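(* Let $\Gamma=(\mathscr{C},\mathscr{X},I,H,\eta,\epsilon,\mathcal{E},\mathcal{F})$ be a Galois structure such that (1) the induced Galois structure $\Gamma_{\mathrm{Split}}=(\mathscr{C},\mathscr{X},I,H,\eta,\epsilon,\mathrm{Split}(\mathcal{E}),\mathrm{Split}(\mathcal{F}))$ is admissible; (2) every morphism in $\mathcal{E}$ is a regular epimorphism. Let $K\colon\mathrm{Ext}_{\mathrm{Split}(\mathcal{E})}(\mathscr{C})\to\mathrm{Ext}_{\mathcal{E}}(\mathscr{C})$ and $\tilde K\colon\mathrm{TExt}_{\Gamma_{\mathrm{Split}}}(\mathscr{C})\to\mathrm{NExt}_{\Gamma}(\mathscr{C})$ be the inclusion functors, and let $T_1\colon\mathrm{Ext}_{\mathrm{Split}(\mathcal{E})}(\mathscr{C})\to\mathrm{TExt}_{\Gamma_{\mathrm{Split}}}(\mathscr{C})$ be the left adjoint of the inclusion functor $\mathrm{TExt}_{\Gamma_{\mathrm{Split}}}(\mathscr{C})\to\mathrm{Ext}_{\mathrm{Split}(\mathcal{E})}(\mathscr{C})$. Then the inclusion functor $H_1\colon\mathrm{NExt}_{\Gamma}(\mathscr{C})\to\mathrm{Ext}_{\mathcal{E}}(\mathscr{C})$ has a left adjoint $I_1$ if and only if the pointwise left Kan extension of $\tilde K\circ T_1\colon\mathrm{Ext}_{\mathrm{Split}(\mathcal{E})}(\mathscr{C})\to\mathrm{NExt}_{\Gamma}(\mathscr{C})$ along $K$ exists and, in this case, $I_1=\mathrm{Lan}_K(\tilde K\circ T_1)$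 (up to natural isomorphism).
   Context: A Galois structure $\Gamma=(\mathscr{C},\mathscr{X},I,H,\eta,\epsilon,\mathcal{E},\mathcal{F})$ consists of categories $\mathscr{C}$, $\mathscr{X}$, an adjunction $I\dashv H$ with left adjoint $I\colon\mathscr{C}\to\mathscr{X}$, right adjoint $H\colon\mathscr{X}\to\mathscr{C}$, unit $\eta\colon 1_{\mathscr{C}}\Rightarrow HI$ and counit $\epsilon\colon IH\Rightarrow 1_{\mathscr{X}}$, and classes $\mathcal{E}$, $\mathcal{F}$ of morphisms of $\mathscr{C}$, $\mathscr{X}$ respectively. Each class contains all isomorphisms, is closed under composition, and is closed under pullback (pullbacks of its members along arbitrary morphisms exist and are again in the class). Moreover $I(\mathcal{E})\subseteq\mathcal{F}$ and $H(\mathcal{F})\subseteq\mathcal{E}$. Morphisms in $\mathcal{E}$ are called extensions. $(\mathscr{C}\downarrow_{\mathcal{E}}B)$ and $(\mathscr{X}\downarrow_{\mathcal{F}}Y)$ are the full subcategories of the comma (slice) categories $(\mathscr{C}\downarrow B)$ and $(\mathscr{X}\downarrow Y)$ determined by $\mathcal{E}$ and $\mathcal{F}$. For an extension $p\colon E\to B$, $p^*\colon(\mathscr{C}\downarrow_{\mathcal{E}}B)\to(\mathscr{C}\downarrow_{\mathcal{E}}E)$ is the change-of-base (pullback along $p$) functor. An extension $f\colon A\to B$ is: - trivial if the naturality square $HI(f)\circ\eta_A=\eta_B\circ f$ is a pullback; - monadic if $f^*\colon(\mathscr{C}\downarrow_{\mathcal{E}}B)\to(\mathscr{C}\downarrow_{\mathcal{E}}A)$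 is a monadic functor; - normal if it is monadic and $f^*(f)$ (the first kernel pair projection $A\times_BA\to A$) is a trivial extension. $\mathrm{Split}(\mathcal{E})$ and $\mathrm{Split}(\mathcal{F})$ are the classes of morphisms in $\mathcal{E}$, respectively $\mathcal{F}$, that are also split epimorphisms. Admissibility: for a Galois structure $\Gamma=(\mathscr{C},\mathscr{X},I,H,\eta,\epsilon,\mathcal{E},\mathcal{F})$ and $B\in\mathscr{C}$, the functor $H^B\colon(\mathscr{X}\downarrow_{\mathcal{F}}I(B))\to(\mathscr{C}\downarrow_{\mathcal{E}}B)$ sends $\varphi\colon X\to I(B)$ to the pullback of $H(\varphi)\colon H(X)\to HI(B)$ along $\eta_B\colon B\to HI(B)$. The Galois structure is admissible when $H^B$ is fully faithful for every $B\in\mathscr{C}$. (For $\Gamma_{\mathrm{Split}}$, use $\mathrm{Split}(\mathcal{E})$, $\mathrm{Split}(\mathcal{F})$ in place of $\mathcal{E}$, $\mathcal{F}$.) $\mathrm{Ext}_{\mathcal{E}}(\mathscr{C})$ is the full subcategory of the arrow category of $\mathscr{C}$ on the extensions (a morphism from $f\colon A\to B$ to $g\colon C\to D$ is a pair $(h_1\colon A\to C,h_0\colon B\to D)$ with $gh_1=h_0f$). Its full subcategories are: $\mathrm{Ext}_{\mathrm{Split}(\mathcal{E})}(\mathscr{C})$, on the extensions that are split epimorphisms; $\mathrm{NExt}_{\Gamma}(\mathscr{C})$, on the normal extensions; $\mathrm{TExt}_{\Gamma_{\mathrm{Split}}}(\mathscr{C})$, on the trivial extensions that are split epimorphisms.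 When $\Gamma_{\mathrm{Split}}$ is admissible, every split epic trivial extension is normal (so $\tilde K$ is well defined) and the left adjoint $T_1$ exists. The left Kan extension of a functor $F\colon\mathscr{A}\to\mathscr{D}$ along $K\colon\mathscr{A}\to\mathscr{B}$ is pointwise when it is computed by colimits: for each object $f$ of $\mathscr{B}$, the colimit in $\mathscr{D}$ of $F\circ P^f$ exists and gives $\mathrm{Lan}_K(F)(f)$, where $P^f\colon(K\downarrow f)\to\mathscr{A}$ is the forgetful functor from the comma category. *)

theory Defs
  imports Main
begin

section \<open>Categories, functors, natural transformations\<close>

text \<open>
  Objects and arrows are carried by sets. Functors and transformations are total functions of which
  only the values on the carriers matter, so uniqueness of a transformation is always stated
  componentwise on the objects.
\<close>

record ('o, 'a) cat =
  Obj :: "'o set"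
  Arr :: "'a set"
  Dom :: "'a \<Rightarrow> 'o"
  Cod :: "'a \<Rightarrow> 'o"
  Idn :: "'o \<Rightarrow> 'a"
  Comp :: "'a \<Rightarrow> 'a \<Rightarrow> 'a" (infixr "\<cdot>\<index>" 75)

definition Hom :: "('o, 'a) cat \<Rightarrow> 'o \<Rightarrow> 'o \<Rightarrow> 'a set" where
  "Hom C x y = {f \<in> Arr C. Dom C f = x \<and> Cod C f = y}"

locale category =
  fixes C :: "('o, 'a) cat" (structure)
  assumes dom_obj: "f \<in> Arr C \<Longrightarrow> Dom C f \<in> Obj C"
    and cod_obj: "f \<in> Arr C \<Longrightarrow> Cod C f \<in> Obj C"
    and idn_hom: "x \<in> Obj C \<Longrightarrow> Idn C x \<in> Hom C x x"
    and comp_hom: "\<lbrakk>f \<in> Hom C x y; g \<in> Hom C y z\<rbrakk> \<Longrightarrow> g \<cdot> f \<in> Hom C x z"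
    and comp_idn: "f \<in> Hom C x y \<Longrightarrow> f \<cdot> Idn C x = f"
    and idn_comp: "f \<in> Hom C x y \<Longrightarrow> Idn C y \<cdot> f = f"
    and comp_assoc: "\<lbrakk>f \<in> Hom C w x; g \<in> Hom C x y; h \<in> Hom C y z\<rbrakk>
                     \<Longrightarrow> (h \<cdot> g) \<cdot> f = h \<cdot> (g \<cdot> f)"

record ('o, 'a, 'p, 'b) func =
  FObj :: "'o \<Rightarrow> 'p"
  FArr :: "'a \<Rightarrow> 'b"

locale cat_functor = A: category A + B: category B
  for A :: "('o, 'a) cat" and B :: "('p, 'b) cat" and F :: "('o, 'a, 'p, 'b) func" +
  assumes obj: "x \<in> Obj A \<Longrightarrow> FObj F x \<in> Obj B"
    and hom: "f \<in> Hom A x y \<Longrightarrow> FArr F f \<in> Hom B (FObj F x) (FObj F y)"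
    and idn: "x \<in> Obj A \<Longrightarrow> FArr F (Idn A x) = Idn B (FObj F x)"
    and comp: "\<lbrakk>f \<in> Hom A x y; g \<in> Hom A y z\<rbrakk>
               \<Longrightarrow> FArr F (g \<cdot>\<^bsub>A\<^esub> f) = FArr F g \<cdot>\<^bsub>B\<^esub> FArr F f"

definition id_func :: "('o, 'a, 'o, 'a) func" where
  "id_func = \<lparr>FObj = (\<lambda>x. x), FArr = (\<lambda>f. f)\<rparr>"

definition comp_func ::
    "('p, 'b, 'q, 'c) func \<Rightarrow> ('o, 'a, 'p, 'b) func \<Rightarrow> ('o, 'a, 'q, 'c) func"
    (infixr "\<circ>\<^sub>F" 75) where
  "G \<circ>\<^sub>F F = \<lparr>FObj = (\<lambda>x. FObj G (FObj F x)), FArr = (\<lambda>f. FArr G (FArr F f))\<rparr>"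

locale nat_trans = F: cat_functor A B F + G: cat_functor A B G
  for A :: "('o, 'a) cat" and B :: "('p, 'b) cat"
    and F :: "('o, 'a, 'p, 'b) func" and G :: "('o, 'a, 'p, 'b) func" and \<tau> :: "'o \<Rightarrow> 'b" +
  assumes component: "x \<in> Obj A \<Longrightarrow> \<tau> x \<in> Hom B (FObj F x) (FObj G x)"
    and naturality: "f \<in> Hom A x y \<Longrightarrow> \<tau> y \<cdot>\<^bsub>B\<^esub> FArr F f = FArr G f \<cdot>\<^bsub>B\<^esub> \<tau> x"

definition iso :: "('o, 'a) cat \<Rightarrow> 'a \<Rightarrow> bool" where
  "iso C f \<longleftrightarrow> f \<in> Arr C \<and> (\<exists>g \<in> Hom C (Cod C f) (Dom C f).
     g \<cdot>\<^bsub>C\<^esub> f = Idn C (Dom C f) \<and> f \<cdot>\<^bsub>C\<^esub> g = Idn C (Cod C f))"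

definition naturally_isomorphic ::
    "('o, 'a) cat \<Rightarrow> ('p, 'b) cat \<Rightarrow> ('o, 'a, 'p, 'b) func \<Rightarrow> ('o, 'a, 'p, 'b) func \<Rightarrow> bool" where
  "naturally_isomorphic A B F G \<longleftrightarrow> (\<exists>\<tau>. nat_trans A B F G \<tau> \<and> (\<forall>x \<in> Obj A. iso B (\<tau> x)))"

definition fully_faithful ::
    "('o, 'a) cat \<Rightarrow> ('p, 'b) cat \<Rightarrow> ('o, 'a, 'p, 'b) func \<Rightarrow> bool" where
  "fully_faithful A B F \<longleftrightarrow> cat_functor A B F \<and>
     (\<forall>x \<in> Obj A. \<forall>y \<in> Obj A. bij_betw (FArr F) (Hom A x y) (Hom B (FObj F x) (FObj F y)))"

definition equivalence ::
    "('o, 'a) cat \<Rightarrow> ('p, 'b) cat \<Rightarrow> ('o, 'a, 'p, 'b) func \<Rightarrow> bool" where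
  "equivalence A B F \<longleftrightarrow> cat_functor A B F \<and> (\<exists>G. cat_functor B A G \<and>
     naturally_isomorphic A A (G \<circ>\<^sub>F F) id_func \<and> naturally_isomorphic B B (F \<circ>\<^sub>F G) id_func)"

definition full_subcat :: "('o, 'a) cat \<Rightarrow> 'o set \<Rightarrow> ('o, 'a) cat" where
  "full_subcat C S = C\<lparr>Obj := S, Arr := {f \<in> Arr C. Dom C f \<in> S \<and> Cod C f \<in> S}\<rparr>"


section \<open>Adjunctions and monadic functors\<close>

locale adjunction =
  unit: nat_trans A A id_func "G \<circ>\<^sub>F F" \<eta> + counit: nat_trans X X "F \<circ>\<^sub>F G" id_func \<epsilon> +
  left: cat_functor A X F + right: cat_functor X A G
  for A :: "('o, 'a) cat" and X :: "('p, 'b) cat"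
    and F :: "('o, 'a, 'p, 'b) func" and G :: "('p, 'b, 'o, 'a) func"
    and \<eta> :: "'o \<Rightarrow> 'a" and \<epsilon> :: "'p \<Rightarrow> 'b" +
  assumes triangle_left: "a \<in> Obj A \<Longrightarrow> \<epsilon> (FObj F a) \<cdot>\<^bsub>X\<^esub> FArr F (\<eta> a) = Idn X (FObj F a)"
    and triangle_right: "x \<in> Obj X \<Longrightarrow> FArr G (\<epsilon> x) \<cdot>\<^bsub>A\<^esub> \<eta> (FObj G x) = Idn A (FObj G x)"

definition left_adjoint ::
    "('o, 'a) cat \<Rightarrow> ('p, 'b) cat \<Rightarrow> ('o, 'a, 'p, 'b) func \<Rightarrow> ('p, 'b, 'o, 'a) func \<Rightarrow> bool" where
  "left_adjoint A X F G \<longleftrightarrow> (\<exists>\<eta> \<epsilon>. adjunction A X F G \<eta> \<epsilon>)"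

definition em_algebras ::
    "('o, 'a) cat \<Rightarrow> ('o, 'a, 'o, 'a) func \<Rightarrow> ('o \<Rightarrow> 'a) \<Rightarrow> ('o \<Rightarrow> 'a) \<Rightarrow> ('o \<times> 'a) set" where
  "em_algebras A T \<eta> \<mu> = {(x, \<xi>). x \<in> Obj A \<and> \<xi> \<in> Hom A (FObj T x) x \<and>
     \<xi> \<cdot>\<^bsub>A\<^esub> \<eta> x = Idn A x \<and> \<xi> \<cdot>\<^bsub>A\<^esub> \<mu> x = \<xi> \<cdot>\<^bsub>A\<^esub> FArr T \<xi>}"

text \<open>The Eilenberg--Moore category of a monad. Arrows record their source and target algebra.\<close>

definition em_cat ::
    "('o, 'a) cat \<Rightarrow> ('o, 'a, 'o, 'a) func \<Rightarrow> ('o \<Rightarrow> 'a) \<Rightarrow> ('o \<Rightarrow> 'a)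
     \<Rightarrow> ('o \<times> 'a, ('o \<times> 'a) \<times> ('o \<times> 'a) \<times> 'a) cat" where
  "em_cat A T \<eta> \<mu> = \<lparr>
     Obj = em_algebras A T \<eta> \<mu>,
     Arr = {((x, \<xi>), (y, \<theta>), h). (x, \<xi>) \<in> em_algebras A T \<eta> \<mu> \<and> (y, \<theta>) \<in> em_algebras A T \<eta> \<mu> \<and>
              h \<in> Hom A x y \<and> h \<cdot>\<^bsub>A\<^esub> \<xi> = \<theta> \<cdot>\<^bsub>A\<^esub> FArr T h},
     Dom = (\<lambda>(s, t, h). s),
     Cod = (\<lambda>(s, t, h). t),
     Idn = (\<lambda>(x, \<xi>). ((x, \<xi>), (x, \<xi>), Idn A x)),
     Comp = (\<lambda>(s', t', h') (s, t, h). (s, t', h' \<cdot>\<^bsub>A\<^esub> h))\<rparr>"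

definition comparison ::
    "('p, 'b) cat \<Rightarrow> ('p, 'b, 'o, 'a) func \<Rightarrow> ('p \<Rightarrow> 'b)
     \<Rightarrow> ('p, 'b, 'o \<times> 'a, ('o \<times> 'a) \<times> ('o \<times> 'a) \<times> 'a) func" where
  "comparison X U \<epsilon> = (let k = (\<lambda>x. (FObj U x, FArr U (\<epsilon> x)))
     in \<lparr>FObj = k, FArr = (\<lambda>f. (k (Dom X f), k (Cod X f), FArr U f))\<rparr>)"

text \<open>Monadicity is up to equivalence: the comparison functor need not be an isomorphism.\<close>

definition monadic_functor ::
    "('p, 'b) cat \<Rightarrow> ('o, 'a) cat \<Rightarrow> ('p, 'b, 'o, 'a) func \<Rightarrow> bool" where
  "monadic_functor X A U \<longleftrightarrow> (\<exists>L \<eta> \<epsilon>. adjunction A X L U \<eta> \<epsilon> \<and>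
     equivalence X (em_cat A (U \<circ>\<^sub>F L) \<eta> (\<lambda>a. FArr U (\<epsilon> (FObj L a)))) (comparison X U \<epsilon>))"


section \<open>Pullbacks, coequalizers, slices\<close>

definition is_pullback :: "('o, 'a) cat \<Rightarrow> 'a \<Rightarrow> 'a \<Rightarrow> 'a \<Rightarrow> 'a \<Rightarrow> bool" where
  "is_pullback C f g p q \<longleftrightarrow>
     f \<in> Arr C \<and> g \<in> Arr C \<and> p \<in> Arr C \<and> q \<in> Arr C \<and>
     Cod C f = Cod C g \<and> Cod C p = Dom C f \<and> Cod C q = Dom C g \<and> Dom C p = Dom C q \<and>
     f \<cdot>\<^bsub>C\<^esub> p = g \<cdot>\<^bsub>C\<^esub> q \<and>
     (\<forall>z. \<forall>u \<in> Hom C z (Dom C f). \<forall>v \<in> Hom C z (Dom C g). f \<cdot>\<^bsub>C\<^esub> u = g \<cdot>\<^bsub>C\<^esub> v \<longrightarrow>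
        (\<exists>!w. w \<in> Hom C z (Dom C p) \<and> p \<cdot>\<^bsub>C\<^esub> w = u \<and> q \<cdot>\<^bsub>C\<^esub> w = v))"

definition regular_epi :: "('o, 'a) cat \<Rightarrow> 'a \<Rightarrow> bool" where
  "regular_epi C f \<longleftrightarrow> f \<in> Arr C \<and>
     (\<exists>r. \<exists>u \<in> Hom C r (Dom C f). \<exists>v \<in> Hom C r (Dom C f). f \<cdot>\<^bsub>C\<^esub> u = f \<cdot>\<^bsub>C\<^esub> v \<and>
        (\<forall>z. \<forall>g \<in> Hom C (Dom C f) z. g \<cdot>\<^bsub>C\<^esub> u = g \<cdot>\<^bsub>C\<^esub> v \<longrightarrow>
           (\<exists>!w. w \<in> Hom C (Cod C f) z \<and> w \<cdot>\<^bsub>C\<^esub> f = g)))"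

definition split_epi :: "('o, 'a) cat \<Rightarrow> 'a \<Rightarrow> bool" where
  "split_epi C f \<longleftrightarrow> f \<in> Arr C \<and> (\<exists>s \<in> Hom C (Cod C f) (Dom C f). f \<cdot>\<^bsub>C\<^esub> s = Idn C (Cod C f))"

text \<open>Arrows of the slice over \<open>b\<close> are triples (source, target, underlying arrow of \<open>C\<close>).\<close>

definition slice :: "('o, 'a) cat \<Rightarrow> 'o \<Rightarrow> ('a, 'a \<times> 'a \<times> 'a) cat" where
  "slice C b = \<lparr>
     Obj = {f \<in> Arr C. Cod C f = b},
     Arr = {(f, g, h). f \<in> Arr C \<and> g \<in> Arr C \<and> Cod C f = b \<and> Cod C g = b \<and>
              h \<in> Hom C (Dom C f) (Dom C g) \<and> g \<cdot>\<^bsub>C\<^esub> h = f},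
     Dom = (\<lambda>(f, g, h). f),
     Cod = (\<lambda>(f, g, h). g),
     Idn = (\<lambda>f. (f, f, Idn C (Dom C f))),
     Comp = (\<lambda>(f', g', h') (f, g, h). (f, g', h' \<cdot>\<^bsub>C\<^esub> h))\<rparr>"

definition slice_in :: "('o, 'a) cat \<Rightarrow> 'a set \<Rightarrow> 'o \<Rightarrow> ('a, 'a \<times> 'a \<times> 'a) cat" where
  "slice_in C E b = full_subcat (slice C b) {f \<in> E. Cod C f = b}"

text \<open>
  \<open>pb_along C p f\<close> is a chosen pullback of \<open>f\<close> along \<open>p\<close>: a pair of the projection to the domain
  of \<open>f\<close> and the projection to the domain of \<open>p\<close>.
\<close>

definition pb_along :: "('o, 'a) cat \<Rightarrow> 'a \<Rightarrow> 'a \<Rightarrow> 'a \<times> 'a" where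
  "pb_along C p f = (SOME pq. is_pullback C f p (fst pq) (snd pq))"

definition base_change :: "('o, 'a) cat \<Rightarrow> 'a \<Rightarrow> ('a, 'a \<times> 'a \<times> 'a, 'a, 'a \<times> 'a \<times> 'a) func" where
  "base_change C p = \<lparr>
     FObj = (\<lambda>f. snd (pb_along C p f)),
     FArr = (\<lambda>(f, g, h). (snd (pb_along C p f), snd (pb_along C p g),
        THE w. w \<in> Hom C (Dom C (snd (pb_along C p f))) (Dom C (snd (pb_along C p g))) \<and>
               fst (pb_along C p g) \<cdot>\<^bsub>C\<^esub> w = h \<cdot>\<^bsub>C\<^esub> fst (pb_along C p f) \<and>
               snd (pb_along C p g) \<cdot>\<^bsub>C\<^esub> w = snd (pb_along C p f)))\<rparr>"


section \<open>Galois structures\<close>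

definition morphism_class :: "('o, 'a) cat \<Rightarrow> 'a set \<Rightarrow> bool" where
  "morphism_class C E \<longleftrightarrow> E \<subseteq> Arr C \<and>
     (\<forall>f. iso C f \<longrightarrow> f \<in> E) \<and>
     (\<forall>f \<in> E. \<forall>g \<in> E. Cod C f = Dom C g \<longrightarrow> g \<cdot>\<^bsub>C\<^esub> f \<in> E) \<and>
     (\<forall>f \<in> E. \<forall>g \<in> Arr C. Cod C g = Cod C f \<longrightarrow>
        (\<exists>p q. is_pullback C f g p q) \<and> (\<forall>p q. is_pullback C f g p q \<longrightarrow> q \<in> E))"

locale galois_structure = adjunction C X I H \<eta> \<epsilon>
  for C :: "('o, 'a) cat" and X :: "('p, 'b) cat"
    and I :: "('o, 'a, 'p, 'b) func" and H :: "('p, 'b, 'o, 'a) func"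
    and \<eta> :: "'o \<Rightarrow> 'a" and \<epsilon> :: "'p \<Rightarrow> 'b" +
  fixes E :: "'a set" and F :: "'b set"
  assumes class_E: "morphism_class C E"
    and class_F: "morphism_class X F"
    and I_E: "f \<in> E \<Longrightarrow> FArr I f \<in> F"
    and H_F: "\<phi> \<in> F \<Longrightarrow> FArr H \<phi> \<in> E"

definition Split :: "('o, 'a) cat \<Rightarrow> 'a set \<Rightarrow> 'a set" where
  "Split C E = {f \<in> E. split_epi C f}"

definition slice_func ::
    "('p, 'b, 'o, 'a) func \<Rightarrow> ('b, 'b \<times> 'b \<times> 'b, 'a, 'a \<times> 'a \<times> 'a) func" where
  "slice_func H = \<lparr>FObj = FArr H, FArr = (\<lambda>(\<phi>, \<psi>, h). (FArr H \<phi>, FArr H \<psi>, FArr H h))\<rparr>"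

definition admissible ::
    "('o, 'a) cat \<Rightarrow> ('p, 'b) cat \<Rightarrow> ('o, 'a, 'p, 'b) func \<Rightarrow> ('p, 'b, 'o, 'a) func
     \<Rightarrow> ('o \<Rightarrow> 'a) \<Rightarrow> 'a set \<Rightarrow> 'b set \<Rightarrow> bool" where
  "admissible C X I H \<eta> E F \<longleftrightarrow> (\<forall>b \<in> Obj C.
     fully_faithful (slice_in X F (FObj I b)) (slice_in C E b)
       (base_change C (\<eta> b) \<circ>\<^sub>F slice_func H))"

definition trivial_ext ::
    "('o, 'a) cat \<Rightarrow> ('o, 'a, 'p, 'b) func \<Rightarrow> ('p, 'b, 'o, 'a) func \<Rightarrow> ('o \<Rightarrow> 'a)
     \<Rightarrow> 'a set \<Rightarrow> 'a \<Rightarrow> bool" where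
  "trivial_ext C I H \<eta> E f \<longleftrightarrow>
     f \<in> E \<and> is_pullback C (FArr H (FArr I f)) (\<eta> (Cod C f)) (\<eta> (Dom C f)) f"

definition monadic_ext :: "('o, 'a) cat \<Rightarrow> 'a set \<Rightarrow> 'a \<Rightarrow> bool" where
  "monadic_ext C E f \<longleftrightarrow>
     f \<in> E \<and> monadic_functor (slice_in C E (Cod C f)) (slice_in C E (Dom C f)) (base_change C f)"

definition normal_ext ::
    "('o, 'a) cat \<Rightarrow> ('o, 'a, 'p, 'b) func \<Rightarrow> ('p, 'b, 'o, 'a) func \<Rightarrow> ('o \<Rightarrow> 'a)
     \<Rightarrow> 'a set \<Rightarrow> 'a \<Rightarrow> bool" where
  "normal_ext C I H \<eta> E f \<longleftrightarrow>
     monadic_ext C E f \<and> trivial_ext C I H \<eta> E (FObj (base_change C f) f)"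


section \<open>Categories of extensions\<close>

text \<open>Arrows of the arrow category are commutative squares \<open>(f, g, h\<^sub>1, h\<^sub>0)\<close> from \<open>f\<close> to \<open>g\<close>.\<close>

definition arrow_cat :: "('o, 'a) cat \<Rightarrow> ('a, 'a \<times> 'a \<times> 'a \<times> 'a) cat" where
  "arrow_cat C = \<lparr>
     Obj = Arr C,
     Arr = {(f, g, h\<^sub>1, h\<^sub>0). f \<in> Arr C \<and> g \<in> Arr C \<and>
              h\<^sub>1 \<in> Hom C (Dom C f) (Dom C g) \<and> h\<^sub>0 \<in> Hom C (Cod C f) (Cod C g) \<and>
              g \<cdot>\<^bsub>C\<^esub> h\<^sub>1 = h\<^sub>0 \<cdot>\<^bsub>C\<^esub> f},
     Dom = (\<lambda>(f, g, h\<^sub>1, h\<^sub>0). f),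
     Cod = (\<lambda>(f, g, h\<^sub>1, h\<^sub>0). g),
     Idn = (\<lambda>f. (f, f, Idn C (Dom C f), Idn C (Cod C f))),
     Comp = (\<lambda>(f', g', h\<^sub>1', h\<^sub>0') (f, g, h\<^sub>1, h\<^sub>0). (f, g', h\<^sub>1' \<cdot>\<^bsub>C\<^esub> h\<^sub>1, h\<^sub>0' \<cdot>\<^bsub>C\<^esub> h\<^sub>0))\<rparr>"

definition Ext :: "('o, 'a) cat \<Rightarrow> 'a set \<Rightarrow> ('a, 'a \<times> 'a \<times> 'a \<times> 'a) cat" where
  "Ext C E = full_subcat (arrow_cat C) E"

definition NExt ::
    "('o, 'a) cat \<Rightarrow> ('o, 'a, 'p, 'b) func \<Rightarrow> ('p, 'b, 'o, 'a) func \<Rightarrow> ('o \<Rightarrow> 'a)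
     \<Rightarrow> 'a set \<Rightarrow> ('a, 'a \<times> 'a \<times> 'a \<times> 'a) cat" where
  "NExt C I H \<eta> E = full_subcat (arrow_cat C) {f. normal_ext C I H \<eta> E f}"

definition TExt ::
    "('o, 'a) cat \<Rightarrow> ('o, 'a, 'p, 'b) func \<Rightarrow> ('p, 'b, 'o, 'a) func \<Rightarrow> ('o \<Rightarrow> 'a)
     \<Rightarrow> 'a set \<Rightarrow> ('a, 'a \<times> 'a \<times> 'a \<times> 'a) cat" where
  "TExt C I H \<eta> E = full_subcat (arrow_cat C) {f. trivial_ext C I H \<eta> E f}"

text \<open>
  The inclusion of one full subcategory of the arrow category in a larger one; source and target
  category are determined by the context of use.
\<close>

abbreviation inclusion ::
    "('a, 'a \<times> 'a \<times> 'a \<times> 'a, 'a, 'a \<times> 'a \<times> 'a \<times> 'a) func" where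
  "inclusion \<equiv> id_func"


section \<open>Colimits and pointwise left Kan extensions\<close>

definition is_cocone ::
    "('j, 'k) cat \<Rightarrow> ('o, 'a) cat \<Rightarrow> ('j, 'k, 'o, 'a) func \<Rightarrow> 'o \<Rightarrow> ('j \<Rightarrow> 'a) \<Rightarrow> bool" where
  "is_cocone J D \<Delta> c \<sigma> \<longleftrightarrow> c \<in> Obj D \<and>
     (\<forall>j \<in> Obj J. \<sigma> j \<in> Hom D (FObj \<Delta> j) c) \<and>
     (\<forall>i j. \<forall>u \<in> Hom J i j. \<sigma> j \<cdot>\<^bsub>D\<^esub> FArr \<Delta> u = \<sigma> i)"

definition is_colimit ::
    "('j, 'k) cat \<Rightarrow> ('o, 'a) cat \<Rightarrow> ('j, 'k, 'o, 'a) func \<Rightarrow> 'o \<Rightarrow> ('j \<Rightarrow> 'a) \<Rightarrow> bool" where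
  "is_colimit J D \<Delta> c \<sigma> \<longleftrightarrow> cat_functor J D \<Delta> \<and> is_cocone J D \<Delta> c \<sigma> \<and>
     (\<forall>z \<rho>. is_cocone J D \<Delta> z \<rho> \<longrightarrow>
        (\<exists>!w. w \<in> Hom D c z \<and> (\<forall>j \<in> Obj J. w \<cdot>\<^bsub>D\<^esub> \<sigma> j = \<rho> j)))"

text \<open>The comma category \<open>(K \<down> b)\<close>, with arrows (source, target, underlying arrow of \<open>A\<close>).\<close>

definition comma ::
    "('o, 'a) cat \<Rightarrow> ('p, 'b) cat \<Rightarrow> ('o, 'a, 'p, 'b) func \<Rightarrow> 'p
     \<Rightarrow> ('o \<times> 'b, ('o \<times> 'b) \<times> ('o \<times> 'b) \<times> 'a) cat" where
  "comma A B K b = \<lparr>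
     Obj = {(x, k). x \<in> Obj A \<and> k \<in> Hom B (FObj K x) b},
     Arr = {((x, k), (y, l), u). x \<in> Obj A \<and> k \<in> Hom B (FObj K x) b \<and>
              y \<in> Obj A \<and> l \<in> Hom B (FObj K y) b \<and> u \<in> Hom A x y \<and> l \<cdot>\<^bsub>B\<^esub> FArr K u = k},
     Dom = (\<lambda>(s, t, u). s),
     Cod = (\<lambda>(s, t, u). t),
     Idn = (\<lambda>(x, k). ((x, k), (x, k), Idn A x)),
     Comp = (\<lambda>(s', t', u') (s, t, u). (s, t', u' \<cdot>\<^bsub>A\<^esub> u))\<rparr>"

definition comma_proj :: "('o \<times> 'b, ('o \<times> 'b) \<times> ('o \<times> 'b) \<times> 'a, 'o, 'a) func" where
  "comma_proj = \<lparr>FObj = fst, FArr = (\<lambda>(s, t, u). u)\<rparr>"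

definition is_left_kan_extension ::
    "('o, 'a) cat \<Rightarrow> ('p, 'b) cat \<Rightarrow> ('q, 'c) cat \<Rightarrow> ('o, 'a, 'p, 'b) func \<Rightarrow> ('o, 'a, 'q, 'c) func
     \<Rightarrow> ('p, 'b, 'q, 'c) func \<Rightarrow> ('o \<Rightarrow> 'c) \<Rightarrow> bool" where
  "is_left_kan_extension A B D K F L \<alpha> \<longleftrightarrow>
     cat_functor A B K \<and> cat_functor B D L \<and> nat_trans A D F (L \<circ>\<^sub>F K) \<alpha> \<and>
     (\<forall>G \<gamma>. cat_functor B D G \<and> nat_trans A D F (G \<circ>\<^sub>F K) \<gamma> \<longrightarrow>
        (\<exists>\<beta>. nat_trans B D L G \<beta> \<and>
             (\<forall>x \<in> Obj A. \<beta> (FObj K x) \<cdot>\<^bsub>D\<^esub> \<alpha> x = \<gamma> x) \<and>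
             (\<forall>\<beta>'. nat_trans B D L G \<beta>' \<and>
                   (\<forall>x \<in> Obj A. \<beta>' (FObj K x) \<cdot>\<^bsub>D\<^esub> \<alpha> x = \<gamma> x) \<longrightarrow>
                   (\<forall>y \<in> Obj B. \<beta>' y = \<beta> y))))"

text \<open>
  The colimit cocone at \<open>b\<close> is the canonical one, with component \<open>L k \<circ> \<alpha> x\<close> at \<open>(x, k : K x \<rightarrow> b)\<close>.
\<close>

definition is_pointwise_left_kan_extension ::
    "('o, 'a) cat \<Rightarrow> ('p, 'b) cat \<Rightarrow> ('q, 'c) cat \<Rightarrow> ('o, 'a, 'p, 'b) func \<Rightarrow> ('o, 'a, 'q, 'c) func
     \<Rightarrow> ('p, 'b, 'q, 'c) func \<Rightarrow> ('o \<Rightarrow> 'c) \<Rightarrow> bool" where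
  "is_pointwise_left_kan_extension A B D K F L \<alpha> \<longleftrightarrow>
     is_left_kan_extension A B D K F L \<alpha> \<and>
     (\<forall>b \<in> Obj B. is_colimit (comma A B K b) D (F \<circ>\<^sub>F comma_proj) (FObj L b)
        (\<lambda>(x, k). FArr L k \<cdot>\<^bsub>D\<^esub> \<alpha> x))"

end

theory Submission
  imports Defs
begin

text \<open>
  Write \<open>M\<close> for the arrow category of \<open>C\<close>. The theorem compares two universal properties of an object
  attached to an extension \<open>f\<close>: being the reflection of \<open>f\<close> in the normal extensions, and being the
  colimit of the objects \<open>T\<^sub>1 s\<close>, indexed by all arrows \<open>s \<rightarrow> f\<close> of \<open>M\<close> with \<open>s\<close> a split epic extension. Both
  amount to representing the same functor on normal extensions, namely \<open>g \<mapsto> M(f, g)\<close>, because of two facts.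

  \<^item> Density (\<open>split_extensions_dense\<close>): an arrow \<open>f \<rightarrow> g\<close> is the same thing as a cocone with vertex \<open>g\<close>
    over all split epic extensions above \<open>f\<close>. The identity of the domain of \<open>f\<close> is such an extension and
    determines the upper half of the arrow; the lower half comes from \<open>f\<close> being a regular epimorphism.
  \<^item> Transfer (\<open>reflection_universal_for_normal\<close>): although \<open>T\<^sub>1 s\<close> is only assumed to be universal among
    split epic trivial extensions, arrows \<open>s \<rightarrow> g\<close> into any normal \<open>g\<close> factor uniquely through the unit
    \<open>s \<rightarrow> T\<^sub>1 s\<close>. Indeed a square from a split epic extension to \<open>g\<close> has a lower side that lifts through
    \<open>g\<close>, and the pullback of a normal extension along such an arrow is trivial, being a pullback of its
    kernel pair projection.

  The second fact uses that split epic trivial extensions are stable under pullback. Admissibility of the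
  split Galois structure gives this: the split epic trivial extensions of \<open>B\<close> are exactly the pullbacks
  along \<open>\<eta>\<^sub>B\<close> of arrows \<open>H \<phi>\<close> with \<open>\<phi>\<close> a split epimorphism in \<open>F\<close> (\<open>trivial_split_if_pullback_of_H\<close>),
  and this description is stable because \<open>H\<close> preserves pullbacks.

  For the statement to make sense, split epic trivial extensions must be normal, hence monadic. Change of
  base along a split epimorphism \<open>f\<close> has a section \<open>s\<close> of \<open>f\<close> to undo it, as \<open>s\<^sup>* f\<^sup>* \<cong> (f s)\<^sup>*\<close> is isomorphic to
  the identity, and any right adjoint with such a retraction is monadic
  (\<open>monadic_if_retracted\<close>).

  The argument combining density and transfer mentions neither pullbacks nor Galois structures and is
  carried out in the locale \<open>densely_reflective\<close>.
\<close>

section \<open>Elementary category theory\<close>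

lemma ex1_implies_eq: "\<lbrakk>\<exists>!x. P x; P a; P b\<rbrakk> \<Longrightarrow> a = b"
  by blast

context category
begin

lemma arr_comp [simp]: "\<lbrakk>f \<in> Arr C; g \<in> Arr C; Cod C f = Dom C g\<rbrakk> \<Longrightarrow> g \<cdot> f \<in> Arr C"
  and dom_comp [simp]: "\<lbrakk>f \<in> Arr C; g \<in> Arr C; Cod C f = Dom C g\<rbrakk> \<Longrightarrow> Dom C (g \<cdot> f) = Dom C f"
  and cod_comp [simp]: "\<lbrakk>f \<in> Arr C; g \<in> Arr C; Cod C f = Dom C g\<rbrakk> \<Longrightarrow> Cod C (g \<cdot> f) = Cod C g"
  using comp_hom[of f "Dom C f" "Cod C f" g "Cod C g"] by (auto simp: Hom_def)

lemma arr_idn [simp]: "x \<in> Obj C \<Longrightarrow> Idn C x \<in> Arr C"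
  and dom_idn [simp]: "x \<in> Obj C \<Longrightarrow> Dom C (Idn C x) = x"
  and cod_idn [simp]: "x \<in> Obj C \<Longrightarrow> Cod C (Idn C x) = x"
  using idn_hom[of x] by (auto simp: Hom_def)

lemma comp_idn_right [simp]: "\<lbrakk>f \<in> Arr C; Dom C f = x\<rbrakk> \<Longrightarrow> f \<cdot> Idn C x = f"
  by (rule comp_idn) (auto simp: Hom_def)

lemma comp_idn_left [simp]: "\<lbrakk>f \<in> Arr C; Cod C f = x\<rbrakk> \<Longrightarrow> Idn C x \<cdot> f = f"
  by (rule idn_comp) (auto simp: Hom_def)

lemma assoc [simp]:
  "\<lbrakk>f \<in> Arr C; g \<in> Arr C; h \<in> Arr C; Cod C f = Dom C g; Cod C g = Dom C h\<rbrakk>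
   \<Longrightarrow> (h \<cdot> g) \<cdot> f = h \<cdot> (g \<cdot> f)"
  by (rule comp_assoc) (auto simp: Hom_def)

text \<open>
  The simplifier associates composites to the right, so a known equation between composites can only be
  used below a further arrow \<open>f\<close> in the extended form given here and in \<open>square_extend\<close>.
\<close>

lemma comp_eq_extend:
  "\<lbrakk>h \<cdot> g = k; f \<in> Arr C; g \<in> Arr C; h \<in> Arr C; Cod C f = Dom C g; Cod C g = Dom C h\<rbrakk>
   \<Longrightarrow> h \<cdot> (g \<cdot> f) = k \<cdot> f"
  by (metis assoc)

lemma square_extend:
  "\<lbrakk>h \<cdot> g = k \<cdot> l; f \<in> Arr C; g \<in> Arr C; h \<in> Arr C; k \<in> Arr C; l \<in> Arr C;
    Cod C f = Dom C g; Cod C g = Dom C h; Cod C l = Dom C k; Cod C f = Dom C l\<rbrakk>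
   \<Longrightarrow> h \<cdot> (g \<cdot> f) = k \<cdot> (l \<cdot> f)"
  by (metis assoc)

declare dom_obj [simp] cod_obj [simp]

lemma HomD: "f \<in> Hom C x y \<Longrightarrow> f \<in> Arr C" "f \<in> Hom C x y \<Longrightarrow> Dom C f = x"
   "f \<in> Hom C x y \<Longrightarrow> Cod C f = y" "f \<in> Hom C x y \<Longrightarrow> x \<in> Obj C" "f \<in> Hom C x y \<Longrightarrow> y \<in> Obj C"
  by (auto simp: Hom_def)

lemma isoI:
  assumes "f \<in> Hom C x y" "g \<in> Hom C y x" "g \<cdot> f = Idn C x" "f \<cdot> g = Idn C y"
  shows "iso C f"
  using assms by (auto simp: iso_def Hom_def)

lemma iso_idn: "x \<in> Obj C \<Longrightarrow> iso C (Idn C x)"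
  by (rule isoI[of _ x x "Idn C x"]) (auto simp: Hom_def)

lemma category_full_subcat: "S \<subseteq> Obj C \<Longrightarrow> category (full_subcat C S)"
  by unfold_locales (auto simp: full_subcat_def Hom_def)

lemma category_slice: "category (slice C b)"
  by (rule category.intro; clarsimp simp: slice_def Hom_def simp del: dom_comp cod_comp)
    (metis dom_comp cod_comp)

lemma paste_squares:
  assumes "g \<cdot> h1 = h0 \<cdot> f" "k \<cdot> l1 = l0 \<cdot> g"
    and "f \<in> Arr C" "g \<in> Arr C" "k \<in> Arr C" "h1 \<in> Arr C" "h0 \<in> Arr C" "l1 \<in> Arr C" "l0 \<in> Arr C"
    and "Dom C h1 = Dom C f" "Cod C h1 = Dom C g" "Dom C h0 = Cod C f" "Cod C h0 = Cod C g"
    and "Dom C l1 = Dom C g" "Cod C l1 = Dom C k" "Dom C l0 = Cod C g" "Cod C l0 = Cod C k"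
  shows "k \<cdot> (l1 \<cdot> h1) = l0 \<cdot> (h0 \<cdot> f)"
proof -
  have "k \<cdot> (l1 \<cdot> h1) = (l0 \<cdot> g) \<cdot> h1"
    using assms(3-) by (intro comp_eq_extend[OF assms(2)]) auto
  also have "\<dots> = l0 \<cdot> (h0 \<cdot> f)"
    using assms(3-) by (simp add: assms(1))
  finally show ?thesis .
qed

lemma category_arrow_cat: "category (arrow_cat C)"
proof (rule category.intro; clarsimp simp: arrow_cat_def Hom_def simp del: dom_comp cod_comp, (intro conjI)?)
qed ((rule paste_squares, assumption+) | metis dom_comp cod_comp)+

end

lemma full_subcat_simps [simp]:
  "Obj (full_subcat C S) = S"
  "Dom (full_subcat C S) = Dom C"
  "Cod (full_subcat C S) = Cod C"
  "Idn (full_subcat C S) = Idn C"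
  "Comp (full_subcat C S) = Comp C"
  by (auto simp: full_subcat_def)

lemma Hom_full_subcat:
  "Hom (full_subcat C S) x y = (if x \<in> S \<and> y \<in> S then Hom C x y else {})"
  by (auto simp: full_subcat_def Hom_def)

context cat_functor
begin

lemma arr_FArr [simp]: "f \<in> Arr A \<Longrightarrow> FArr F f \<in> Arr B"
  and dom_FArr [simp]: "f \<in> Arr A \<Longrightarrow> Dom B (FArr F f) = FObj F (Dom A f)"
  and cod_FArr [simp]: "f \<in> Arr A \<Longrightarrow> Cod B (FArr F f) = FObj F (Cod A f)"
  using hom[of f "Dom A f" "Cod A f"] by (auto simp: Hom_def)

lemma FArr_comp [simp]:
  "\<lbrakk>f \<in> Arr A; g \<in> Arr A; Cod A f = Dom A g\<rbrakk>
   \<Longrightarrow> FArr F (g \<cdot>\<^bsub>A\<^esub> f) = FArr F g \<cdot>\<^bsub>B\<^esub> FArr F f"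
  by (rule comp) (auto simp: Hom_def)

declare obj [simp] idn [simp]

end

lemma id_func_simps [simp]: "FObj id_func x = x" "FArr id_func f = f"
  by (auto simp: id_func_def)

lemma comp_func_simps [simp]:
  "FObj (G \<circ>\<^sub>F F) x = FObj G (FObj F x)" "FArr (G \<circ>\<^sub>F F) f = FArr G (FArr F f)"
  by (auto simp: comp_func_def)

lemma (in category) cat_functor_id: "cat_functor C C id_func"
  by unfold_locales auto

lemma cat_functor_comp:
  assumes "cat_functor A B F" "cat_functor B D G"
  shows "cat_functor A D (G \<circ>\<^sub>F F)"
proof -
  interpret F: cat_functor A B F by fact
  interpret G: cat_functor B D G by fact
  show ?thesis by unfold_locales (auto simp: F.hom G.hom F.comp G.comp[OF F.hom F.hom])
qed

lemma cat_functor_full_inclusion: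
  assumes "category C" "S \<subseteq> S'" "S' \<subseteq> Obj C"
  shows "cat_functor (full_subcat C S) (full_subcat C S') id_func"
proof -
  interpret category C by fact
  interpret S: category "full_subcat C S" using assms by (intro category_full_subcat) auto
  interpret S': category "full_subcat C S'" using assms by (intro category_full_subcat)
  show ?thesis using assms by unfold_locales (auto simp: Hom_full_subcat split: if_splits)
qed

context nat_trans
begin

lemma arr_component [simp]: "x \<in> Obj A \<Longrightarrow> \<tau> x \<in> Arr B"
  and dom_component [simp]: "x \<in> Obj A \<Longrightarrow> Dom B (\<tau> x) = FObj F x"
  and cod_component [simp]: "x \<in> Obj A \<Longrightarrow> Cod B (\<tau> x) = FObj G x"
  using component[of x] by (auto simp: Hom_def)

lemma naturality_arr:
  "f \<in> Arr A \<Longrightarrow> \<tau> (Cod A f) \<cdot>\<^bsub>B\<^esub> FArr F f = FArr G f \<cdot>\<^bsub>B\<^esub> \<tau> (Dom A f)"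
  by (rule naturality) (auto simp: Hom_def)

end

section \<open>Right adjoints with a retraction are monadic\<close>

text \<open>
  By Beck's theorem a right adjoint \<open>U\<close> is monadic when it reflects isomorphisms and the pairs that it turns
  into split pairs have coequalizers which \<open>U\<close> preserves. A functor \<open>V\<close> with \<open>V U \<cong> 1\<close> gives all this: it turns
  the split coequalizer of the image of such a pair back into a split, hence absolute, coequalizer of the pair. For the pairs that come
  from algebras this coequalizer is explicit, and so is the inverse of the comparison functor: it sends an
  algebra \<open>(a, \<xi>)\<close> to \<open>V a\<close>.
\<close>

locale retracted_right_adjoint =
  A: category A + X: category X + adjunction A X L U \<eta> \<epsilon> + V: cat_functor A X V + \<theta>: nat_trans X X "V \<circ>\<^sub>F U" id_func \<theta>
  for A :: "('o, 'a) cat" and X :: "('p, 'b) cat"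
    and L U \<eta> \<epsilon> V \<theta> +
  assumes iso_\<theta>: "x \<in> Obj X \<Longrightarrow> iso X (\<theta> x)"
begin

abbreviation T where "T \<equiv> U \<circ>\<^sub>F L"
abbreviation \<mu> where "\<mu> \<equiv> \<lambda>a. FArr U (\<epsilon> (FObj L a))"
abbreviation EM where "EM \<equiv> em_cat A T \<eta> \<mu>"
abbreviation algs where "algs \<equiv> em_algebras A T \<eta> \<mu>"

lemma category_em: "category EM"
proof -
  have "Idn A x \<cdot>\<^bsub>A\<^esub> \<xi> = \<xi> \<cdot>\<^bsub>A\<^esub> FArr U (FArr L (Idn A x))"
    if "(x, \<xi>) \<in> algs" for x \<xi>
    using that by (simp add: em_algebras_def Hom_def)
  moreover have "(k \<cdot>\<^bsub>A\<^esub> h) \<cdot>\<^bsub>A\<^esub> \<xi> = \<zeta> \<cdot>\<^bsub>A\<^esub> FArr U (FArr L (k \<cdot>\<^bsub>A\<^esub> h))"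
    if "(x, \<xi>) \<in> algs" "(y, \<theta>') \<in> algs" "(z, \<zeta>) \<in> algs" "h \<in> Hom A x y" "k \<in> Hom A y z"
      "h \<cdot>\<^bsub>A\<^esub> \<xi> = \<theta>' \<cdot>\<^bsub>A\<^esub> FArr U (FArr L h)" "k \<cdot>\<^bsub>A\<^esub> \<theta>' = \<zeta> \<cdot>\<^bsub>A\<^esub> FArr U (FArr L k)"
    for x y z \<xi> \<theta>' \<zeta> h k
  proof -
    have t: "\<xi> \<in> Arr A" "\<theta>' \<in> Arr A" "\<zeta> \<in> Arr A" "h \<in> Arr A" "k \<in> Arr A"
      "Dom A h = x" "Cod A h = y" "Dom A k = y" "Cod A k = z" "Cod A \<xi> = x" "Cod A \<theta>' = y" "Cod A \<zeta> = z"
      "Dom A \<xi> = FObj U (FObj L x)" "Dom A \<theta>' = FObj U (FObj L y)" "Dom A \<zeta> = FObj U (FObj L z)"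
      using that(1-5) by (auto simp: em_algebras_def Hom_def)
    have "(k \<cdot>\<^bsub>A\<^esub> h) \<cdot>\<^bsub>A\<^esub> \<xi> = k \<cdot>\<^bsub>A\<^esub> (\<theta>' \<cdot>\<^bsub>A\<^esub> FArr U (FArr L h))"
      using t by (simp add: that(6))
    also have "\<dots> = (\<zeta> \<cdot>\<^bsub>A\<^esub> FArr U (FArr L k)) \<cdot>\<^bsub>A\<^esub> FArr U (FArr L h)"
      using t by (intro A.comp_eq_extend[OF that(7)]) auto
    finally show ?thesis using t by simp
  qed
  ultimately show ?thesis
    apply -
    apply (rule category.intro; clarsimp simp: em_cat_def Hom_def simp del: A.dom_comp A.cod_comp)
    subgoal by (simp add: em_algebras_def)
    subgoal by simp
    done
qed

definition \<theta>_inv where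
  "\<theta>_inv x = (SOME g. g \<in> Hom X x (FObj V (FObj U x)) \<and>
     g \<cdot>\<^bsub>X\<^esub> \<theta> x = Idn X (FObj V (FObj U x)) \<and> \<theta> x \<cdot>\<^bsub>X\<^esub> g = Idn X x)"

lemma \<theta>_inv:
  assumes "x \<in> Obj X"
  shows "\<theta>_inv x \<in> Hom X x (FObj V (FObj U x))"
    and "\<theta>_inv x \<cdot>\<^bsub>X\<^esub> \<theta> x = Idn X (FObj V (FObj U x))" and "\<theta> x \<cdot>\<^bsub>X\<^esub> \<theta>_inv x = Idn X x"
proof -
  have "\<exists>g. g \<in> Hom X x (FObj V (FObj U x)) \<and>
     g \<cdot>\<^bsub>X\<^esub> \<theta> x = Idn X (FObj V (FObj U x)) \<and> \<theta> x \<cdot>\<^bsub>X\<^esub> g = Idn X x"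
    using iso_\<theta>[OF assms] \<theta>.component[OF assms] by (auto simp: iso_def Hom_def)
  from someI_ex[OF this, folded \<theta>_inv_def]
  show "\<theta>_inv x \<in> Hom X x (FObj V (FObj U x))"
    and "\<theta>_inv x \<cdot>\<^bsub>X\<^esub> \<theta> x = Idn X (FObj V (FObj U x))" and "\<theta> x \<cdot>\<^bsub>X\<^esub> \<theta>_inv x = Idn X x"
    by auto
qed

lemma \<theta>_inv_typing [simp]:
  assumes "x \<in> Obj X"
  shows "\<theta>_inv x \<in> Arr X" "Dom X (\<theta>_inv x) = x" "Cod X (\<theta>_inv x) = FObj V (FObj U x)"
  using \<theta>_inv(1)[OF assms] by (auto simp: Hom_def)

lemma \<theta>_inv_naturality:
  assumes "f \<in> Arr X"
  shows "\<theta>_inv (Cod X f) \<cdot>\<^bsub>X\<^esub> f = FArr V (FArr U f) \<cdot>\<^bsub>X\<^esub> \<theta>_inv (Dom X f)"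
proof -
  have "\<theta>_inv (Cod X f) \<cdot>\<^bsub>X\<^esub> f = \<theta>_inv (Cod X f) \<cdot>\<^bsub>X\<^esub> (f \<cdot>\<^bsub>X\<^esub> (\<theta> (Dom X f) \<cdot>\<^bsub>X\<^esub> \<theta>_inv (Dom X f)))"
    using assms by (simp add: \<theta>_inv)
  also have "\<dots> = \<theta>_inv (Cod X f) \<cdot>\<^bsub>X\<^esub> ((\<theta> (Cod X f) \<cdot>\<^bsub>X\<^esub> FArr V (FArr U f)) \<cdot>\<^bsub>X\<^esub> \<theta>_inv (Dom X f))"
    using assms \<theta>.naturality_arr[OF assms] by simp
  also have "\<dots> = (\<theta>_inv (Cod X f) \<cdot>\<^bsub>X\<^esub> \<theta> (Cod X f)) \<cdot>\<^bsub>X\<^esub> (FArr V (FArr U f) \<cdot>\<^bsub>X\<^esub> \<theta>_inv (Dom X f))"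
    using assms by simp
  also have "\<dots> = FArr V (FArr U f) \<cdot>\<^bsub>X\<^esub> \<theta>_inv (Dom X f)"
    using assms by (simp add: \<theta>_inv del: A.assoc X.assoc)
  finally show ?thesis .
qed

text \<open>
  The absolute coequalizer \<open>L a \<rightarrow> V a\<close> of \<open>L \<xi>\<close> and \<open>\<epsilon> (L a)\<close>. In \<open>A\<close> the structure map \<open>\<xi>\<close> is a split
  coequalizer of \<open>U L \<xi>\<close> and \<open>U (\<epsilon> (L a))\<close>; applying \<open>V\<close> and identifying \<open>V U\<close> with the identity gives \<open>quot\<close>.
\<close>

definition quot where "quot a \<xi> = FArr V \<xi> \<cdot>\<^bsub>X\<^esub> \<theta>_inv (FObj L a)"

text \<open>
  Both \<open>\<xi>\<close> and \<open>U (quot a \<xi>)\<close> are coequalizers of the same pair, with section \<open>\<eta> a\<close> in the case of \<open>\<xi>\<close>;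
  the next two arrows are the induced maps \<open>a \<rightarrow> U V a\<close> and \<open>U V a \<rightarrow> a\<close> between the two quotients.
\<close>

definition alg_iso where "alg_iso a \<xi> = FArr U (quot a \<xi>) \<cdot>\<^bsub>A\<^esub> \<eta> a"
definition alg_iso_inv where "alg_iso_inv a \<xi> = \<xi> \<cdot>\<^bsub>A\<^esub> (FArr U (\<theta> (FObj L a)) \<cdot>\<^bsub>A\<^esub> FArr U (FArr V (\<eta> a)))"

lemma comparison_algebra:
  assumes "x \<in> Obj X"
  shows "(FObj U x, FArr U (\<epsilon> x)) \<in> algs"
proof -
  have "FArr U (\<epsilon> x \<cdot>\<^bsub>X\<^esub> \<epsilon> (FObj L (FObj U x))) = FArr U (\<epsilon> x \<cdot>\<^bsub>X\<^esub> FArr L (FArr U (\<epsilon> x)))"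
    using counit.naturality_arr[of "\<epsilon> x"] assms by simp
  then show ?thesis
    using assms triangle_right[OF assms] by (simp add: em_algebras_def Hom_def)
qed

context
  fixes a \<xi>
  assumes alg: "(a, \<xi>) \<in> algs"
begin

lemma alg_typing [simp]:
  "a \<in> Obj A" "\<xi> \<in> Arr A" "Dom A \<xi> = FObj U (FObj L a)" "Cod A \<xi> = a"
  using alg by (auto simp: em_algebras_def Hom_def)

lemma alg_unit: "\<xi> \<cdot>\<^bsub>A\<^esub> \<eta> a = Idn A a"
  and alg_mult: "\<xi> \<cdot>\<^bsub>A\<^esub> FArr U (FArr L \<xi>) = \<xi> \<cdot>\<^bsub>A\<^esub> FArr U (\<epsilon> (FObj L a))"
  using alg by (auto simp: em_algebras_def)

lemma quot_typing [simp]: "quot a \<xi> \<in> Arr X" "Dom X (quot a \<xi>) = FObj L a" "Cod X (quot a \<xi>) = FObj V a"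
  by (simp_all add: quot_def)

lemma quot_coequalizes: "quot a \<xi> \<cdot>\<^bsub>X\<^esub> FArr L \<xi> = quot a \<xi> \<cdot>\<^bsub>X\<^esub> \<epsilon> (FObj L a)"
proof -
  have "quot a \<xi> \<cdot>\<^bsub>X\<^esub> FArr L \<xi> = FArr V \<xi> \<cdot>\<^bsub>X\<^esub> (FArr V (FArr U (FArr L \<xi>)) \<cdot>\<^bsub>X\<^esub> \<theta>_inv (FObj L (FObj U (FObj L a))))"
    using \<theta>_inv_naturality[of "FArr L \<xi>"] by (simp add: quot_def)
  also have "\<dots> = FArr V (\<xi> \<cdot>\<^bsub>A\<^esub> FArr U (FArr L \<xi>)) \<cdot>\<^bsub>X\<^esub> \<theta>_inv (FObj L (FObj U (FObj L a)))"
    by simp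
  also have "\<dots> = FArr V \<xi> \<cdot>\<^bsub>X\<^esub> (FArr V (FArr U (\<epsilon> (FObj L a))) \<cdot>\<^bsub>X\<^esub> \<theta>_inv (FObj L (FObj U (FObj L a))))"
    by (simp add: alg_mult)
  also have "\<dots> = quot a \<xi> \<cdot>\<^bsub>X\<^esub> \<epsilon> (FObj L a)"
    using \<theta>_inv_naturality[of "\<epsilon> (FObj L a)"] by (simp add: quot_def)
  finally show ?thesis .
qed

lemma alg_iso_typing [simp]: "alg_iso a \<xi> \<in> Arr A" "Dom A (alg_iso a \<xi>) = a" "Cod A (alg_iso a \<xi>) = FObj U (FObj V a)"
  by (simp_all add: alg_iso_def)

lemma alg_iso_inv_typing [simp]: "alg_iso_inv a \<xi> \<in> Arr A" "Dom A (alg_iso_inv a \<xi>) = FObj U (FObj V a)" "Cod A (alg_iso_inv a \<xi>) = a"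
  by (simp_all add: alg_iso_inv_def)

text \<open>
  The map \<open>alg_iso\<close> is the comparison of quotients: as \<open>quot\<close> coequalizes the pair, precomposing with
  \<open>\<xi>\<close> and its section \<open>\<eta> a\<close> does not change \<open>U (quot a \<xi>)\<close>.
\<close>

lemma alg_iso_action: "alg_iso a \<xi> \<cdot>\<^bsub>A\<^esub> \<xi> = FArr U (quot a \<xi>)"
proof -
  have "alg_iso a \<xi> \<cdot>\<^bsub>A\<^esub> \<xi> = FArr U (quot a \<xi>) \<cdot>\<^bsub>A\<^esub> (FArr U (FArr L \<xi>) \<cdot>\<^bsub>A\<^esub> \<eta> (FObj U (FObj L a)))"
    using unit.naturality_arr[of \<xi>] by (simp add: alg_iso_def)
  also have "\<dots> = FArr U (quot a \<xi> \<cdot>\<^bsub>X\<^esub> FArr L \<xi>) \<cdot>\<^bsub>A\<^esub> \<eta> (FObj U (FObj L a))"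
    by simp
  also have "\<dots> = FArr U (quot a \<xi>) \<cdot>\<^bsub>A\<^esub> (FArr U (\<epsilon> (FObj L a)) \<cdot>\<^bsub>A\<^esub> \<eta> (FObj U (FObj L a)))"
    unfolding quot_coequalizes by simp
  also have "\<dots> = FArr U (quot a \<xi>)"
    by (simp add: triangle_right)
  finally show ?thesis .
qed

lemma alg_iso_hom: "alg_iso a \<xi> \<cdot>\<^bsub>A\<^esub> \<xi> = FArr U (\<epsilon> (FObj V a)) \<cdot>\<^bsub>A\<^esub> FArr U (FArr L (alg_iso a \<xi>))"
proof -
  have "\<epsilon> (FObj V a) \<cdot>\<^bsub>X\<^esub> FArr L (alg_iso a \<xi>)
      = \<epsilon> (FObj V a) \<cdot>\<^bsub>X\<^esub> (FArr L (FArr U (quot a \<xi>)) \<cdot>\<^bsub>X\<^esub> FArr L (\<eta> a))"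
    by (simp add: alg_iso_def)
  also have "\<dots> = quot a \<xi> \<cdot>\<^bsub>X\<^esub> (\<epsilon> (FObj L a) \<cdot>\<^bsub>X\<^esub> FArr L (\<eta> a))"
    using counit.naturality_arr[of "quot a \<xi>"]
    by (intro X.square_extend) auto
  also have "\<dots> = quot a \<xi>"
    by (simp add: triangle_left)
  finally have "FArr U (\<epsilon> (FObj V a) \<cdot>\<^bsub>X\<^esub> FArr L (alg_iso a \<xi>)) = FArr U (quot a \<xi>)"
    by simp
  then show ?thesis
    by (simp add: alg_iso_action)
qed

text \<open>
  Naturality of \<open>\<eta>\<close> and \<open>\<theta>\<close> rewrites the middle of the composite as \<open>L \<xi>\<close> after an arrow \<open>m\<close> that is a
  section of \<open>\<epsilon> (L a)\<close>. Under \<open>\<xi>\<close>, associativity of the algebra turns \<open>U (L \<xi>)\<close> into \<open>U (\<epsilon> (L a))\<close>, which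
  cancels \<open>U m\<close>, and the unit law remains.
\<close>

lemma alg_iso_left_inverse: "alg_iso_inv a \<xi> \<cdot>\<^bsub>A\<^esub> alg_iso a \<xi> = Idn A a"
proof -
  let ?L = "FObj L a" and ?TL = "FObj L (FObj U (FObj L a))"
  define m where "m = \<theta> ?TL \<cdot>\<^bsub>X\<^esub> (FArr V (\<eta> (FObj U ?L)) \<cdot>\<^bsub>X\<^esub> \<theta>_inv ?L)"
  have m_typing [simp]: "m \<in> Arr X" "Dom X m = ?L" "Cod X m = ?TL"
    by (simp_all add: m_def)
  have "FArr V (\<eta> a) \<cdot>\<^bsub>X\<^esub> FArr V \<xi> = FArr V (FArr U (FArr L \<xi>)) \<cdot>\<^bsub>X\<^esub> FArr V (\<eta> (FObj U ?L))"
    using unit.naturality_arr[of \<xi>] by (simp flip: V.FArr_comp)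
  then have "FArr V (\<eta> a) \<cdot>\<^bsub>X\<^esub> quot a \<xi>
      = FArr V (FArr U (FArr L \<xi>)) \<cdot>\<^bsub>X\<^esub> (FArr V (\<eta> (FObj U ?L)) \<cdot>\<^bsub>X\<^esub> \<theta>_inv ?L)"
    unfolding quot_def by (intro X.square_extend) auto
  then have "\<theta> ?L \<cdot>\<^bsub>X\<^esub> (FArr V (\<eta> a) \<cdot>\<^bsub>X\<^esub> quot a \<xi>)
      = \<theta> ?L \<cdot>\<^bsub>X\<^esub> (FArr V (FArr U (FArr L \<xi>)) \<cdot>\<^bsub>X\<^esub> (FArr V (\<eta> (FObj U ?L)) \<cdot>\<^bsub>X\<^esub> \<theta>_inv ?L))"
    by simp
  also have "\<dots> = FArr L \<xi> \<cdot>\<^bsub>X\<^esub> m"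
    unfolding m_def using \<theta>.naturality_arr[of "FArr L \<xi>"]
    by (intro X.square_extend) auto
  finally have 1: "\<theta> ?L \<cdot>\<^bsub>X\<^esub> (FArr V (\<eta> a) \<cdot>\<^bsub>X\<^esub> quot a \<xi>) = FArr L \<xi> \<cdot>\<^bsub>X\<^esub> m" .
  have "\<epsilon> ?L \<cdot>\<^bsub>X\<^esub> m = \<theta> ?L \<cdot>\<^bsub>X\<^esub> (FArr V (FArr U (\<epsilon> ?L)) \<cdot>\<^bsub>X\<^esub> (FArr V (\<eta> (FObj U ?L)) \<cdot>\<^bsub>X\<^esub> \<theta>_inv ?L))"
    unfolding m_def using \<theta>.naturality_arr[of "\<epsilon> ?L"]
    by (intro X.square_extend) auto
  also have "\<dots> = \<theta> ?L \<cdot>\<^bsub>X\<^esub> (FArr V (FArr U (\<epsilon> ?L) \<cdot>\<^bsub>A\<^esub> \<eta> (FObj U ?L)) \<cdot>\<^bsub>X\<^esub> \<theta>_inv ?L)"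
    by simp
  also have "\<dots> = Idn X ?L"
    using triangle_right[of ?L] by (simp add: \<theta>_inv del: V.FArr_comp)
  finally have 2: "\<epsilon> ?L \<cdot>\<^bsub>X\<^esub> m = Idn X ?L" .
  have "alg_iso_inv a \<xi> \<cdot>\<^bsub>A\<^esub> alg_iso a \<xi> = \<xi> \<cdot>\<^bsub>A\<^esub> (FArr U (\<theta> ?L \<cdot>\<^bsub>X\<^esub> (FArr V (\<eta> a) \<cdot>\<^bsub>X\<^esub> quot a \<xi>)) \<cdot>\<^bsub>A\<^esub> \<eta> a)"
    by (simp add: alg_iso_inv_def alg_iso_def)
  also have "\<dots> = \<xi> \<cdot>\<^bsub>A\<^esub> (FArr U (FArr L \<xi>) \<cdot>\<^bsub>A\<^esub> (FArr U m \<cdot>\<^bsub>A\<^esub> \<eta> a))"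
    unfolding 1 by simp
  also have "\<dots> = \<xi> \<cdot>\<^bsub>A\<^esub> (FArr U (\<epsilon> ?L) \<cdot>\<^bsub>A\<^esub> (FArr U m \<cdot>\<^bsub>A\<^esub> \<eta> a))"
    using alg_mult by (intro A.square_extend) auto
  also have "\<dots> = \<xi> \<cdot>\<^bsub>A\<^esub> (FArr U (\<epsilon> ?L \<cdot>\<^bsub>X\<^esub> m) \<cdot>\<^bsub>A\<^esub> \<eta> a)"
    by simp
  also have "\<dots> = Idn A a"
    unfolding 2 by (simp add: alg_unit)
  finally show ?thesis .
qed

lemma alg_iso_right_inverse: "alg_iso a \<xi> \<cdot>\<^bsub>A\<^esub> alg_iso_inv a \<xi> = Idn A (FObj U (FObj V a))"
proof -
  let ?L = "FObj L a"
  have "quot a \<xi> \<cdot>\<^bsub>X\<^esub> (\<theta> ?L \<cdot>\<^bsub>X\<^esub> FArr V (\<eta> a))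
     = FArr V \<xi> \<cdot>\<^bsub>X\<^esub> ((\<theta>_inv ?L \<cdot>\<^bsub>X\<^esub> \<theta> ?L) \<cdot>\<^bsub>X\<^esub> FArr V (\<eta> a))"
    by (simp add: quot_def)
  also have "\<dots> = FArr V (\<xi> \<cdot>\<^bsub>A\<^esub> \<eta> a)"
    by (simp add: \<theta>_inv(2) del: X.assoc)
  also have "\<dots> = Idn X (FObj V a)"
    unfolding alg_unit by simp
  finally have 1: "quot a \<xi> \<cdot>\<^bsub>X\<^esub> (\<theta> ?L \<cdot>\<^bsub>X\<^esub> FArr V (\<eta> a)) = Idn X (FObj V a)" .
  have "alg_iso a \<xi> \<cdot>\<^bsub>A\<^esub> alg_iso_inv a \<xi>
      = FArr U (quot a \<xi>) \<cdot>\<^bsub>A\<^esub> (FArr U (\<theta> (FObj L a)) \<cdot>\<^bsub>A\<^esub> FArr U (FArr V (\<eta> a)))"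
    unfolding alg_iso_inv_def using alg_iso_action by (intro A.comp_eq_extend) auto
  also have "\<dots> = FArr U (quot a \<xi> \<cdot>\<^bsub>X\<^esub> (\<theta> ?L \<cdot>\<^bsub>X\<^esub> FArr V (\<eta> a)))"
    by simp
  also have "\<dots> = Idn A (FObj U (FObj V a))"
    unfolding 1 by simp
  finally show ?thesis .
qed

end

lemma alg_iso_inv_hom:
  assumes "(a, \<xi>) \<in> algs"
  shows "alg_iso_inv a \<xi> \<cdot>\<^bsub>A\<^esub> FArr U (\<epsilon> (FObj V a)) = \<xi> \<cdot>\<^bsub>A\<^esub> FArr U (FArr L (alg_iso_inv a \<xi>))"
proof -
  note [simp] = alg_typing[OF assms] alg_iso_typing[OF assms] alg_iso_inv_typing[OF assms]
  have "alg_iso_inv a \<xi> \<cdot>\<^bsub>A\<^esub> FArr U (\<epsilon> (FObj V a))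
      = alg_iso_inv a \<xi> \<cdot>\<^bsub>A\<^esub> (FArr U (\<epsilon> (FObj V a)) \<cdot>\<^bsub>A\<^esub> FArr U (FArr L (alg_iso a \<xi> \<cdot>\<^bsub>A\<^esub> alg_iso_inv a \<xi>)))"
    unfolding alg_iso_right_inverse[OF assms] by simp
  also have "\<dots> = alg_iso_inv a \<xi> \<cdot>\<^bsub>A\<^esub> ((FArr U (\<epsilon> (FObj V a)) \<cdot>\<^bsub>A\<^esub> FArr U (FArr L (alg_iso a \<xi>))) \<cdot>\<^bsub>A\<^esub> FArr U (FArr L (alg_iso_inv a \<xi>)))"
    by simp
  also have "\<dots> = alg_iso_inv a \<xi> \<cdot>\<^bsub>A\<^esub> ((alg_iso a \<xi> \<cdot>\<^bsub>A\<^esub> \<xi>) \<cdot>\<^bsub>A\<^esub> FArr U (FArr L (alg_iso_inv a \<xi>)))"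
    unfolding alg_iso_hom[OF assms] ..
  also have "\<dots> = (alg_iso_inv a \<xi> \<cdot>\<^bsub>A\<^esub> alg_iso a \<xi>) \<cdot>\<^bsub>A\<^esub> (\<xi> \<cdot>\<^bsub>A\<^esub> FArr U (FArr L (alg_iso_inv a \<xi>)))"
    by simp
  also have "\<dots> = \<xi> \<cdot>\<^bsub>A\<^esub> FArr U (FArr L (alg_iso_inv a \<xi>))"
    unfolding alg_iso_left_inverse[OF assms] by simp
  finally show ?thesis .
qed

lemma alg_iso_inv_natural:
  assumes "(a, \<xi>) \<in> algs" "(b, \<zeta>) \<in> algs" "h \<in> Hom A a b"
    and h: "h \<cdot>\<^bsub>A\<^esub> \<xi> = \<zeta> \<cdot>\<^bsub>A\<^esub> FArr U (FArr L h)"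
  shows "alg_iso_inv b \<zeta> \<cdot>\<^bsub>A\<^esub> FArr U (FArr V h) = h \<cdot>\<^bsub>A\<^esub> alg_iso_inv a \<xi>"
proof -
  note [simp] = alg_typing[OF assms(1)] alg_typing[OF assms(2)]
  have [simp]: "h \<in> Arr A" "Dom A h = a" "Cod A h = b"
    using assms(3) by (auto simp: Hom_def)
  have 1: "FArr V (\<eta> b) \<cdot>\<^bsub>X\<^esub> FArr V h = FArr V (FArr U (FArr L h)) \<cdot>\<^bsub>X\<^esub> FArr V (\<eta> a)"
    using unit.naturality_arr[of h] by (simp flip: V.FArr_comp)
  have 2: "\<theta> (FObj L b) \<cdot>\<^bsub>X\<^esub> (FArr V (FArr U (FArr L h)) \<cdot>\<^bsub>X\<^esub> FArr V (\<eta> a))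
    = FArr L h \<cdot>\<^bsub>X\<^esub> (\<theta> (FObj L a) \<cdot>\<^bsub>X\<^esub> FArr V (\<eta> a))"
    using \<theta>.naturality_arr[of "FArr L h"] by (intro X.square_extend) auto
  have "alg_iso_inv b \<zeta> \<cdot>\<^bsub>A\<^esub> FArr U (FArr V h)
     = \<zeta> \<cdot>\<^bsub>A\<^esub> FArr U (\<theta> (FObj L b) \<cdot>\<^bsub>X\<^esub> (FArr V (\<eta> b) \<cdot>\<^bsub>X\<^esub> FArr V h))"
    by (simp add: alg_iso_inv_def)
  also have "\<dots> = \<zeta> \<cdot>\<^bsub>A\<^esub> (FArr U (FArr L h) \<cdot>\<^bsub>A\<^esub> FArr U (\<theta> (FObj L a) \<cdot>\<^bsub>X\<^esub> FArr V (\<eta> a)))"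
    unfolding 1 2 by simp
  also have "\<dots> = h \<cdot>\<^bsub>A\<^esub> (\<xi> \<cdot>\<^bsub>A\<^esub> FArr U (\<theta> (FObj L a) \<cdot>\<^bsub>X\<^esub> FArr V (\<eta> a)))"
    using h by (intro A.square_extend) auto
  also have "\<dots> = h \<cdot>\<^bsub>A\<^esub> alg_iso_inv a \<xi>"
    by (simp add: alg_iso_inv_def)
  finally show ?thesis .
qed

lemma em_simps:
  "Obj EM = algs"
  "(s, t, h) \<in> Arr EM \<longleftrightarrow> s \<in> algs \<and> t \<in> algs \<and> h \<in> Hom A (fst s) (fst t) \<and>
     h \<cdot>\<^bsub>A\<^esub> snd s = snd t \<cdot>\<^bsub>A\<^esub> FArr U (FArr L h)"
  "Dom EM (s, t, h) = s" "Cod EM (s, t, h) = t"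
  "Idn EM s = (s, s, Idn A (fst s))"
  "Comp EM (s', t', h') (s, t, h) = (s, t', h' \<cdot>\<^bsub>A\<^esub> h)"
  by (auto simp: em_cat_def split: prod.splits)

lemma comparison_functor: "cat_functor X EM (comparison X U \<epsilon>)"
proof -
  interpret EM: category EM by (rule category_em)
  have "FArr U f \<cdot>\<^bsub>A\<^esub> FArr U (\<epsilon> (Dom X f)) = FArr U (\<epsilon> (Cod X f)) \<cdot>\<^bsub>A\<^esub> FArr U (FArr L (FArr U f))"
    if "f \<in> Arr X" for f
    using that counit.naturality_arr[of f] by (simp flip: right.FArr_comp)
  then show ?thesis
    by unfold_locales
      (auto simp: comparison_def Let_def em_simps Hom_def comparison_algebra)
qed

definition inverse_comparison where
  "inverse_comparison = \<lparr>FObj = (\<lambda>(a, \<xi>). FObj V a), FArr = (\<lambda>(s, t, h). FArr V h)\<rparr>"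

lemma inverse_comparison_functor: "cat_functor EM X inverse_comparison"
proof -
  interpret EM: category EM by (rule category_em)
  show ?thesis
    by unfold_locales
      (auto simp: inverse_comparison_def Let_def em_simps Hom_def dest: alg_typing)
qed

lemma equivalence_comparison: "equivalence X EM (comparison X U \<epsilon>)"
proof -
  interpret EM: category EM by (rule category_em)
  interpret k: cat_functor X EM "comparison X U \<epsilon>" by (rule comparison_functor)
  interpret G: cat_functor EM X inverse_comparison by (rule inverse_comparison_functor)
  have "nat_trans X X (inverse_comparison \<circ>\<^sub>F comparison X U \<epsilon>) id_func \<theta>"
    by (intro nat_trans.intro cat_functor_comp[of _ EM] k.cat_functor_axioms G.cat_functor_axioms
        counit.G.cat_functor_axioms nat_trans_axioms.intro)
       (use \<theta>.component \<theta>.naturality in \<open>auto simp: comparison_def inverse_comparison_def Let_def\<close>)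
  then have 1: "naturally_isomorphic X X (inverse_comparison \<circ>\<^sub>F comparison X U \<epsilon>) id_func"
    using iso_\<theta> unfolding naturally_isomorphic_def by blast
  let ?k = "\<lambda>x. (FObj U x, FArr U (\<epsilon> x))"
  let ?\<tau> = "\<lambda>(a, \<xi>). (?k (FObj V a), (a, \<xi>), alg_iso_inv a \<xi>)"
  have hom: "?\<tau> s \<in> Hom EM (?k (FObj V (fst s))) s" if "s \<in> algs" for s
  proof (cases s)
    case (Pair a \<xi>)
    with that show ?thesis
      using alg_iso_inv_typing[of a \<xi>] comparison_algebra[of "FObj V a"] alg_typing[of a \<xi>]
      by (auto simp: em_simps Hom_def alg_iso_inv_hom)
  qed
  have nat: "?\<tau> t \<cdot>\<^bsub>EM\<^esub> FArr (comparison X U \<epsilon> \<circ>\<^sub>F inverse_comparison) f = f \<cdot>\<^bsub>EM\<^esub> ?\<tau> s"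
    if f: "f \<in> Hom EM s t" for f s t
  proof -
    obtain a \<xi> b \<zeta> h where "f = ((a, \<xi>), (b, \<zeta>), h)" "s = (a, \<xi>)" "t = (b, \<zeta>)"
      using f by (cases f; cases s; cases t) (auto simp: Hom_def em_simps)
    moreover have "h \<in> Arr A" "Dom A h = a" "Cod A h = b"
      using f calculation by (auto simp: Hom_def em_simps)
    ultimately show ?thesis
      using f alg_iso_inv_natural[of a \<xi> b \<zeta> h]
      by (auto simp: comparison_def inverse_comparison_def Let_def Hom_def em_simps)
  qed
  have "nat_trans EM EM (comparison X U \<epsilon> \<circ>\<^sub>F inverse_comparison) id_func ?\<tau>"
    apply (intro nat_trans.intro cat_functor_comp[of _ X] k.cat_functor_axioms G.cat_functor_axioms
        EM.cat_functor_id nat_trans_axioms.intro)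
    subgoal for s
      using hom[of s] by (cases s) (auto simp: comparison_def inverse_comparison_def Let_def em_simps)
    subgoal for f s t
      using nat[of f s t] by simp
    done
  moreover have "iso EM (?\<tau> s)" if "s \<in> Obj EM" for s
  proof (cases s)
    case (Pair a \<xi>)
    have s: "(a, \<xi>) \<in> algs"
      using that Pair by (simp add: em_simps)
    note [simp] = alg_typing[OF s] alg_iso_typing[OF s]
    show ?thesis
    proof (rule EM.isoI)
      show "?\<tau> s \<in> Hom EM (?k (FObj V a)) (a, \<xi>)"
        using hom[of "(a, \<xi>)"] s Pair by auto
      show "((a, \<xi>), ?k (FObj V a), alg_iso a \<xi>) \<in> Hom EM (a, \<xi>) (?k (FObj V a))"
        using comparison_algebra[of "FObj V a"] s by (auto simp: em_simps Hom_def alg_iso_hom)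
    qed (use s Pair in \<open>auto simp: em_simps alg_iso_right_inverse alg_iso_left_inverse\<close>)
  qed
  ultimately have 2: "naturally_isomorphic EM EM (comparison X U \<epsilon> \<circ>\<^sub>F inverse_comparison) id_func"
    unfolding naturally_isomorphic_def by blast
  show ?thesis
    unfolding equivalence_def using 1 2 comparison_functor inverse_comparison_functor by blast
qed

theorem monadic_if_retracted: "monadic_functor X A U"
  unfolding monadic_functor_def using adjunction_axioms equivalence_comparison by blast

end

section \<open>Pullbacks\<close>

context category
begin

lemma pullback_arr:
  assumes "is_pullback C f g p q"
  shows "f \<in> Arr C" "g \<in> Arr C" "p \<in> Arr C" "q \<in> Arr C"
    "Cod C f = Cod C g" "Cod C p = Dom C f" "Cod C q = Dom C g" "Dom C p = Dom C q"
  using assms by (auto simp: is_pullback_def)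

lemma pullback_square: "is_pullback C f g p q \<Longrightarrow> f \<cdot> p = g \<cdot> q"
  by (simp add: is_pullback_def)

lemma pullback_universal:
  "\<lbrakk>is_pullback C f g p q; u \<in> Hom C z (Dom C f); v \<in> Hom C z (Dom C g); f \<cdot> u = g \<cdot> v\<rbrakk>
   \<Longrightarrow> \<exists>!w. w \<in> Hom C z (Dom C p) \<and> p \<cdot> w = u \<and> q \<cdot> w = v"
  unfolding is_pullback_def by (elim conjE allE[of _ z], drule bspec, assumption, drule bspec, assumption, erule mp)

lemma pullback_lift:
  assumes "is_pullback C f g p q" "u \<in> Arr C" "v \<in> Arr C" "Dom C u = Dom C v"
    "Cod C u = Dom C f" "Cod C v = Dom C g" "f \<cdot> u = g \<cdot> v"
  obtains w where "w \<in> Arr C" "Dom C w = Dom C v" "Cod C w = Dom C p" "p \<cdot> w = u" "q \<cdot> w = v"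
proof -
  have "u \<in> Hom C (Dom C v) (Dom C f)" "v \<in> Hom C (Dom C v) (Dom C g)"
    using assms(2-6) by (simp_all add: Hom_def)
  with pullback_universal[OF assms(1)] assms(7)
  obtain w where "w \<in> Hom C (Dom C v) (Dom C p)" "p \<cdot> w = u" "q \<cdot> w = v"
    by blast
  then show thesis
    by (intro that) (auto simp: Hom_def)
qed

lemma pullback_unique:
  assumes "is_pullback C f g p q" "w \<in> Arr C" "w' \<in> Arr C" "Dom C w = Dom C w'"
    "Cod C w = Dom C p" "Cod C w' = Dom C p" "p \<cdot> w = p \<cdot> w'" "q \<cdot> w = q \<cdot> w'"
  shows "w = w'"
proof -
  note t = pullback_arr[OF assms(1)]
  have "p \<cdot> w' \<in> Hom C (Dom C w') (Dom C f)" "q \<cdot> w' \<in> Hom C (Dom C w') (Dom C g)"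
    using assms t by (auto simp: Hom_def)
  moreover have "f \<cdot> (p \<cdot> w') = g \<cdot> (q \<cdot> w')"
    using t assms(2-6) by (intro square_extend[OF pullback_square[OF assms(1)]]) auto
  ultimately have "\<exists>!w. w \<in> Hom C (Dom C w') (Dom C p) \<and> p \<cdot> w = p \<cdot> w' \<and> q \<cdot> w = q \<cdot> w'"
    by (rule pullback_universal[OF assms(1)])
  moreover have "w \<in> Hom C (Dom C w') (Dom C p)" "w' \<in> Hom C (Dom C w') (Dom C p)"
    using assms(2-6) by (simp_all add: Hom_def)
  ultimately show ?thesis
    using assms(7,8) by metis
qed

lemma pullbackI:
  assumes "f \<in> Arr C" "g \<in> Arr C" "p \<in> Arr C" "q \<in> Arr C"
    "Cod C f = Cod C g" "Cod C p = Dom C f" "Cod C q = Dom C g" "Dom C p = Dom C q" "f \<cdot> p = g \<cdot> q"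
    and lift: "\<And>u v. \<lbrakk>u \<in> Arr C; v \<in> Arr C; Dom C u = Dom C v; Cod C u = Dom C f; Cod C v = Dom C g;
      f \<cdot> u = g \<cdot> v\<rbrakk> \<Longrightarrow> \<exists>w. w \<in> Arr C \<and> Dom C w = Dom C v \<and> Cod C w = Dom C p \<and> p \<cdot> w = u \<and> q \<cdot> w = v"
    and uniq: "\<And>w w'. \<lbrakk>w \<in> Arr C; w' \<in> Arr C; Dom C w = Dom C w'; Cod C w = Dom C p; Cod C w' = Dom C p;
      p \<cdot> w = p \<cdot> w'; q \<cdot> w = q \<cdot> w'\<rbrakk> \<Longrightarrow> w = w'"
  shows "is_pullback C f g p q"
proof -
  have "\<exists>!w. w \<in> Hom C z (Dom C p) \<and> p \<cdot> w = u \<and> q \<cdot> w = v"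
    if uv: "u \<in> Hom C z (Dom C f)" "v \<in> Hom C z (Dom C g)" "f \<cdot> u = g \<cdot> v" for z u v
  proof -
    have "\<exists>w. w \<in> Arr C \<and> Dom C w = Dom C v \<and> Cod C w = Dom C p \<and> p \<cdot> w = u \<and> q \<cdot> w = v"
      by (rule lift) (use uv in \<open>auto simp: Hom_def\<close>)
    then obtain w where w: "w \<in> Hom C z (Dom C p)" "p \<cdot> w = u" "q \<cdot> w = v"
      using uv(2) by (auto simp: Hom_def simp del: dom_comp)
    show ?thesis
    proof (rule ex1I[of _ w])
      fix w' assume w': "w' \<in> Hom C z (Dom C p) \<and> p \<cdot> w' = u \<and> q \<cdot> w' = v"
      show "w' = w"
        by (rule uniq) (use w w' in \<open>auto simp: Hom_def\<close>)
    qed (use w in auto)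
  qed
  then show ?thesis
    using assms(1-9) by (simp add: is_pullback_def)
qed

lemma pullback_paste:
  assumes l: "is_pullback C f g p q" and r: "is_pullback C q h p' q'"
  shows "is_pullback C f (g \<cdot> h) (p \<cdot> p') q'"
proof -
  note t [simp] = pullback_arr[OF l] pullback_arr(2-4,6-)[OF r]
  have [simp]: "Cod C h = Dom C g" using pullback_arr(5)[OF r] by simp
  show ?thesis
  proof (rule pullbackI)
  show "f \<cdot> (p \<cdot> p') = (g \<cdot> h) \<cdot> q'"
  proof -
    have "f \<cdot> (p \<cdot> p') = g \<cdot> (q \<cdot> p')"
      by (rule square_extend[OF pullback_square[OF l]]) auto
    then show ?thesis
      by (simp add: pullback_square[OF r])
  qed
  show "\<exists>w. w \<in> Arr C \<and> Dom C w = Dom C v \<and> Cod C w = Dom C (p \<cdot> p') \<and> (p \<cdot> p') \<cdot> w = u \<and> q' \<cdot> w = v"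
    if uv: "u \<in> Arr C" "v \<in> Arr C" "Dom C u = Dom C v" "Cod C u = Dom C f" "Cod C v = Dom C (g \<cdot> h)"
      "f \<cdot> u = (g \<cdot> h) \<cdot> v" for u v
  proof -
    have [simp]: "Cod C v = Dom C h" using uv by simp
    have "f \<cdot> u = g \<cdot> (h \<cdot> v)" using uv by simp
    from pullback_lift[OF l _ _ _ _ _ this] obtain w where
      w: "w \<in> Arr C" "Dom C w = Dom C v" "Cod C w = Dom C q" "p \<cdot> w = u" "q \<cdot> w = h \<cdot> v"
      using uv by auto
    from pullback_lift[OF r w(1) uv(2) w(2,3) _ w(5)] obtain z where
      "z \<in> Arr C" "Dom C z = Dom C v" "Cod C z = Dom C p'" "p' \<cdot> z = w" "q' \<cdot> z = v"
      by auto
    then show ?thesis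
      using w by (intro exI[of _ z]) auto
  qed
  show "w = w'" if w: "w \<in> Arr C" "w' \<in> Arr C" "Dom C w = Dom C w'" "Cod C w = Dom C (p \<cdot> p')"
    "Cod C w' = Dom C (p \<cdot> p')" "(p \<cdot> p') \<cdot> w = (p \<cdot> p') \<cdot> w'" "q' \<cdot> w = q' \<cdot> w'" for w w'
  proof (rule pullback_unique[OF r])
    have [simp]: "Cod C w = Dom C q'" "Cod C w' = Dom C q'" using w by simp_all
    show "p' \<cdot> w = p' \<cdot> w'"
    proof (rule pullback_unique[OF l])
      have "q \<cdot> (p' \<cdot> w) = h \<cdot> (q' \<cdot> w)" "q \<cdot> (p' \<cdot> w') = h \<cdot> (q' \<cdot> w')"
        using w(1-3) by (auto intro!: square_extend[OF pullback_square[OF r]])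
      then show "q \<cdot> (p' \<cdot> w) = q \<cdot> (p' \<cdot> w')" using w(7) by simp
    qed (use w in auto)
  qed (use w in auto)
  qed auto
qed

lemma pullback_along_identity_iso:
  assumes pb: "is_pullback C f (Idn C (Cod C f)) p q"
  shows "iso C p"
proof -
  note [simp] = pullback_arr(1,3,4,6-)[OF pb]
  obtain w where w: "w \<in> Arr C" "Dom C w = Dom C f" "Cod C w = Dom C q" "p \<cdot> w = Idn C (Dom C f)" "q \<cdot> w = f"
    by (rule pullback_lift[OF pb, of "Idn C (Dom C f)" f]) auto
  have "w \<cdot> p = Idn C (Dom C q)"
  proof (rule pullback_unique[OF pb])
    have "p \<cdot> (w \<cdot> p) = Idn C (Dom C f) \<cdot> p"
      using w by (intro comp_eq_extend) auto
    then show "p \<cdot> (w \<cdot> p) = p \<cdot> Idn C (Dom C q)" by simp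
    have "q \<cdot> (w \<cdot> p) = f \<cdot> p"
      using w by (intro comp_eq_extend) auto
    then show "q \<cdot> (w \<cdot> p) = q \<cdot> Idn C (Dom C q)"
      using pullback_square[OF pb] by simp
  qed (use w in auto)
  then show ?thesis
    using w by (intro isoI[of p "Dom C q" "Dom C f" w]) (auto simp: Hom_def)
qed

lemma split_epiI: "\<lbrakk>f \<in> Arr C; s \<in> Arr C; Dom C s = Cod C f; Cod C s = Dom C f; f \<cdot> s = Idn C (Cod C f)\<rbrakk> \<Longrightarrow> split_epi C f"
  unfolding split_epi_def Hom_def by auto

lemma split_epiE:
  assumes "split_epi C f"
  obtains s where "f \<in> Arr C" "s \<in> Arr C" "Dom C s = Cod C f" "Cod C s = Dom C f" "f \<cdot> s = Idn C (Cod C f)"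
  using assms unfolding split_epi_def Hom_def by auto

lemma split_epi_cancel:
  assumes f: "split_epi C f"
    and "g \<in> Arr C" "h \<in> Arr C" "Dom C g = Cod C f" "Dom C h = Cod C f" "g \<cdot> f = h \<cdot> f"
  shows "g = h"
proof -
  obtain s where s: "f \<in> Arr C" "s \<in> Arr C" "Dom C s = Cod C f" "Cod C s = Dom C f" "f \<cdot> s = Idn C (Cod C f)"
    using f by (rule split_epiE)
  have "g \<cdot> (f \<cdot> s) = h \<cdot> (f \<cdot> s)"
    using assms(2-) s(1-4) by (intro square_extend) auto
  then show ?thesis
    using assms s by simp
qed

lemma iso_split_epi: "iso C f \<Longrightarrow> split_epi C f"
  unfolding iso_def split_epi_def by auto

text \<open>
  A lift of \<open>g\<close> through \<open>f\<close> is a section of the pullback of \<open>f\<close> along \<open>g\<close>, even if \<open>f\<close> is not split.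
\<close>

lemma split_epi_pullback:
  assumes pb: "is_pullback C f g p q"
    and s: "s \<in> Arr C" "Dom C s = Dom C g" "Cod C s = Dom C f" "f \<cdot> s = g"
  shows "split_epi C q"
proof -
  note [simp] = pullback_arr[OF pb]
  have "f \<cdot> s = g \<cdot> Idn C (Dom C g)" using s by simp
  from pullback_lift[OF pb s(1) _ _ _ _ this] s obtain w
    where "w \<in> Arr C" "Dom C w = Dom C g" "Cod C w = Dom C q" "q \<cdot> w = Idn C (Dom C g)"
    by auto
  then show ?thesis by (intro split_epiI) auto
qed

lemma split_epi_pullback_stable:
  assumes pb: "is_pullback C f g p q" and f: "split_epi C f"
  shows "split_epi C q"
proof -
  note [simp] = pullback_arr[OF pb]
  obtain s where [simp]: "s \<in> Arr C" "Dom C s = Cod C f" "Cod C s = Dom C f" and s: "f \<cdot> s = Idn C (Cod C f)"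
    using f by (rule split_epiE) auto
  have "f \<cdot> (s \<cdot> g) = Idn C (Cod C f) \<cdot> g"
    using s by (intro comp_eq_extend) auto
  then show ?thesis
    by (intro split_epi_pullback[OF pb, of "s \<cdot> g"]) auto
qed

text \<open>
  The converse of pasting: the pullback with base \<open>g \<cdot> h\<close> factors through the one with base \<open>g\<close>, and
  the left-over square is a pullback.
\<close>

lemma pullback_cancel:
  assumes l: "is_pullback C f g p q" and o: "is_pullback C f (g \<cdot> h) r q'"
    and h: "h \<in> Arr C" "Cod C h = Dom C g"
  obtains p' where "p \<cdot> p' = r" "is_pullback C q h p' q'"
proof -
  note [simp] = h pullback_arr(1-3,6-)[OF l] pullback_arr(3,4,6,8)[OF o]
  have [simp]: "q \<in> Arr C" using pullback_arr[OF l] by simp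
  have [simp]: "Cod C q' = Dom C h" using pullback_arr(7)[OF o] by simp
  have o_square: "f \<cdot> r = g \<cdot> (h \<cdot> q')" using pullback_square[OF o] by simp
  obtain p' where p' [simp]: "p' \<in> Arr C" "Dom C p' = Dom C q'" "Cod C p' = Dom C q"
    and p'_eq: "p \<cdot> p' = r" "q \<cdot> p' = h \<cdot> q'"
    using pullback_lift[OF l, of r "h \<cdot> q'"] o_square by auto
  have "is_pullback C q h p' q'"
  proof (rule pullbackI)
    fix u v assume uv [simp]: "u \<in> Arr C" "v \<in> Arr C" "Dom C u = Dom C v" "Cod C u = Dom C q" "Cod C v = Dom C h"
      and sq: "q \<cdot> u = h \<cdot> v"
    have "f \<cdot> (p \<cdot> u) = g \<cdot> (q \<cdot> u)"
      by (rule square_extend[OF pullback_square[OF l]]) auto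
    then have "f \<cdot> (p \<cdot> u) = (g \<cdot> h) \<cdot> v" by (simp add: sq)
    then obtain w where w [simp]: "w \<in> Arr C" "Dom C w = Dom C v" "Cod C w = Dom C q'"
      and w_eq: "r \<cdot> w = p \<cdot> u" "q' \<cdot> w = v"
      using pullback_lift[OF o, of "p \<cdot> u" v] by auto
    have "p' \<cdot> w = u"
    proof (rule pullback_unique[OF l])
      show "p \<cdot> (p' \<cdot> w) = p \<cdot> u"
        using w_eq by (subst comp_eq_extend[OF p'_eq(1)]) auto
      show "q \<cdot> (p' \<cdot> w) = q \<cdot> u"
        using w_eq by (subst square_extend[OF p'_eq(2)]) (auto simp: sq)
    qed simp_all
    then show "\<exists>w. w \<in> Arr C \<and> Dom C w = Dom C v \<and> Cod C w = Dom C p' \<and> p' \<cdot> w = u \<and> q' \<cdot> w = v"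
      using w_eq by (intro exI[of _ w]) simp
  next
    fix w w' assume w [simp]: "w \<in> Arr C" "w' \<in> Arr C" "Dom C w = Dom C w'"
      "Cod C w = Dom C p'" "Cod C w' = Dom C p'" and eq: "p' \<cdot> w = p' \<cdot> w'" "q' \<cdot> w = q' \<cdot> w'"
    have r: "r \<cdot> w = p \<cdot> (p' \<cdot> w)" "r \<cdot> w' = p \<cdot> (p' \<cdot> w')"
      by (rule comp_eq_extend[OF p'_eq(1), symmetric]; simp)+
    show "w = w'"
      by (rule pullback_unique[OF o]) (use eq in \<open>simp_all add: r\<close>)
  qed (simp_all add: p'_eq)
  then show thesis using that p'_eq by blast
qed

lemma pullback_transport:
  assumes pb: "is_pullback C f g p q" and i: "iso C i" "i \<in> Arr C" "Cod C i = Dom C f"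
    and p': "p' \<in> Arr C" "Dom C p' = Dom C q" "Cod C p' = Dom C i" "i \<cdot> p' = p"
  shows "is_pullback C (f \<cdot> i) g p' q"
proof -
  note [simp] = pullback_arr[OF pb] i(2-) p'(1-3)
  obtain j where j [simp]: "j \<in> Arr C" "Dom C j = Dom C f" "Cod C j = Dom C i"
    and ji: "j \<cdot> i = Idn C (Dom C i)" "i \<cdot> j = Idn C (Dom C f)"
    using i by (auto simp: iso_def Hom_def)
  have i_mono: "u = v" if "u \<in> Arr C" "v \<in> Arr C" "Dom C u = Dom C v" "Cod C u = Dom C i" "Cod C v = Dom C i"
    "i \<cdot> u = i \<cdot> v" for u v
  proof -
    have "j \<cdot> (i \<cdot> w) = w" if "w \<in> Arr C" "Cod C w = Dom C i" for w
      using comp_eq_extend[OF ji(1), of w] that by simp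
    then show ?thesis using that(1,2,4-6) by metis
  qed
  show ?thesis
  proof (rule pullbackI)
    show "(f \<cdot> i) \<cdot> p' = g \<cdot> q"
      using pullback_square[OF pb] p'(4) by simp
    fix u v assume uv [simp]: "u \<in> Arr C" "v \<in> Arr C" "Dom C u = Dom C v" "Cod C u = Dom C (f \<cdot> i)" "Cod C v = Dom C g"
      and sq: "(f \<cdot> i) \<cdot> u = g \<cdot> v"
    have [simp]: "Cod C u = Dom C i" using uv by simp
    obtain w where w [simp]: "w \<in> Arr C" "Dom C w = Dom C v" "Cod C w = Dom C q"
      and w_eq: "p \<cdot> w = i \<cdot> u" "q \<cdot> w = v"
      using pullback_lift[OF pb, of "i \<cdot> u" v] sq by auto
    have "p' \<cdot> w = u"
      by (rule i_mono) (use w_eq in \<open>simp_all add: comp_eq_extend[OF p'(4)]\<close>)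
    then show "\<exists>w. w \<in> Arr C \<and> Dom C w = Dom C v \<and> Cod C w = Dom C p' \<and> p' \<cdot> w = u \<and> q \<cdot> w = v"
      using w_eq by (intro exI[of _ w]) simp
  next
    fix w w' assume w [simp]: "w \<in> Arr C" "w' \<in> Arr C" "Dom C w = Dom C w'"
      "Cod C w = Dom C p'" "Cod C w' = Dom C p'" and eq: "p' \<cdot> w = p' \<cdot> w'" "q \<cdot> w = q \<cdot> w'"
    have r: "p \<cdot> w = i \<cdot> (p' \<cdot> w)" "p \<cdot> w' = i \<cdot> (p' \<cdot> w')"
      by (rule comp_eq_extend[OF p'(4), symmetric]; simp)+
    show "w = w'"
      by (rule pullback_unique[OF pb]) (use eq in \<open>simp_all add: r\<close>)
  qed simp_all
qed

lemma split_epi_comp: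
  assumes "split_epi C f" "split_epi C g" "Cod C f = Dom C g"
  shows "split_epi C (g \<cdot> f)"
proof -
  obtain s where s: "f \<in> Arr C" "s \<in> Arr C" "Dom C s = Cod C f" "Cod C s = Dom C f" "f \<cdot> s = Idn C (Cod C f)"
    using assms(1) by (rule split_epiE)
  obtain t where t: "g \<in> Arr C" "t \<in> Arr C" "Dom C t = Cod C g" "Cod C t = Dom C g" "g \<cdot> t = Idn C (Cod C g)"
    using assms(2) by (rule split_epiE)
  have "f \<cdot> (s \<cdot> t) = Idn C (Cod C f) \<cdot> t"
    using s t(1-4) assms(3) by (intro comp_eq_extend) auto
  then show ?thesis
    using s(1-4) t assms(3) by (intro split_epiI[of _ "s \<cdot> t"]) auto
qed

end

lemma (in cat_functor) split_epi_FArr: "split_epi A f \<Longrightarrow> split_epi B (FArr F f)"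
proof (erule A.split_epiE)
  fix s assume s: "f \<in> Arr A" "s \<in> Arr A" "Dom A s = Cod A f" "Cod A s = Dom A f" "f \<cdot>\<^bsub>A\<^esub> s = Idn A (Cod A f)"
  then have "FArr F f \<cdot>\<^bsub>B\<^esub> FArr F s = Idn B (FObj F (Cod A f))"
    using FArr_comp[of s f] by simp
  then show "split_epi B (FArr F f)"
    using s by (intro B.split_epiI[of _ "FArr F s"]) auto
qed

lemma (in category) category_slice_in: "E \<subseteq> Arr C \<Longrightarrow> category (slice_in C E b)"
  unfolding slice_in_def
  by (rule category.category_full_subcat[OF category_slice]) (auto simp: slice_def)

lemma slice_in_simps:
  "Obj (slice_in C E b) = {f \<in> E. Cod C f = b}"
  "Dom (slice_in C E b) (f, g, h) = f"
  "Cod (slice_in C E b) (f, g, h) = g"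
  "Idn (slice_in C E b) f = (f, f, Idn C (Dom C f))"
  "Comp (slice_in C E b) (f', g', h') (f, g, h) = (f, g', h' \<cdot>\<^bsub>C\<^esub> h)"
  by (auto simp: slice_in_def slice_def)

lemma slice_in_arr:
  "E \<subseteq> Arr C \<Longrightarrow> (f, g, h) \<in> Arr (slice_in C E b) \<longleftrightarrow>
    f \<in> E \<and> g \<in> E \<and> Cod C f = b \<and> Cod C g = b \<and>
    h \<in> Arr C \<and> Dom C h = Dom C f \<and> Cod C h = Dom C g \<and> g \<cdot>\<^bsub>C\<^esub> h = f"
  by (auto simp: slice_in_def slice_def full_subcat_def Hom_def)

lemma slice_in_hom:
  "E \<subseteq> Arr C \<Longrightarrow> k \<in> Hom (slice_in C E b) f g \<longleftrightarrow> (\<exists>h. k = (f, g, h) \<and>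
    f \<in> E \<and> g \<in> E \<and> Cod C f = b \<and> Cod C g = b \<and>
    h \<in> Arr C \<and> Dom C h = Dom C f \<and> Cod C h = Dom C g \<and> g \<cdot>\<^bsub>C\<^esub> h = f)"
  by (cases k) (auto simp: Hom_def slice_in_arr slice_in_simps)

section \<open>Change of base\<close>

locale extension_class = category C for C :: "('o, 'a) cat" (structure) +
  fixes E :: "'a set"
  assumes class_E: "morphism_class C E"
begin

lemma E_arr: "f \<in> E \<Longrightarrow> f \<in> Arr C"
  and E_sub: "E \<subseteq> Arr C"
  and E_iso: "iso C f \<Longrightarrow> f \<in> E"
  and E_comp: "\<lbrakk>f \<in> E; g \<in> E; Cod C f = Dom C g\<rbrakk> \<Longrightarrow> g \<cdot> f \<in> E"
  and E_pullback: "\<lbrakk>is_pullback C f g p q; f \<in> E\<rbrakk> \<Longrightarrow> q \<in> E"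
  and E_has_pullback: "\<lbrakk>f \<in> E; g \<in> Arr C; Cod C g = Cod C f\<rbrakk> \<Longrightarrow> \<exists>p q. is_pullback C f g p q"
  using class_E pullback_arr unfolding morphism_class_def by (auto 0 3)

abbreviation bc where "bc p f \<equiv> snd (pb_along C p f)"
abbreviation pr where "pr p f \<equiv> fst (pb_along C p f)"

lemma pb_along:
  assumes "f \<in> E" "p \<in> Arr C" "Cod C f = Cod C p"
  shows "is_pullback C f p (pr p f) (bc p f)"
proof -
  have "\<exists>pq. is_pullback C f p (fst pq) (snd pq)"
    using E_has_pullback[of f p] assms by auto
  then show ?thesis
    unfolding pb_along_def by (rule someI_ex)
qed

lemma bc_E:
  assumes "f \<in> E" "p \<in> Arr C" "Cod C f = Cod C p"
  shows "bc p f \<in> E"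
  using E_pullback[OF pb_along[OF assms]] assms(1) .

lemma pb_typing [simp]:
  assumes "f \<in> E" "p \<in> Arr C" "Cod C f = Cod C p"
  shows "bc p f \<in> Arr C" "Cod C (bc p f) = Dom C p" "Dom C (pr p f) = Dom C (bc p f)"
    "pr p f \<in> Arr C" "Cod C (pr p f) = Dom C f"
  using pullback_arr[OF pb_along[OF assms]] by auto

lemma pb_comm:
  assumes "f \<in> E" "p \<in> Arr C" "Cod C f = Cod C p"
  shows "f \<cdot> pr p f = p \<cdot> bc p f"
  by (rule pullback_square[OF pb_along[OF assms]])

definition lift where
  "lift p g u v = (THE w. w \<in> Hom C (Dom C v) (Dom C (bc p g)) \<and> pr p g \<cdot> w = u \<and> bc p g \<cdot> w = v)"

lemma lift:
  assumes "g \<in> E" "p \<in> Arr C" "Cod C g = Cod C p"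
    and "u \<in> Arr C" "v \<in> Arr C" "Dom C u = Dom C v" "Cod C u = Dom C g" "Cod C v = Dom C p" "g \<cdot> u = p \<cdot> v"
  shows "lift p g u v \<in> Arr C" "Dom C (lift p g u v) = Dom C v" "Cod C (lift p g u v) = Dom C (bc p g)"
    "pr p g \<cdot> lift p g u v = u" "bc p g \<cdot> lift p g u v = v"
proof -
  have "\<exists>!w. w \<in> Hom C (Dom C v) (Dom C (pr p g)) \<and> pr p g \<cdot> w = u \<and> bc p g \<cdot> w = v"
    by (rule pullback_universal[OF pb_along[OF assms(1-3)]]) (use assms(4-) in \<open>simp_all add: Hom_def\<close>)
  then have "\<exists>!w. w \<in> Hom C (Dom C v) (Dom C (bc p g)) \<and> pr p g \<cdot> w = u \<and> bc p g \<cdot> w = v"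
    using assms(1-3) by simp
  from theI'[OF this, folded lift_def]
  show "lift p g u v \<in> Arr C" "Dom C (lift p g u v) = Dom C v" "Cod C (lift p g u v) = Dom C (bc p g)"
    "pr p g \<cdot> lift p g u v = u" "bc p g \<cdot> lift p g u v = v"
    by (auto simp: Hom_def)
qed

lemma base_change_simps:
  "FObj (base_change C p) f = bc p f"
  "FArr (base_change C p) (f, g, h) = (bc p f, bc p g, lift p g (h \<cdot> pr p f) (bc p f))"
  by (auto simp: base_change_def lift_def)

abbreviation Sl where "Sl b \<equiv> slice_in C E b"

lemma category_Sl: "category (Sl b)"
  using category_slice_in E_sub .

text \<open>The arrow of \<open>C\<close> underlying the action of \<open>p\<^sup>*\<close> on an arrow of the slice over the codomain of \<open>p\<close>.\<close>

lemma bc_arr: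
  assumes "p \<in> Arr C" "(f, g, h) \<in> Arr (Sl (Cod C p))"
  defines "w \<equiv> lift p g (h \<cdot> pr p f) (bc p f)"
  shows "w \<in> Arr C" "Dom C w = Dom C (bc p f)" "Cod C w = Dom C (bc p g)"
    "pr p g \<cdot> w = h \<cdot> pr p f" "bc p g \<cdot> w = bc p f"
proof -
  have t: "f \<in> E" "g \<in> E" "Cod C f = Cod C p" "Cod C g = Cod C p" "f \<in> Arr C" "g \<in> Arr C"
     "h \<in> Arr C" "Dom C h = Dom C f" "Cod C h = Dom C g" and gh: "g \<cdot> h = f"
    using assms(2) by (auto simp: slice_in_arr[OF E_sub] E_arr)
  have "g \<cdot> (h \<cdot> pr p f) = f \<cdot> pr p f"
    using t assms(1) by (intro comp_eq_extend[OF gh]) auto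
  also have "\<dots> = p \<cdot> bc p f"
    using t assms(1) by (intro pb_comm) auto
  finally have "g \<cdot> (h \<cdot> pr p f) = p \<cdot> bc p f" .
  from lift[OF _ _ _ _ _ _ _ _ this]
  show "w \<in> Arr C" "Dom C w = Dom C (bc p f)" "Cod C w = Dom C (bc p g)"
    "pr p g \<cdot> w = h \<cdot> pr p f" "bc p g \<cdot> w = bc p f"
    unfolding w_def using t assms(1) by auto
qed

lemma bc_unique:
  assumes "g \<in> E" "p \<in> Arr C" "Cod C g = Cod C p"
    "w \<in> Arr C" "w' \<in> Arr C" "Dom C w = Dom C w'"
    "Cod C w = Dom C (bc p g)" "Cod C w' = Dom C (bc p g)"
    "pr p g \<cdot> w = pr p g \<cdot> w'" "bc p g \<cdot> w = bc p g \<cdot> w'"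
  shows "w = w'"
  by (rule pullback_unique[OF pb_along[OF assms(1-3)]]) (use assms in auto)

lemma base_change_functor:
  assumes p: "p \<in> Arr C"
  shows "cat_functor (Sl (Cod C p)) (Sl (Dom C p)) (base_change C p)"
proof (intro cat_functor.intro category_Sl cat_functor_axioms.intro)
  fix f assume f: "f \<in> Obj (Sl (Cod C p))"
  then show "FObj (base_change C p) f \<in> Obj (Sl (Dom C p))"
    using p by (auto simp: base_change_simps slice_in_simps bc_E)
  show "FArr (base_change C p) (Idn (Sl (Cod C p)) f) = Idn (Sl (Dom C p)) (FObj (base_change C p) f)"
  proof -
    have t: "f \<in> E" "Cod C f = Cod C p" "f \<in> Arr C"
      using f by (auto simp: slice_in_simps E_arr)
    then have a: "(f, f, Idn C (Dom C f)) \<in> Arr (Sl (Cod C p))"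
      by (auto simp: slice_in_arr[OF E_sub])
    have "lift p f (Idn C (Dom C f) \<cdot> pr p f) (bc p f) = Idn C (Dom C (bc p f))"
      by (rule bc_unique[of f p]) (use t p in \<open>simp_all add: bc_arr[OF p a] del: comp_idn_left\<close>, simp)
    then show ?thesis
      by (simp add: base_change_simps slice_in_simps)
  qed
next
  fix k f g assume k: "k \<in> Hom (Sl (Cod C p)) f g"
  then obtain h where h: "k = (f, g, h)" and a: "(f, g, h) \<in> Arr (Sl (Cod C p))"
    by (auto simp: slice_in_hom[OF E_sub] slice_in_arr[OF E_sub])
  then show "FArr (base_change C p) k \<in> Hom (Sl (Dom C p)) (FObj (base_change C p) f) (FObj (base_change C p) g)"
    using bc_arr[OF p a] p
    by (auto simp: base_change_simps slice_in_hom[OF E_sub] slice_in_arr[OF E_sub] bc_E)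
next
  fix k k' f g g' assume k: "k \<in> Hom (Sl (Cod C p)) f g" "k' \<in> Hom (Sl (Cod C p)) g g'"
  then obtain h h' where h: "k = (f, g, h)" "k' = (g, g', h')"
    and a: "(f, g, h) \<in> Arr (Sl (Cod C p))" "(g, g', h') \<in> Arr (Sl (Cod C p))"
    by (auto simp: slice_in_hom[OF E_sub] slice_in_arr[OF E_sub])
  interpret S: category "Sl (Cod C p)" by (rule category_Sl)
  have c: "(f, g', h' \<cdot> h) \<in> Arr (Sl (Cod C p))"
    using S.arr_comp[OF a] by (simp add: slice_in_simps)
  note w = bc_arr[OF p a(1)] bc_arr[OF p a(2)] bc_arr[OF p c]
  have t: "f \<in> E" "g \<in> E" "g' \<in> E" "Cod C f = Cod C p" "Cod C g = Cod C p" "Cod C g' = Cod C p"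
     "h \<in> Arr C" "Dom C h = Dom C f" "Cod C h = Dom C g" "h' \<in> Arr C" "Dom C h' = Dom C g" "Cod C h' = Dom C g'"
    using a by (auto simp: slice_in_arr[OF E_sub])
  let ?w = "lift p g (h \<cdot> pr p f) (bc p f)" and ?w' = "lift p g' (h' \<cdot> pr p g) (bc p g)"
  have "lift p g' ((h' \<cdot> h) \<cdot> pr p f) (bc p f) = ?w' \<cdot> ?w"
  proof (rule bc_unique[of g' p])
    have "pr p g' \<cdot> (?w' \<cdot> ?w) = h' \<cdot> (pr p g \<cdot> ?w)"
      by (rule square_extend[OF w(9)]) (use w(1-3,6-8) t p in auto)
    then show "pr p g' \<cdot> lift p g' ((h' \<cdot> h) \<cdot> pr p f) (bc p f) = pr p g' \<cdot> (?w' \<cdot> ?w)"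
      using w(4) w(14) t p by simp
    have "bc p g' \<cdot> (?w' \<cdot> ?w) = bc p g \<cdot> ?w"
      by (rule comp_eq_extend[OF w(10)]) (use w(1-3,6-8) t p in auto)
    then show "bc p g' \<cdot> lift p g' ((h' \<cdot> h) \<cdot> pr p f) (bc p f) = bc p g' \<cdot> (?w' \<cdot> ?w)"
      using w(5) w(15) by simp
  qed (use w(1-3) w(6-8) w(11-13) t p in auto)
  then show "FArr (base_change C p) (k' \<cdot>\<^bsub>Sl (Cod C p)\<^esub> k)
      = FArr (base_change C p) k' \<cdot>\<^bsub>Sl (Dom C p)\<^esub> FArr (base_change C p) k"
    by (simp add: h slice_in_simps base_change_simps)
qed

end

lemma (in extension_class) split_class: "extension_class C (Split C E)"
proof
  show "morphism_class C (Split C E)"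
    unfolding morphism_class_def Split_def
    using E_sub E_iso E_comp E_pullback E_has_pullback iso_split_epi split_epi_comp split_epi_pullback_stable
    by (auto 0 3)
qed

section \<open>Split epic extensions are monadic\<close>

context extension_class
begin

text \<open>
  The left adjoint of change of base along \<open>f\<close>: postcomposition with \<open>f\<close>.
\<close>

definition push where
  "push f = \<lparr>FObj = (\<lambda>x. f \<cdot> x), FArr = (\<lambda>(x, y, h). (f \<cdot> x, f \<cdot> y, h))\<rparr>"

lemma push_functor:
  assumes f: "f \<in> E"
  shows "cat_functor (Sl (Dom C f)) (Sl (Cod C f)) (push f)"
proof (intro cat_functor.intro category_Sl cat_functor_axioms.intro)
  note [simp] = E_arr[OF f]
  fix x assume "x \<in> Obj (Sl (Dom C f))"
  then show "FObj (push f) x \<in> Obj (Sl (Cod C f))"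
    "FArr (push f) (Idn (Sl (Dom C f)) x) = Idn (Sl (Cod C f)) (FObj (push f) x)"
    using f by (auto simp: push_def slice_in_simps E_arr intro: E_comp)
next
  fix k x y assume "k \<in> Hom (Sl (Dom C f)) x y"
  then obtain h where "k = (x, y, h)" and t: "x \<in> E" "y \<in> E" "Cod C x = Dom C f" "Cod C y = Dom C f"
    "h \<in> Arr C" "Dom C h = Dom C x" "Cod C h = Dom C y" "y \<cdot> h = x"
    by (auto simp: slice_in_hom[OF E_sub])
  then show "FArr (push f) k \<in> Hom (Sl (Cod C f)) (FObj (push f) x) (FObj (push f) y)"
    using f E_arr[OF f] by (auto simp: push_def slice_in_hom[OF E_sub] E_arr intro: E_comp)
next
  fix k k' x y z assume "k \<in> Hom (Sl (Dom C f)) x y" "k' \<in> Hom (Sl (Dom C f)) y z"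
  then show "FArr (push f) (k' \<cdot>\<^bsub>Sl (Dom C f)\<^esub> k) = FArr (push f) k' \<cdot>\<^bsub>Sl (Cod C f)\<^esub> FArr (push f) k"
    by (auto simp: push_def slice_in_hom[OF E_sub] slice_in_simps)
qed

lemma slice_iso:
  assumes "(x, y, h) \<in> Arr (Sl b)" "iso C h"
  shows "iso (Sl b) (x, y, h)"
proof -
  interpret S: category "Sl b" by (rule category_Sl)
  have t: "x \<in> E" "y \<in> E" "Cod C x = b" "Cod C y = b" "x \<in> Arr C" "y \<in> Arr C"
    "h \<in> Arr C" "Dom C h = Dom C x" "Cod C h = Dom C y" and yh: "y \<cdot> h = x"
    using assms(1) by (auto simp: slice_in_arr[OF E_sub] E_arr)
  obtain g where g: "g \<in> Arr C" "Dom C g = Dom C y" "Cod C g = Dom C x" "g \<cdot> h = Idn C (Dom C x)" "h \<cdot> g = Idn C (Dom C y)"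
    using assms(2) t(7-9) by (auto simp: iso_def Hom_def)
  have "y \<cdot> (h \<cdot> g) = x \<cdot> g"
    by (rule comp_eq_extend[OF yh]) (use t g(1-3) in auto)
  then have xg: "x \<cdot> g = y"
    using g t by simp
  show ?thesis
  proof (rule S.isoI)
    show "(x, y, h) \<in> Hom (Sl b) x y" "(y, x, g) \<in> Hom (Sl b) y x"
      using t yh xg g by (auto simp: slice_in_hom[OF E_sub])
  qed (use g in \<open>simp_all add: slice_in_simps\<close>)
qed

definition push_unit where "push_unit f x = (x, bc f (f \<cdot> x), lift f (f \<cdot> x) (Idn C (Dom C x)) x)"
definition push_counit where "push_counit f y = (f \<cdot> bc f y, y, pr f y)"

lemma push_unit_lift:
  assumes "f \<in> E" "x \<in> E" "Cod C x = Dom C f"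
  defines "w \<equiv> lift f (f \<cdot> x) (Idn C (Dom C x)) x"
  shows "w \<in> Arr C" "Dom C w = Dom C x" "Cod C w = Dom C (bc f (f \<cdot> x))"
    "pr f (f \<cdot> x) \<cdot> w = Idn C (Dom C x)" "bc f (f \<cdot> x) \<cdot> w = x"
  unfolding w_def by (rule lift; use assms(1-3) E_comp[of x f] in \<open>auto simp: E_arr\<close>)+

lemma push_base_change_adjunction:
  assumes f: "f \<in> E"
  shows "adjunction (Sl (Dom C f)) (Sl (Cod C f)) (push f) (base_change C f) (push_unit f) (push_counit f)"
proof -
  note [simp] = E_arr[OF f]
  interpret P: cat_functor "Sl (Dom C f)" "Sl (Cod C f)" "push f"
    by (rule push_functor[OF f])
  interpret U: cat_functor "Sl (Cod C f)" "Sl (Dom C f)" "base_change C f"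
    by (rule base_change_functor) simp
  have fx: "f \<cdot> x \<in> E" if "x \<in> E" "Cod C x = Dom C f" for x
    using that f by (intro E_comp) auto
  have unit: "nat_trans (Sl (Dom C f)) (Sl (Dom C f)) id_func (base_change C f \<circ>\<^sub>F push f) (push_unit f)"
  proof (intro nat_trans.intro nat_trans_axioms.intro category.cat_functor_id[OF category_Sl]
      cat_functor_comp[OF P.cat_functor_axioms U.cat_functor_axioms])
    fix x assume x: "x \<in> Obj (Sl (Dom C f))"
    then have "x \<in> E" "Cod C x = Dom C f" by (auto simp: slice_in_simps)
    then show "push_unit f x \<in> Hom (Sl (Dom C f)) (FObj id_func x) (FObj (base_change C f \<circ>\<^sub>F push f) x)"
      using push_unit_lift[OF f, of x] fx[of x]
      by (auto simp: push_unit_def slice_in_hom[OF E_sub] base_change_simps push_def bc_E E_arr)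
  next
    fix k x y assume k: "k \<in> Hom (Sl (Dom C f)) x y"
    then obtain h where h: "k = (x, y, h)" and t: "x \<in> E" "y \<in> E" "Cod C x = Dom C f" "Cod C y = Dom C f"
      "h \<in> Arr C" "Dom C h = Dom C x" "Cod C h = Dom C y" "x \<in> Arr C" "y \<in> Arr C" and yh: "y \<cdot> h = x"
      by (auto simp: slice_in_hom[OF E_sub] E_arr)
    have a: "(f \<cdot> x, f \<cdot> y, h) \<in> Arr (Sl (Cod C f))"
      using P.arr_FArr[of k] k by (auto simp: h push_def Hom_def)
    note w = bc_arr[OF _ a, simplified]
    note lx = push_unit_lift[OF f t(1,3)] and ly = push_unit_lift[OF f t(2,4)]
    let ?lx = "lift f (f \<cdot> x) (Idn C (Dom C x)) x" and ?ly = "lift f (f \<cdot> y) (Idn C (Dom C y)) y"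
    let ?w = "lift f (f \<cdot> y) (h \<cdot> pr f (f \<cdot> x)) (bc f (f \<cdot> x))"
    have "?ly \<cdot> h = ?w \<cdot> ?lx"
    proof (rule bc_unique[of "f \<cdot> y" f])
      have "pr f (f \<cdot> y) \<cdot> (?ly \<cdot> h) = Idn C (Dom C y) \<cdot> h"
        by (rule comp_eq_extend[OF ly(4)]) (use t fx ly(1-3) in auto)
      moreover have "pr f (f \<cdot> y) \<cdot> (?w \<cdot> ?lx) = h \<cdot> (pr f (f \<cdot> x) \<cdot> ?lx)"
        by (rule square_extend[OF w(4)]) (use t fx lx(1-3) w(1-3) in auto)
      ultimately show "pr f (f \<cdot> y) \<cdot> (?ly \<cdot> h) = pr f (f \<cdot> y) \<cdot> (?w \<cdot> ?lx)"
        using lx(4) t by simp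
      have "bc f (f \<cdot> y) \<cdot> (?ly \<cdot> h) = y \<cdot> h"
        by (rule comp_eq_extend[OF ly(5)]) (use t fx ly(1-3) in auto)
      moreover have "bc f (f \<cdot> y) \<cdot> (?w \<cdot> ?lx) = bc f (f \<cdot> x) \<cdot> ?lx"
        by (rule comp_eq_extend[OF w(5)]) (use t fx lx(1-3) w(1-3) in auto)
      ultimately show "bc f (f \<cdot> y) \<cdot> (?ly \<cdot> h) = bc f (f \<cdot> y) \<cdot> (?w \<cdot> ?lx)"
        using lx(5) yh by simp
    qed (use t fx lx(1-3) ly(1-3) w(1-3) in auto)
    then show "push_unit f y \<cdot>\<^bsub>Sl (Dom C f)\<^esub> FArr id_func k
        = FArr (base_change C f \<circ>\<^sub>F push f) k \<cdot>\<^bsub>Sl (Dom C f)\<^esub> push_unit f x"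
      by (simp add: h push_unit_def slice_in_simps push_def base_change_simps)
  qed
  have counit: "nat_trans (Sl (Cod C f)) (Sl (Cod C f)) (push f \<circ>\<^sub>F base_change C f) id_func (push_counit f)"
  proof (intro nat_trans.intro nat_trans_axioms.intro category.cat_functor_id[OF category_Sl]
      cat_functor_comp[OF U.cat_functor_axioms P.cat_functor_axioms])
    fix y assume y: "y \<in> Obj (Sl (Cod C f))"
    then have "y \<in> E" "Cod C y = Cod C f" by (auto simp: slice_in_simps)
    then show "push_counit f y \<in> Hom (Sl (Cod C f)) (FObj (push f \<circ>\<^sub>F base_change C f) y) (FObj id_func y)"
      using pb_comm[of y f] fx[of "bc f y"]
      by (auto simp: push_counit_def slice_in_hom[OF E_sub] base_change_simps push_def bc_E E_arr)
  next
    fix k x y assume k: "k \<in> Hom (Sl (Cod C f)) x y"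
    then obtain h where h: "k = (x, y, h)" and a: "(x, y, h) \<in> Arr (Sl (Cod C f))"
      by (auto simp: slice_in_hom[OF E_sub] slice_in_arr[OF E_sub])
    from bc_arr(4)[OF _ a]
    show "push_counit f y \<cdot>\<^bsub>Sl (Cod C f)\<^esub> FArr (push f \<circ>\<^sub>F base_change C f) k
        = FArr id_func k \<cdot>\<^bsub>Sl (Cod C f)\<^esub> push_counit f x"
      by (simp add: h push_counit_def slice_in_simps push_def base_change_simps)
  qed
  show ?thesis
  proof (intro adjunction.intro unit counit P.cat_functor_axioms U.cat_functor_axioms adjunction_axioms.intro)
    fix x assume "x \<in> Obj (Sl (Dom C f))"
    then have "x \<in> E" "Cod C x = Dom C f" by (auto simp: slice_in_simps)
    then show "push_counit f (FObj (push f) x) \<cdot>\<^bsub>Sl (Cod C f)\<^esub> FArr (push f) (push_unit f x)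
        = Idn (Sl (Cod C f)) (FObj (push f) x)"
      using push_unit_lift(4)[OF f, of x] E_arr[of x]
      by (simp add: push_counit_def push_unit_def slice_in_simps push_def)
  next
    fix y assume "y \<in> Obj (Sl (Cod C f))"
    then have y: "y \<in> E" "Cod C y = Cod C f" by (auto simp: slice_in_simps)
    let ?b = "bc f y"
    have b: "?b \<in> E" "Cod C ?b = Dom C f" using y by (simp_all add: bc_E)
    have a: "(f \<cdot> ?b, y, pr f y) \<in> Arr (Sl (Cod C f))"
      using y b pb_comm[of y f] fx[OF b] by (auto simp: slice_in_arr[OF E_sub])
    note w = bc_arr[OF _ a, simplified] and l = push_unit_lift[OF f b]
    let ?w = "lift f y (pr f y \<cdot> pr f (f \<cdot> ?b)) (bc f (f \<cdot> ?b))"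
    let ?l = "lift f (f \<cdot> ?b) (Idn C (Dom C ?b)) ?b"
    have "?w \<cdot> ?l = Idn C (Dom C ?b)"
    proof (rule bc_unique[of y f])
      have "pr f y \<cdot> (?w \<cdot> ?l) = pr f y \<cdot> (pr f (f \<cdot> ?b) \<cdot> ?l)"
        by (rule square_extend[OF w(4)]) (use y b fx w(1-3) l(1-3) in auto)
      then show "pr f y \<cdot> (?w \<cdot> ?l) = pr f y \<cdot> Idn C (Dom C ?b)"
        by (simp add: l(4))
      have "bc f y \<cdot> (?w \<cdot> ?l) = bc f (f \<cdot> ?b) \<cdot> ?l"
        by (rule comp_eq_extend[OF w(5)]) (use y b fx w(1-3) l(1-3) in auto)
      then show "bc f y \<cdot> (?w \<cdot> ?l) = bc f y \<cdot> Idn C (Dom C ?b)"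
        using y by (simp add: l(5))
    qed (use y b fx w(1-3) l(1-3) in auto)
    then show "FArr (base_change C f) (push_counit f y) \<cdot>\<^bsub>Sl (Dom C f)\<^esub> push_unit f (FObj (base_change C f) y)
        = Idn (Sl (Dom C f)) (FObj (base_change C f) y)"
      by (simp add: push_counit_def push_unit_def slice_in_simps base_change_simps)
  qed
qed

text \<open>
  If \<open>s\<close> is a section of \<open>f\<close>, then pulling back along \<open>f\<close> and then along \<open>s\<close> is, by pasting, pulling back
  along \<open>f \<cdot> s = 1\<close>. So change of base along \<open>s\<close> retracts change of base along \<open>f\<close>.
\<close>

theorem split_epi_base_change_monadic:
  assumes f: "f \<in> E" and split: "split_epi C f"
  shows "monadic_functor (Sl (Cod C f)) (Sl (Dom C f)) (base_change C f)"
proof -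
  note [simp] = E_arr[OF f]
  obtain s where [simp]: "s \<in> Arr C" "Dom C s = Cod C f" "Cod C s = Dom C f" and s: "f \<cdot> s = Idn C (Cod C f)"
    using split by (rule split_epiE) auto
  interpret adj: adjunction "Sl (Dom C f)" "Sl (Cod C f)" "push f" "base_change C f" "push_unit f" "push_counit f"
    by (rule push_base_change_adjunction[OF f])
  interpret V: cat_functor "Sl (Dom C f)" "Sl (Cod C f)" "base_change C s"
    using base_change_functor[of s] by simp
  define \<theta> where "\<theta> y = (bc s (bc f y), y, pr f y \<cdot> pr s (bc f y))" for y
  have pb: "is_pullback C y (Idn C (Cod C y)) (pr f y \<cdot> pr s (bc f y)) (bc s (bc f y))"
    if "y \<in> E" "Cod C y = Cod C f" for y
    using pullback_paste[OF pb_along[of y f] pb_along[of "bc f y" s]] that s by (simp add: bc_E)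
  have hom: "\<theta> y \<in> Hom (Sl (Cod C f)) (bc s (bc f y)) y" if "y \<in> E" "Cod C y = Cod C f" for y
    using pullback_arr[OF pb[OF that]] pullback_square[OF pb[OF that]] that
    by (auto simp: \<theta>_def slice_in_hom[OF E_sub] bc_E)
  have nat: "nat_trans (Sl (Cod C f)) (Sl (Cod C f)) (base_change C s \<circ>\<^sub>F base_change C f) id_func \<theta>"
  proof (intro nat_trans.intro nat_trans_axioms.intro category.cat_functor_id[OF category_Sl]
      cat_functor_comp[OF adj.right.cat_functor_axioms V.cat_functor_axioms])
    fix y assume "y \<in> Obj (Sl (Cod C f))"
    then show "\<theta> y \<in> Hom (Sl (Cod C f)) (FObj (base_change C s \<circ>\<^sub>F base_change C f) y) (FObj id_func y)"
      using hom by (auto simp: slice_in_simps base_change_simps)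
  next
    fix k x y assume k: "k \<in> Hom (Sl (Cod C f)) x y"
    then obtain h where h: "k = (x, y, h)" and t: "x \<in> E" "y \<in> E" "Cod C x = Cod C f" "Cod C y = Cod C f"
      "h \<in> Arr C" "Dom C h = Dom C x" "Cod C h = Dom C y" and a: "(x, y, h) \<in> Arr (Sl (Cod C f))"
      by (auto simp: slice_in_hom[OF E_sub] slice_in_arr[OF E_sub])
    let ?w = "lift f y (h \<cdot> pr f x) (bc f x)"
    have a': "(bc f x, bc f y, ?w) \<in> Arr (Sl (Cod C s))"
      using adj.right.arr_FArr[OF a] by (simp add: base_change_simps)
    note w = bc_arr[OF _ a, simplified] and w' = bc_arr[OF _ a', simplified]
    let ?w' = "lift s (bc f y) (?w \<cdot> pr s (bc f x)) (bc s (bc f x))"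
    have "pr f y \<cdot> (pr s (bc f y) \<cdot> ?w') = pr f y \<cdot> (?w \<cdot> pr s (bc f x))"
      by (simp only: w'(4))
    also have "\<dots> = h \<cdot> (pr f x \<cdot> pr s (bc f x))"
      by (rule square_extend[OF w(4)]) (use t w(1-3) in \<open>auto simp: bc_E\<close>)
    finally have "(pr f y \<cdot> pr s (bc f y)) \<cdot> ?w' = h \<cdot> (pr f x \<cdot> pr s (bc f x))"
      using t w'(1-3) by (simp add: bc_E)
    then show "\<theta> y \<cdot>\<^bsub>Sl (Cod C f)\<^esub> FArr (base_change C s \<circ>\<^sub>F base_change C f) k
        = FArr id_func k \<cdot>\<^bsub>Sl (Cod C f)\<^esub> \<theta> x"
      by (simp add: h \<theta>_def slice_in_simps base_change_simps)
  qed
  interpret retracted_right_adjoint "Sl (Dom C f)" "Sl (Cod C f)" "push f" "base_change C f"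
    "push_unit f" "push_counit f" "base_change C s" \<theta>
  proof (intro retracted_right_adjoint.intro category_Sl adj.adjunction_axioms V.cat_functor_axioms nat
      retracted_right_adjoint_axioms.intro)
    fix y assume "y \<in> Obj (Sl (Cod C f))"
    then have y: "y \<in> E" "Cod C y = Cod C f" by (auto simp: slice_in_simps)
    have "iso C (pr f y \<cdot> pr s (bc f y))"
      using pullback_along_identity_iso[OF pb[OF y]] .
    then show "iso (Sl (Cod C f)) (\<theta> y)"
      using hom[OF y] unfolding \<theta>_def by (intro slice_iso) (auto simp: Hom_def)
  qed
  show ?thesis by (rule monadic_if_retracted)
qed

end

section \<open>Transposition along an adjunction\<close>

context adjunction
begin

lemma transpose:
  assumes "a \<in> Obj A" "x \<in> Obj X" "f \<in> Hom A a (FObj G x)"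
  shows "\<epsilon> x \<cdot>\<^bsub>X\<^esub> FArr F f \<in> Hom X (FObj F a) x" "FArr G (\<epsilon> x \<cdot>\<^bsub>X\<^esub> FArr F f) \<cdot>\<^bsub>A\<^esub> \<eta> a = f"
proof -
  have [simp]: "f \<in> Arr A" "Dom A f = a" "Cod A f = FObj G x"
    using assms(3) by (auto simp: Hom_def)
  show "\<epsilon> x \<cdot>\<^bsub>X\<^esub> FArr F f \<in> Hom X (FObj F a) x"
    using assms(1,2) by (simp add: Hom_def)
  have "FArr G (\<epsilon> x) \<cdot>\<^bsub>A\<^esub> (FArr G (FArr F f) \<cdot>\<^bsub>A\<^esub> \<eta> a) = FArr G (\<epsilon> x) \<cdot>\<^bsub>A\<^esub> (\<eta> (FObj G x) \<cdot>\<^bsub>A\<^esub> f)"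
    using unit.naturality_arr[of f] by simp
  also have "\<dots> = Idn A (FObj G x) \<cdot>\<^bsub>A\<^esub> f"
    using assms(1,2) triangle_right[of x] by (intro unit.F.A.comp_eq_extend) auto
  finally show "FArr G (\<epsilon> x \<cdot>\<^bsub>X\<^esub> FArr F f) \<cdot>\<^bsub>A\<^esub> \<eta> a = f"
    using assms(1,2) by simp
qed

lemma transpose_unique:
  assumes "a \<in> Obj A" "k \<in> Hom X (FObj F a) x" "k' \<in> Hom X (FObj F a) x"
    "FArr G k \<cdot>\<^bsub>A\<^esub> \<eta> a = FArr G k' \<cdot>\<^bsub>A\<^esub> \<eta> a"
  shows "k = k'"
proof -
  have "j = \<epsilon> x \<cdot>\<^bsub>X\<^esub> FArr F (FArr G j \<cdot>\<^bsub>A\<^esub> \<eta> a)" if "j \<in> Hom X (FObj F a) x" for j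
  proof -
    have [simp]: "j \<in> Arr X" "Dom X j = FObj F a" "Cod X j = x"
      using that by (auto simp: Hom_def)
    then have [simp]: "x \<in> Obj X" using counit.F.A.cod_obj by blast
    have "\<epsilon> x \<cdot>\<^bsub>X\<^esub> (FArr F (FArr G j) \<cdot>\<^bsub>X\<^esub> FArr F (\<eta> a)) = j \<cdot>\<^bsub>X\<^esub> (\<epsilon> (FObj F a) \<cdot>\<^bsub>X\<^esub> FArr F (\<eta> a))"
      using assms(1) counit.naturality_arr[of j] by (intro counit.F.A.square_extend) auto
    then show ?thesis
      using assms(1) triangle_left[of a] by simp
  qed
  from this[OF assms(2)] this[OF assms(3)] show ?thesis
    using assms(4) by simp
qed

lemma universal_unit:
  assumes "a \<in> Obj A" "x \<in> Obj X" "f \<in> Hom A a (FObj G x)"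
  shows "\<exists>!k. k \<in> Hom X (FObj F a) x \<and> FArr G k \<cdot>\<^bsub>A\<^esub> \<eta> a = f"
  using transpose[OF assms] transpose_unique[OF assms(1)] by metis

lemma right_adjoint_preserves_pullback:
  assumes pb: "is_pullback X f g p q"
  shows "is_pullback A (FArr G f) (FArr G g) (FArr G p) (FArr G q)"
proof -
  note [simp] = counit.F.A.pullback_arr[OF pb]
  show ?thesis
  proof (rule unit.F.A.pullbackI)
    show "FArr G f \<cdot>\<^bsub>A\<^esub> FArr G p = FArr G g \<cdot>\<^bsub>A\<^esub> FArr G q"
      using counit.F.A.pullback_square[OF pb] by (simp flip: right.FArr_comp)
  next
    fix u v assume u [simp]: "u \<in> Arr A" "v \<in> Arr A" "Dom A u = Dom A v" "Cod A u = Dom A (FArr G f)"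
      "Cod A v = Dom A (FArr G g)" and sq: "FArr G f \<cdot>\<^bsub>A\<^esub> u = FArr G g \<cdot>\<^bsub>A\<^esub> v"
    define z where "z = Dom A v"
    have z [simp]: "z \<in> Obj A" "Dom A v = z" by (simp_all add: z_def)
    have hu: "u \<in> Hom A z (FObj G (Dom X f))" and hv: "v \<in> Hom A z (FObj G (Dom X g))"
      by (simp_all add: Hom_def)
    obtain u' where u': "u' \<in> Hom X (FObj F z) (Dom X f)" "FArr G u' \<cdot>\<^bsub>A\<^esub> \<eta> z = u"
      using universal_unit[OF z(1) _ hu] by auto
    obtain v' where v': "v' \<in> Hom X (FObj F z) (Dom X g)" "FArr G v' \<cdot>\<^bsub>A\<^esub> \<eta> z = v"
      using universal_unit[OF z(1) _ hv] by auto
    have t [simp]: "u' \<in> Arr X" "v' \<in> Arr X" "Dom X u' = FObj F z" "Dom X v' = FObj F z"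
      "Cod X u' = Dom X f" "Cod X v' = Dom X g"
      using u' v' by (auto simp: Hom_def)
    have "f \<cdot>\<^bsub>X\<^esub> u' = g \<cdot>\<^bsub>X\<^esub> v'"
      by (rule transpose_unique[of z _ "Cod X g"]) (use u'(2) v'(2) sq in \<open>simp_all add: Hom_def\<close>)
    then obtain w where w [simp]: "w \<in> Arr X" "Dom X w = FObj F z" "Cod X w = Dom X q"
      and w': "p \<cdot>\<^bsub>X\<^esub> w = u'" "q \<cdot>\<^bsub>X\<^esub> w = v'"
      using counit.F.A.pullback_lift[OF pb, of u' v'] by auto
    have "FArr G p \<cdot>\<^bsub>A\<^esub> FArr G w = FArr G u'" "FArr G q \<cdot>\<^bsub>A\<^esub> FArr G w = FArr G v'"
      by (simp_all flip: right.FArr_comp add: w')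
    then have "FArr G p \<cdot>\<^bsub>A\<^esub> (FArr G w \<cdot>\<^bsub>A\<^esub> \<eta> z) = FArr G u' \<cdot>\<^bsub>A\<^esub> \<eta> z"
      "FArr G q \<cdot>\<^bsub>A\<^esub> (FArr G w \<cdot>\<^bsub>A\<^esub> \<eta> z) = FArr G v' \<cdot>\<^bsub>A\<^esub> \<eta> z"
      by (auto intro!: unit.F.A.comp_eq_extend)
    then show "\<exists>w. w \<in> Arr A \<and> Dom A w = Dom A v \<and> Cod A w = Dom A (FArr G p) \<and>
        FArr G p \<cdot>\<^bsub>A\<^esub> w = u \<and> FArr G q \<cdot>\<^bsub>A\<^esub> w = v"
      using u'(2) v'(2) by (intro exI[of _ "FArr G w \<cdot>\<^bsub>A\<^esub> \<eta> z"]) simp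
  next
    fix w w' assume w [simp]: "w \<in> Arr A" "w' \<in> Arr A" "Dom A w = Dom A w'"
      "Cod A w = Dom A (FArr G p)" "Cod A w' = Dom A (FArr G p)"
      and eq: "FArr G p \<cdot>\<^bsub>A\<^esub> w = FArr G p \<cdot>\<^bsub>A\<^esub> w'" "FArr G q \<cdot>\<^bsub>A\<^esub> w = FArr G q \<cdot>\<^bsub>A\<^esub> w'"
    define z where "z = Dom A w'"
    have z [simp]: "z \<in> Obj A" "Dom A w' = z" by (simp_all add: z_def)
    have hw: "w \<in> Hom A z (FObj G (Dom X q))" "w' \<in> Hom A z (FObj G (Dom X q))"
      by (simp_all add: Hom_def)
    obtain v where v: "v \<in> Hom X (FObj F z) (Dom X q)" "FArr G v \<cdot>\<^bsub>A\<^esub> \<eta> z = w"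
      using universal_unit[OF z(1) _ hw(1)] by auto
    obtain v' where v': "v' \<in> Hom X (FObj F z) (Dom X q)" "FArr G v' \<cdot>\<^bsub>A\<^esub> \<eta> z = w'"
      using universal_unit[OF z(1) _ hw(2)] by auto
    have t [simp]: "v \<in> Arr X" "v' \<in> Arr X" "Dom X v = FObj F z" "Dom X v' = FObj F z"
      "Cod X v = Dom X q" "Cod X v' = Dom X q"
      using v v' by (auto simp: Hom_def)
    have "v = v'"
    proof (rule counit.F.A.pullback_unique[OF pb])
      show "p \<cdot>\<^bsub>X\<^esub> v = p \<cdot>\<^bsub>X\<^esub> v'"
        by (rule transpose_unique[of z _ "Dom X f"]) (use v(2) v'(2) eq in \<open>simp_all add: Hom_def\<close>)
      show "q \<cdot>\<^bsub>X\<^esub> v = q \<cdot>\<^bsub>X\<^esub> v'"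
        by (rule transpose_unique[of z _ "Dom X g"]) (use v(2) v'(2) eq in \<open>simp_all add: Hom_def\<close>)
    qed simp_all
    then show "w = w'" using v v' by simp
  qed simp_all
qed

end

section \<open>Trivial and normal extensions\<close>

locale split_admissible_galois = C: category C + X: category X + galois_structure C X I H \<eta> \<epsilon> E F
  for C :: "('o, 'a) cat" and X :: "('p, 'b) cat"
    and I :: "('o, 'a, 'p, 'b) func" and H :: "('p, 'b, 'o, 'a) func"
    and \<eta> :: "'o \<Rightarrow> 'a" and \<epsilon> :: "'p \<Rightarrow> 'b" and E :: "'a set" and F :: "'b set" +
  assumes split_admissible: "admissible C X I H \<eta> (Split C E) (Split X F)"
begin

sublocale C: extension_class C E
  by unfold_locales (rule class_E)

sublocale X: extension_class X F
  by unfold_locales (rule class_F)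

sublocale CS: extension_class C "Split C E"
  by (rule C.split_class)

sublocale XS: extension_class X "Split X F"
  by (rule X.split_class)

abbreviation trivial_split where "trivial_split \<equiv> trivial_ext C I H \<eta> (Split C E)"
abbreviation normal where "normal \<equiv> normal_ext C I H \<eta> E"

lemma I_Split: "f \<in> Split C E \<Longrightarrow> FArr I f \<in> Split X F"
  using I_E left.split_epi_FArr by (auto simp: Split_def)

lemma H_Split: "\<phi> \<in> Split X F \<Longrightarrow> FArr H \<phi> \<in> Split C E"
  using H_F right.split_epi_FArr by (auto simp: Split_def)

text \<open>
  Full faithfulness of \<open>H\<^sup>b\<close> without slices: arrows over \<open>b\<close> between the pullbacks of \<open>H \<phi>\<close> and \<open>H \<psi>\<close>
  correspond to arrows \<open>\<phi> \<rightarrow> \<psi>\<close> over \<open>I b\<close>.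
\<close>

lemma admissible_unique_lift:
  assumes b: "b \<in> Obj C" and \<phi>: "\<phi> \<in> Split X F" "Cod X \<phi> = FObj I b"
    and \<psi>: "\<psi> \<in> Split X F" "Cod X \<psi> = FObj I b"
    and h: "h \<in> Arr C" "Dom C h = Dom C (C.bc (\<eta> b) (FArr H \<phi>))" "Cod C h = Dom C (C.bc (\<eta> b) (FArr H \<psi>))"
      "C.bc (\<eta> b) (FArr H \<psi>) \<cdot>\<^bsub>C\<^esub> h = C.bc (\<eta> b) (FArr H \<phi>)"
  shows "\<exists>!v. v \<in> Hom X (Dom X \<phi>) (Dom X \<psi>) \<and> \<psi> \<cdot>\<^bsub>X\<^esub> v = \<phi> \<and>
    C.pr (\<eta> b) (FArr H \<psi>) \<cdot>\<^bsub>C\<^esub> h = FArr H v \<cdot>\<^bsub>C\<^esub> C.pr (\<eta> b) (FArr H \<phi>)"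
proof -
  let ?K = "base_change C (\<eta> b) \<circ>\<^sub>F slice_func H"
  let ?A = "C.bc (\<eta> b) (FArr H \<phi>)" and ?B = "C.bc (\<eta> b) (FArr H \<psi>)"
  let ?l = "\<lambda>v. C.lift (\<eta> b) (FArr H \<psi>) (FArr H v \<cdot>\<^bsub>C\<^esub> C.pr (\<eta> b) (FArr H \<phi>)) ?A"
  have t: "FArr H \<phi> \<in> Split C E" "FArr H \<psi> \<in> Split C E" "\<phi> \<in> Arr X" "\<psi> \<in> Arr X"
    using \<phi> \<psi> H_Split XS.E_arr by auto
  have c: "Cod C (FArr H \<phi>) = Cod C (\<eta> b)" "Cod C (FArr H \<psi>) = Cod C (\<eta> b)"
    using t \<phi>(2) \<psi>(2) b by simp_all
  note pbt [simp] = CS.pb_typing[OF t(1) unit.arr_component[OF b] c(1)] CS.pb_typing[OF t(2) unit.arr_component[OF b] c(2)]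
  have bij: "bij_betw (FArr ?K) (Hom (XS.Sl (FObj I b)) \<phi> \<psi>) (Hom (CS.Sl b) (FObj ?K \<phi>) (FObj ?K \<psi>))"
    using split_admissible b \<phi> \<psi> unfolding admissible_def fully_faithful_def
    by (auto simp: slice_in_simps)
  have K_obj: "FObj ?K \<phi> = ?A" "FObj ?K \<psi> = ?B"
    by (simp_all add: C.base_change_simps slice_func_def)
  have K_arr: "FArr ?K (\<phi>, \<psi>, v) = (?A, ?B, ?l v)" for v
    by (simp add: C.base_change_simps slice_func_def)
  have hom_iff: "k \<in> Hom (XS.Sl (FObj I b)) \<phi> \<psi> \<longleftrightarrow>
    (\<exists>v. k = (\<phi>, \<psi>, v) \<and> v \<in> Hom X (Dom X \<phi>) (Dom X \<psi>) \<and> \<psi> \<cdot>\<^bsub>X\<^esub> v = \<phi>)" for k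
    using \<phi> \<psi> by (subst slice_in_hom[OF XS.E_sub]) (auto simp: Hom_def)
  have l: "(?l v = h) = (C.pr (\<eta> b) (FArr H \<psi>) \<cdot>\<^bsub>C\<^esub> h = FArr H v \<cdot>\<^bsub>C\<^esub> C.pr (\<eta> b) (FArr H \<phi>))"
    if v: "v \<in> Hom X (Dom X \<phi>) (Dom X \<psi>)" "\<psi> \<cdot>\<^bsub>X\<^esub> v = \<phi>" for v
  proof -
    have [simp]: "v \<in> Arr X" "Dom X v = Dom X \<phi>" "Cod X v = Dom X \<psi>"
      using v by (auto simp: Hom_def)
    have "FArr H \<psi> \<cdot>\<^bsub>C\<^esub> FArr H v = FArr H \<phi>"
      using v(2) t by (simp flip: right.FArr_comp)
    then have "(FArr H \<phi>, FArr H \<psi>, FArr H v) \<in> Arr (CS.Sl (Cod C (\<eta> b)))"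
      using t c by (auto simp: slice_in_arr[OF CS.E_sub])
    note w = CS.bc_arr[OF unit.arr_component[OF b] this]
    show ?thesis
    proof
      assume eq: "C.pr (\<eta> b) (FArr H \<psi>) \<cdot>\<^bsub>C\<^esub> h = FArr H v \<cdot>\<^bsub>C\<^esub> C.pr (\<eta> b) (FArr H \<phi>)"
      show "?l v = h"
        by (rule CS.bc_unique[OF t(2) unit.arr_component[OF b] c(2)]) (use w h eq in simp_all)
    next
      assume "?l v = h"
      with w(4) show "C.pr (\<eta> b) (FArr H \<psi>) \<cdot>\<^bsub>C\<^esub> h = FArr H v \<cdot>\<^bsub>C\<^esub> C.pr (\<eta> b) (FArr H \<phi>)"
        by simp
    qed
  qed
  have "(?A, ?B, h) \<in> Hom (CS.Sl b) (FObj ?K \<phi>) (FObj ?K \<psi>)"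
    unfolding K_obj slice_in_hom[OF CS.E_sub]
    using h t c b CS.bc_E[of "FArr H \<phi>" "\<eta> b"] CS.bc_E[of "FArr H \<psi>" "\<eta> b"] by auto
  then have "(?A, ?B, h) \<in> FArr ?K ` Hom (XS.Sl (FObj I b)) \<phi> \<psi>"
    by (simp only: bij_betw_imp_surj_on[OF bij])
  then obtain k where k: "k \<in> Hom (XS.Sl (FObj I b)) \<phi> \<psi>" "FArr ?K k = (?A, ?B, h)"
    by (elim imageE) (rule that, assumption, erule sym)
  from k(1)[unfolded hom_iff]
  obtain v where v: "k = (\<phi>, \<psi>, v)" "v \<in> Hom X (Dom X \<phi>) (Dom X \<psi>)" "\<psi> \<cdot>\<^bsub>X\<^esub> v = \<phi>"
    by (elim exE conjE)
  have lv: "?l v = h"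
    using k(2) unfolding v(1) K_arr by (simp only: prod.inject)
  show ?thesis
  proof (rule ex1I[of _ v])
    show "v \<in> Hom X (Dom X \<phi>) (Dom X \<psi>) \<and> \<psi> \<cdot>\<^bsub>X\<^esub> v = \<phi> \<and>
        C.pr (\<eta> b) (FArr H \<psi>) \<cdot>\<^bsub>C\<^esub> h = FArr H v \<cdot>\<^bsub>C\<^esub> C.pr (\<eta> b) (FArr H \<phi>)"
      using v(2,3) l[OF v(2,3), THEN iffD1, OF lv] by (intro conjI)
  next
    fix v' assume v': "v' \<in> Hom X (Dom X \<phi>) (Dom X \<psi>) \<and> \<psi> \<cdot>\<^bsub>X\<^esub> v' = \<phi> \<and>
        C.pr (\<eta> b) (FArr H \<psi>) \<cdot>\<^bsub>C\<^esub> h = FArr H v' \<cdot>\<^bsub>C\<^esub> C.pr (\<eta> b) (FArr H \<phi>)"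
    then have "?l v' = h"
      by (elim conjE) (rule l[THEN iffD2])
    then have "FArr ?K (\<phi>, \<psi>, v') = FArr ?K k"
      unfolding k(2) K_arr by (simp only:)
    moreover have "(\<phi>, \<psi>, v') \<in> Hom (XS.Sl (FObj I b)) \<phi> \<psi>"
      unfolding hom_iff using v' by simp
    ultimately have "(\<phi>, \<psi>, v') = k"
      using bij_betw_imp_inj_on[OF bij] k(1) by (elim inj_onD)
    then show "v' = v" using v by simp
  qed
qed

text \<open>
  Full faithfulness of \<open>H\<^sup>b\<close> means that the counit of the adjunction between slices is invertible. That
  counit is the transpose \<open>m\<close> of \<open>p\<close>, so \<open>m\<close> identifies \<open>I f\<close> with \<open>\<phi>\<close> over \<open>I b\<close> and hence the given pullback
  square with the naturality square of \<open>\<eta>\<close> at \<open>f\<close>.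
\<close>

lemma trivial_split_if_pullback_of_H:
  assumes \<phi>: "\<phi> \<in> Split X F" and pb: "is_pullback C (FArr H \<phi>) (\<eta> b) p f" and b: "b \<in> Obj C"
    and co: "Cod X \<phi> = FObj I b"
  shows "trivial_split f"
proof -
  have H\<phi>: "FArr H \<phi> \<in> Split C E" and \<phi>_arr [simp]: "\<phi> \<in> Arr X"
    using \<phi> H_Split XS.E_arr by auto
  have f_split: "f \<in> Split C E"
    using CS.E_pullback[OF pb H\<phi>] .
  define a where "a = Dom C f"
  have f [simp]: "f \<in> Arr C" "Dom C f = a" "Cod C f = b" "p \<in> Arr C" "Dom C p = a" "Cod C p = FObj H (Dom X \<phi>)"
    using C.pullback_arr[OF pb] b by (auto simp: a_def)
  have a [simp]: "a \<in> Obj C" using C.dom_obj[of f] by simp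
  note [simp] = b co
  define \<psi> where "\<psi> = FArr I f"
  have \<psi>: "\<psi> \<in> Split X F" and [simp]: "\<psi> \<in> Arr X" "Dom X \<psi> = FObj I a" "Cod X \<psi> = FObj I b"
    unfolding \<psi>_def using I_Split[OF f_split] by simp_all
  have H\<psi>: "FArr H \<psi> \<in> Split C E" using H_Split[OF \<psi>] .
  let ?p0 = "C.pr (\<eta> b) (FArr H \<phi>)" and ?f0 = "C.bc (\<eta> b) (FArr H \<phi>)"
  let ?p1 = "C.pr (\<eta> b) (FArr H \<psi>)" and ?f1 = "C.bc (\<eta> b) (FArr H \<psi>)"
  note pb0 = CS.pb_along[OF H\<phi>, of "\<eta> b", simplified] and pb1 = CS.pb_along[OF H\<psi>, of "\<eta> b", simplified]
  note [simp] = CS.pb_typing[OF H\<phi>, of "\<eta> b", simplified] CS.pb_typing[OF H\<psi>, of "\<eta> b", simplified]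
  note sq = C.pullback_square[OF pb] and sq0 = C.pullback_square[OF pb0]
  obtain j where j [simp]: "j \<in> Arr C" "Dom C j = Dom C ?f0" "Cod C j = a" and j_eq: "p \<cdot>\<^bsub>C\<^esub> j = ?p0" "f \<cdot>\<^bsub>C\<^esub> j = ?f0"
    using C.pullback_lift[OF pb, of ?p0 ?f0] sq0 by auto
  obtain i where i [simp]: "i \<in> Arr C" "Dom C i = a" "Cod C i = Dom C ?f0" and i_eq: "?p0 \<cdot>\<^bsub>C\<^esub> i = p" "?f0 \<cdot>\<^bsub>C\<^esub> i = f"
    using C.pullback_lift[OF pb0, of p f] sq by auto
  have ji: "j \<cdot>\<^bsub>C\<^esub> i = Idn C a"
    by (rule C.pullback_unique[OF pb]) (simp_all add: C.comp_eq_extend[OF j_eq(1)] C.comp_eq_extend[OF j_eq(2)] i_eq)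
  have nat: "FArr H \<psi> \<cdot>\<^bsub>C\<^esub> \<eta> a = \<eta> b \<cdot>\<^bsub>C\<^esub> f"
    using unit.naturality_arr[of f] by (simp add: \<psi>_def)
  \<comment> \<open>The unit of the slice adjunction at \<open>f\<close>; full faithfulness turns it into the inverse \<open>v\<close> of \<open>m\<close>.\<close>
  obtain u where u [simp]: "u \<in> Arr C" "Dom C u = a" "Cod C u = Dom C ?f1" and u_eq: "?p1 \<cdot>\<^bsub>C\<^esub> u = \<eta> a" "?f1 \<cdot>\<^bsub>C\<^esub> u = f"
    using C.pullback_lift[OF pb1, of "\<eta> a" f] nat by auto
  have "?f1 \<cdot>\<^bsub>C\<^esub> (u \<cdot>\<^bsub>C\<^esub> j) = ?f0"
    using j_eq by (simp add: C.comp_eq_extend[OF u_eq(2)])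
  then obtain v where v: "v \<in> Hom X (Dom X \<phi>) (FObj I a)" "\<psi> \<cdot>\<^bsub>X\<^esub> v = \<phi>"
    and v': "?p1 \<cdot>\<^bsub>C\<^esub> (u \<cdot>\<^bsub>C\<^esub> j) = FArr H v \<cdot>\<^bsub>C\<^esub> ?p0"
    using admissible_unique_lift[OF b \<phi> co \<psi>, of "u \<cdot>\<^bsub>C\<^esub> j"] by auto
  have v_arr [simp]: "v \<in> Arr X" "Dom X v = Dom X \<phi>" "Cod X v = FObj I a"
    using v by (auto simp: Hom_def)
  have v0: "FArr H v \<cdot>\<^bsub>C\<^esub> ?p0 = \<eta> a \<cdot>\<^bsub>C\<^esub> j"
    using v' by (simp add: C.comp_eq_extend[OF u_eq(1)])
  have "FArr H v \<cdot>\<^bsub>C\<^esub> (?p0 \<cdot>\<^bsub>C\<^esub> i) = \<eta> a \<cdot>\<^bsub>C\<^esub> (j \<cdot>\<^bsub>C\<^esub> i)"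
    by (rule C.square_extend[OF v0]) simp_all
  then have vp: "FArr H v \<cdot>\<^bsub>C\<^esub> p = \<eta> a"
    by (simp add: i_eq ji)
  have "p \<in> Hom C a (FObj H (Dom X \<phi>))" by (simp add: Hom_def)
  from universal_unit[OF a _ this] obtain m where m: "m \<in> Hom X (FObj I a) (Dom X \<phi>)" "FArr H m \<cdot>\<^bsub>C\<^esub> \<eta> a = p"
    by auto
  have m_arr [simp]: "m \<in> Arr X" "Dom X m = FObj I a" "Cod X m = Dom X \<phi>"
    using m by (auto simp: Hom_def)
  have \<phi>m: "\<phi> \<cdot>\<^bsub>X\<^esub> m = \<psi>"
    by (rule transpose_unique[OF a, of _ "FObj I b"]) (use m sq nat in \<open>simp_all add: Hom_def\<close>)
  have vm: "v \<cdot>\<^bsub>X\<^esub> m = Idn X (FObj I a)"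
    by (rule transpose_unique[OF a, of _ "FObj I a"]) (use m vp in \<open>simp_all add: Hom_def\<close>)
  have "\<phi> \<cdot>\<^bsub>X\<^esub> (m \<cdot>\<^bsub>X\<^esub> v) = \<phi>"
    using v by (simp add: X.comp_eq_extend[OF \<phi>m])
  moreover have "FArr H (m \<cdot>\<^bsub>X\<^esub> v) \<cdot>\<^bsub>C\<^esub> ?p0 = ?p0"
  proof -
    have "FArr H m \<cdot>\<^bsub>C\<^esub> (FArr H v \<cdot>\<^bsub>C\<^esub> ?p0) = FArr H m \<cdot>\<^bsub>C\<^esub> (\<eta> a \<cdot>\<^bsub>C\<^esub> j)"
      by (simp only: v0)
    also have "\<dots> = p \<cdot>\<^bsub>C\<^esub> j"
      by (rule C.comp_eq_extend[OF m(2)]) simp_all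
    finally show ?thesis by (simp add: j_eq)
  qed
  ultimately have mv': "m \<cdot>\<^bsub>X\<^esub> v \<in> Hom X (Dom X \<phi>) (Dom X \<phi>) \<and> \<phi> \<cdot>\<^bsub>X\<^esub> (m \<cdot>\<^bsub>X\<^esub> v) = \<phi> \<and>
      ?p0 \<cdot>\<^bsub>C\<^esub> Idn C (Dom C ?f0) = FArr H (m \<cdot>\<^bsub>X\<^esub> v) \<cdot>\<^bsub>C\<^esub> ?p0"
    by (simp add: Hom_def)
  have "Idn X (Dom X \<phi>) \<in> Hom X (Dom X \<phi>) (Dom X \<phi>) \<and> \<phi> \<cdot>\<^bsub>X\<^esub> Idn X (Dom X \<phi>) = \<phi> \<and>
      ?p0 \<cdot>\<^bsub>C\<^esub> Idn C (Dom C ?f0) = FArr H (Idn X (Dom X \<phi>)) \<cdot>\<^bsub>C\<^esub> ?p0"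
    by (simp add: Hom_def)
  with mv' have mv: "m \<cdot>\<^bsub>X\<^esub> v = Idn X (Dom X \<phi>)"
    by (rule ex1_implies_eq[OF admissible_unique_lift[OF b \<phi> co \<phi> co, of "Idn C (Dom C ?f0)"], rotated 4])
      simp_all
  have "FArr H m \<cdot>\<^bsub>C\<^esub> FArr H v = Idn C (FObj H (Dom X \<phi>))" "FArr H v \<cdot>\<^bsub>C\<^esub> FArr H m = Idn C (FObj H (FObj I a))"
    using mv vm by (simp_all flip: right.FArr_comp)
  then have "iso C (FArr H m)"
    by (intro C.isoI[of _ "FObj H (FObj I a)" "FObj H (Dom X \<phi>)" "FArr H v"]) (simp_all add: Hom_def)
  from C.pullback_transport[OF pb this, of "\<eta> a"]
  have "is_pullback C (FArr H \<phi> \<cdot>\<^bsub>C\<^esub> FArr H m) (\<eta> b) (\<eta> a) f"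
    using m by simp
  then have "is_pullback C (FArr H (FArr I f)) (\<eta> b) (\<eta> a) f"
    using \<phi>m by (simp add: \<psi>_def flip: right.FArr_comp)
  then show ?thesis
    using f_split by (simp add: trivial_ext_def)
qed

text \<open>
  Pasting the naturality square at \<open>f\<close> with the given pullback, and using naturality of \<open>\<eta>\<close> at \<open>h\<close>, exhibits
  \<open>f'\<close> as a pullback of \<open>H \<phi>\<close> where \<open>\<phi>\<close> is the pullback of \<open>I f\<close> along \<open>I h\<close>.
\<close>

lemma trivial_split_pullback:
  assumes f: "trivial_split f" and pb: "is_pullback C f h p f'"
  shows "trivial_split f'"
proof -
  have f_split: "f \<in> Split C E" and f_pb: "is_pullback C (FArr H (FArr I f)) (\<eta> (Cod C f)) (\<eta> (Dom C f)) f"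
    using f by (simp_all add: trivial_ext_def)
  note t [simp] = C.pullback_arr(1-4,6-)[OF pb]
  have [simp]: "Cod C h = Cod C f" using C.pullback_arr(5)[OF pb] by simp
  obtain \<pi> \<phi> where pbX: "is_pullback X (FArr I f) (FArr I h) \<pi> \<phi>"
    using XS.E_has_pullback[OF I_Split[OF f_split], of "FArr I h"] by auto
  have \<phi>: "\<phi> \<in> Split X F"
    using XS.E_pullback[OF pbX I_Split[OF f_split]] .
  have "is_pullback C (FArr H (FArr I f)) (\<eta> (Cod C f) \<cdot>\<^bsub>C\<^esub> h) (\<eta> (Dom C f) \<cdot>\<^bsub>C\<^esub> p) f'"
    using C.pullback_paste[OF f_pb pb] .
  then have "is_pullback C (FArr H (FArr I f)) (FArr H (FArr I h) \<cdot>\<^bsub>C\<^esub> \<eta> (Dom C h)) (\<eta> (Dom C f) \<cdot>\<^bsub>C\<^esub> p) f'"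
    using unit.naturality_arr[of h] by simp
  from C.pullback_cancel[OF right_adjoint_preserves_pullback[OF pbX] this]
  obtain p' where "is_pullback C (FArr H \<phi>) (\<eta> (Dom C h)) p' f'"
    by auto
  then show ?thesis
    using X.pullback_arr[OF pbX] by (intro trivial_split_if_pullback_of_H[OF \<phi>]) simp_all
qed

lemma trivial_split_normal:
  assumes f: "trivial_split f"
  shows "normal f"
proof -
  have "f \<in> E" "split_epi C f" using f by (auto simp: trivial_ext_def Split_def)
  moreover have "trivial_split (C.bc f f)"
    using trivial_split_pullback[OF f C.pb_along] calculation by (simp add: C.E_arr)
  ultimately show ?thesis
    using C.split_epi_base_change_monadic[of f]
    by (auto simp: normal_ext_def monadic_ext_def trivial_ext_def C.base_change_simps Split_def)
qed

text \<open>
  The pullback of \<open>g\<close> along \<open>g \<cdot> t\<close> is the pullback along \<open>t\<close> of the kernel pair projection of \<open>g\<close>, which is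
  trivial by normality and split by the diagonal.
\<close>

lemma normal_pullback_trivial_split:
  assumes g: "normal g" and t: "t \<in> Arr C" "Cod C t = Dom C g"
  obtains p q where "is_pullback C g (g \<cdot>\<^bsub>C\<^esub> t) p q" "trivial_split q"
proof -
  let ?k = "C.bc g g"
  have gE: "g \<in> E" and k_triv: "trivial_ext C I H \<eta> E ?k"
    using g by (simp_all add: normal_ext_def monadic_ext_def C.base_change_simps)
  note [simp] = C.E_arr[OF gE]
  have pb: "is_pullback C g g (C.pr g g) ?k"
    using gE by (intro C.pb_along) auto
  have "split_epi C ?k"
    by (rule C.split_epi_pullback[OF pb, of "Idn C (Dom C g)"]) auto
  then have k: "trivial_split ?k"
    using k_triv by (auto simp: trivial_ext_def Split_def)
  have pb': "is_pullback C ?k t (C.pr t ?k) (C.bc t ?k)"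
    using gE t by (intro C.pb_along C.bc_E) auto
  show thesis
    using that[OF C.pullback_paste[OF pb pb'] trivial_split_pullback[OF k pb']] .
qed

lemma trivial_split_idn:
  assumes "b \<in> Obj C"
  shows "trivial_split (Idn C b)"
proof -
  have "Idn C b \<in> Split C E"
    using assms C.iso_idn CS.E_iso by blast
  moreover have "is_pullback C (Idn C (FObj H (FObj I b))) (\<eta> b) (\<eta> b) (Idn C b)"
    using assms by (intro C.pullbackI) auto
  ultimately show ?thesis
    using assms by (simp add: trivial_ext_def)
qed

end

section \<open>Left adjoints and pointwise Kan extensions\<close>

lemma left_adjoint_if_universal_unit:
  assumes u: "nat_trans B B id_func (G \<circ>\<^sub>F L) u" and L: "cat_functor B D L" and G: "cat_functor D B G"
    and univ: "\<And>f g h. \<lbrakk>f \<in> Obj B; g \<in> Obj D; h \<in> Hom B f (FObj G g)\<rbrakk> \<Longrightarrow>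
      \<exists>!w. w \<in> Hom D (FObj L f) g \<and> FArr G w \<cdot>\<^bsub>B\<^esub> u f = h"
  shows "left_adjoint B D L G"
proof -
  interpret B: category B using L by (simp add: cat_functor_def)
  interpret D: category D using L by (simp add: cat_functor_def)
  interpret L: cat_functor B D L by fact
  interpret G: cat_functor D B G by fact
  interpret u: nat_trans B B id_func "G \<circ>\<^sub>F L" u by fact
  define \<epsilon> where "\<epsilon> g = (THE w. w \<in> Hom D (FObj L (FObj G g)) g \<and> FArr G w \<cdot>\<^bsub>B\<^esub> u (FObj G g) = Idn B (FObj G g))" for g
  have \<epsilon>: "\<epsilon> g \<in> Hom D (FObj L (FObj G g)) g" "FArr G (\<epsilon> g) \<cdot>\<^bsub>B\<^esub> u (FObj G g) = Idn B (FObj G g)" if "g \<in> Obj D" for g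
    using theI'[OF univ[of "FObj G g" g "Idn B (FObj G g)"]] that unfolding \<epsilon>_def by (auto simp: B.idn_hom)
  have \<epsilon>_typing [simp]: "\<epsilon> g \<in> Arr D" "Dom D (\<epsilon> g) = FObj L (FObj G g)" "Cod D (\<epsilon> g) = g" if "g \<in> Obj D" for g
    using \<epsilon>(1)[OF that] by (auto simp: Hom_def)
  have eq: "v = w" if "f \<in> Obj B" "v \<in> Hom D (FObj L f) g" "w \<in> Hom D (FObj L f) g" "FArr G v \<cdot>\<^bsub>B\<^esub> u f = FArr G w \<cdot>\<^bsub>B\<^esub> u f"
    for f g v w
  proof (rule ex1_implies_eq[OF univ])
    show "FArr G w \<cdot>\<^bsub>B\<^esub> u f \<in> Hom B f (FObj G g)"
      using that by (auto simp: Hom_def)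
    show "g \<in> Obj D" using D.HomD(5)[OF that(2)] .
  qed (use that in auto)
  have "nat_trans D D (L \<circ>\<^sub>F G) id_func \<epsilon>"
  proof (intro nat_trans.intro nat_trans_axioms.intro cat_functor_comp[OF G L] D.cat_functor_id)
    fix g assume "g \<in> Obj D"
    then show "\<epsilon> g \<in> Hom D (FObj (L \<circ>\<^sub>F G) g) (FObj id_func g)" using \<epsilon> by simp
  next
    fix k g g' assume k: "k \<in> Hom D g g'"
    note [simp] = D.HomD[OF k]
    have "FArr G (\<epsilon> g') \<cdot>\<^bsub>B\<^esub> (FArr G (FArr L (FArr G k)) \<cdot>\<^bsub>B\<^esub> u (FObj G g)) = FArr G (\<epsilon> g') \<cdot>\<^bsub>B\<^esub> (u (FObj G g') \<cdot>\<^bsub>B\<^esub> FArr G k)"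
      using u.naturality_arr[of "FArr G k"] by simp
    also have "\<dots> = Idn B (FObj G g') \<cdot>\<^bsub>B\<^esub> FArr G k"
      by (rule B.comp_eq_extend[OF \<epsilon>(2)]) simp_all
    finally have "FArr G (\<epsilon> g' \<cdot>\<^bsub>D\<^esub> FArr L (FArr G k)) \<cdot>\<^bsub>B\<^esub> u (FObj G g) = FArr G (k \<cdot>\<^bsub>D\<^esub> \<epsilon> g) \<cdot>\<^bsub>B\<^esub> u (FObj G g)"
      by (simp add: \<epsilon>(2))
    then have "\<epsilon> g' \<cdot>\<^bsub>D\<^esub> FArr L (FArr G k) = k \<cdot>\<^bsub>D\<^esub> \<epsilon> g"
      by (rule eq[rotated 3, of _ _ _ g']) (simp_all add: Hom_def)
    then show "\<epsilon> g' \<cdot>\<^bsub>D\<^esub> FArr (L \<circ>\<^sub>F G) k = FArr id_func k \<cdot>\<^bsub>D\<^esub> \<epsilon> g"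
      by simp
  qed
  moreover have "\<epsilon> (FObj L f) \<cdot>\<^bsub>D\<^esub> FArr L (u f) = Idn D (FObj L f)" if [simp]: "f \<in> Obj B" for f
  proof (rule eq[of f _ "FObj L f"])
    have "FArr G (\<epsilon> (FObj L f)) \<cdot>\<^bsub>B\<^esub> (FArr G (FArr L (u f)) \<cdot>\<^bsub>B\<^esub> u f) = FArr G (\<epsilon> (FObj L f)) \<cdot>\<^bsub>B\<^esub> (u (FObj G (FObj L f)) \<cdot>\<^bsub>B\<^esub> u f)"
      using u.naturality_arr[of "u f"] by simp
    also have "\<dots> = Idn B (FObj G (FObj L f)) \<cdot>\<^bsub>B\<^esub> u f"
      by (rule B.comp_eq_extend[OF \<epsilon>(2)]) simp_all
    finally show "FArr G (\<epsilon> (FObj L f) \<cdot>\<^bsub>D\<^esub> FArr L (u f)) \<cdot>\<^bsub>B\<^esub> u f = FArr G (Idn D (FObj L f)) \<cdot>\<^bsub>B\<^esub> u f"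
      by simp
  qed (simp_all add: Hom_def)
  ultimately have "adjunction B D L G u \<epsilon>"
    using u L G \<epsilon>(2) by (intro adjunction.intro adjunction_axioms.intro)
  then show ?thesis
    unfolding left_adjoint_def by blast
qed

lemma left_adjoint_unique:
  assumes "left_adjoint A X F G" "left_adjoint A X F' G"
  shows "naturally_isomorphic A X F F'"
proof -
  obtain \<eta> \<epsilon> \<eta>' \<epsilon>' where adj: "adjunction A X F G \<eta> \<epsilon>" "adjunction A X F' G \<eta>' \<epsilon>'"
    using assms unfolding left_adjoint_def by blast
  interpret F: cat_functor A X F using adj(1) by (simp add: adjunction_def)
  interpret F': cat_functor A X F' using adj(2) by (simp add: adjunction_def)
  interpret a: adjunction A X F G \<eta> \<epsilon> by fact
  interpret a': adjunction A X F' G \<eta>' \<epsilon>' by fact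
  define \<tau> where "\<tau> x = (THE k. k \<in> Hom X (FObj F x) (FObj F' x) \<and> FArr G k \<cdot>\<^bsub>A\<^esub> \<eta> x = \<eta>' x)" for x
  have \<tau>: "\<tau> x \<in> Hom X (FObj F x) (FObj F' x)" "FArr G (\<tau> x) \<cdot>\<^bsub>A\<^esub> \<eta> x = \<eta>' x" if "x \<in> Obj A" for x
    using theI'[OF a.universal_unit[of x "FObj F' x" "\<eta>' x"]] a'.unit.component[of x] that unfolding \<tau>_def by auto
  have \<tau>_typing [simp]: "\<tau> x \<in> Arr X" "Dom X (\<tau> x) = FObj F x" "Cod X (\<tau> x) = FObj F' x" if "x \<in> Obj A" for x
    using \<tau>(1)[OF that] by (auto simp: Hom_def)
  have "nat_trans A X F F' \<tau>"
  proof (intro nat_trans.intro nat_trans_axioms.intro F.cat_functor_axioms F'.cat_functor_axioms \<tau>(1))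
    fix f x y assume f: "f \<in> Hom A x y"
    note [simp] = F.A.HomD[OF f]
    have "FArr G (\<tau> y) \<cdot>\<^bsub>A\<^esub> (FArr G (FArr F f) \<cdot>\<^bsub>A\<^esub> \<eta> x) = FArr G (\<tau> y) \<cdot>\<^bsub>A\<^esub> (\<eta> y \<cdot>\<^bsub>A\<^esub> f)"
      using a.unit.naturality_arr[of f] by simp
    also have "\<dots> = \<eta>' y \<cdot>\<^bsub>A\<^esub> f"
      by (rule F.A.comp_eq_extend[OF \<tau>(2)]) simp_all
    finally have "FArr G (\<tau> y \<cdot>\<^bsub>X\<^esub> FArr F f) \<cdot>\<^bsub>A\<^esub> \<eta> x = FArr G (FArr F' f \<cdot>\<^bsub>X\<^esub> \<tau> x) \<cdot>\<^bsub>A\<^esub> \<eta> x"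
      using a'.unit.naturality_arr[of f] by (simp add: \<tau>(2))
    then show "\<tau> y \<cdot>\<^bsub>X\<^esub> FArr F f = FArr F' f \<cdot>\<^bsub>X\<^esub> \<tau> x"
      by (rule a.transpose_unique[rotated 3, of _ _ _ "FObj F' y"]) (simp_all add: Hom_def)
  qed
  moreover have "iso X (\<tau> x)" if x [simp]: "x \<in> Obj A" for x
  proof -
    obtain \<sigma> where \<sigma>: "\<sigma> \<in> Hom X (FObj F' x) (FObj F x)" "FArr G \<sigma> \<cdot>\<^bsub>A\<^esub> \<eta>' x = \<eta> x"
      using a'.universal_unit[of x "FObj F x" "\<eta> x"] a.unit.component[of x] by auto
    note [simp] = F.B.HomD[OF \<sigma>(1)]
    have "FArr G \<sigma> \<cdot>\<^bsub>A\<^esub> (FArr G (\<tau> x) \<cdot>\<^bsub>A\<^esub> \<eta> x) = \<eta> x" "FArr G (\<tau> x) \<cdot>\<^bsub>A\<^esub> (FArr G \<sigma> \<cdot>\<^bsub>A\<^esub> \<eta>' x) = \<eta>' x"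
      by (simp_all add: \<sigma>(2) \<tau>(2))
    then have 1: "FArr G (\<sigma> \<cdot>\<^bsub>X\<^esub> \<tau> x) \<cdot>\<^bsub>A\<^esub> \<eta> x = FArr G (Idn X (FObj F x)) \<cdot>\<^bsub>A\<^esub> \<eta> x"
      and 2: "FArr G (\<tau> x \<cdot>\<^bsub>X\<^esub> \<sigma>) \<cdot>\<^bsub>A\<^esub> \<eta>' x = FArr G (Idn X (FObj F' x)) \<cdot>\<^bsub>A\<^esub> \<eta>' x"
      by simp_all
    have "\<sigma> \<cdot>\<^bsub>X\<^esub> \<tau> x = Idn X (FObj F x)"
      by (rule a.transpose_unique[OF x _ _ 1]) (simp_all add: Hom_def)
    moreover have "\<tau> x \<cdot>\<^bsub>X\<^esub> \<sigma> = Idn X (FObj F' x)"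
      by (rule a'.transpose_unique[OF x _ _ 2]) (simp_all add: Hom_def)
    ultimately show ?thesis
      using \<tau>(1)[OF x] \<sigma>(1) by (intro F.B.isoI)
  qed
  ultimately show ?thesis
    unfolding naturally_isomorphic_def by blast
qed

lemma comma_simps:
  "Obj (comma A B K b) = {(x, k). x \<in> Obj A \<and> k \<in> Hom B (FObj K x) b}"
  "Dom (comma A B K b) (s, t, u) = s" "Cod (comma A B K b) (s, t, u) = t"
  "Idn (comma A B K b) s = (s, s, Idn A (fst s))"
  "Comp (comma A B K b) (s', t', u') (s, t, u) = (s, t', u' \<cdot>\<^bsub>A\<^esub> u)"
  by (auto simp: comma_def split: prod.splits)

lemma comma_hom:
  "w \<in> Hom (comma A B K b) s t \<longleftrightarrow> (\<exists>x k y l u. s = (x, k) \<and> t = (y, l) \<and> w = (s, t, u) \<and>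
     x \<in> Obj A \<and> k \<in> Hom B (FObj K x) b \<and> y \<in> Obj A \<and> l \<in> Hom B (FObj K y) b \<and>
     u \<in> Hom A x y \<and> l \<cdot>\<^bsub>B\<^esub> FArr K u = k)"
  by (auto simp: comma_def Hom_def)

context cat_functor
begin

lemma category_comma: "category (comma A B F b)"
proof (rule category.intro)
  fix x assume "x \<in> Obj (comma A B F b)"
  then show "Idn (comma A B F b) x \<in> Hom (comma A B F b) x x"
    by (cases x) (auto simp: comma_hom comma_simps A.idn_hom B.comp_idn)
next
  fix f g x y z
  assume "f \<in> Hom (comma A B F b) x y" "g \<in> Hom (comma A B F b) y z"
  then obtain x' k y' l z' m u v where f: "x = (x', k)" "y = (y', l)" "f = (x, y, u)" "u \<in> Hom A x' y'"
    "x' \<in> Obj A" "k \<in> Hom B (FObj F x') b" "y' \<in> Obj A" "l \<in> Hom B (FObj F y') b" "l \<cdot>\<^bsub>B\<^esub> FArr F u = k"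
    and g: "z = (z', m)" "g = (y, z, v)" "v \<in> Hom A y' z'" "z' \<in> Obj A" "m \<in> Hom B (FObj F z') b" "m \<cdot>\<^bsub>B\<^esub> FArr F v = l"
    unfolding comma_hom by blast
  note [simp] = A.HomD(1-3)[OF f(4)] A.HomD(1-3)[OF g(3)] B.HomD(1-3)[OF g(5)]
  have "m \<cdot>\<^bsub>B\<^esub> (FArr F v \<cdot>\<^bsub>B\<^esub> FArr F u) = l \<cdot>\<^bsub>B\<^esub> FArr F u"
    by (rule B.comp_eq_extend[OF g(6)]) simp_all
  then have "m \<cdot>\<^bsub>B\<^esub> FArr F (v \<cdot>\<^bsub>A\<^esub> u) = k"
    using f(9) by simp
  then show "g \<cdot>\<^bsub>comma A B F b\<^esub> f \<in> Hom (comma A B F b) x z"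
    using f(1-8) g(1-5) A.comp_hom[OF f(4) g(3)] by (simp add: comma_hom comma_simps)
next
  fix f x y assume "f \<in> Hom (comma A B F b) x y"
  then show "f \<cdot>\<^bsub>comma A B F b\<^esub> Idn (comma A B F b) x = f"
    and "Idn (comma A B F b) y \<cdot>\<^bsub>comma A B F b\<^esub> f = f"
    unfolding comma_hom by (auto simp: comma_simps A.comp_idn A.idn_comp)
next
  fix f g h w x y z assume "f \<in> Hom (comma A B F b) w x" "g \<in> Hom (comma A B F b) x y" "h \<in> Hom (comma A B F b) y z"
  then show "(h \<cdot>\<^bsub>comma A B F b\<^esub> g) \<cdot>\<^bsub>comma A B F b\<^esub> f = h \<cdot>\<^bsub>comma A B F b\<^esub> g \<cdot>\<^bsub>comma A B F b\<^esub> f"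
    unfolding comma_hom by (auto simp: comma_simps intro: A.comp_assoc)
qed (auto simp: comma_def)

lemma comma_proj_functor: "cat_functor (comma A B F b) A comma_proj"
  by (intro cat_functor.intro category_comma A.category_axioms cat_functor_axioms.intro)
    (auto simp: comma_hom comma_simps comma_proj_def)

end

lemma is_cocone_comma:
  "is_cocone (comma A B K b) D (F \<circ>\<^sub>F comma_proj) c \<sigma> \<longleftrightarrow> c \<in> Obj D \<and>
    (\<forall>x \<in> Obj A. \<forall>k \<in> Hom B (FObj K x) b. \<sigma> (x, k) \<in> Hom D (FObj F x) c) \<and>
    (\<forall>x \<in> Obj A. \<forall>y \<in> Obj A. \<forall>u \<in> Hom A x y. \<forall>l \<in> Hom B (FObj K y) b.
       l \<cdot>\<^bsub>B\<^esub> FArr K u \<in> Hom B (FObj K x) b \<longrightarrow> \<sigma> (y, l) \<cdot>\<^bsub>D\<^esub> FArr F u = \<sigma> (x, l \<cdot>\<^bsub>B\<^esub> FArr K u))"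
  by (auto simp: is_cocone_def comma_hom comma_simps comma_proj_def Ball_def)

lemma ball_comma:
  "(\<forall>j \<in> Obj (comma A B K b). P j) \<longleftrightarrow> (\<forall>x \<in> Obj A. \<forall>k \<in> Hom B (FObj K x) b. P (x, k))"
  by (auto simp: comma_simps)

lemma colimit_comma_universal:
  assumes "is_colimit (comma A B K b) D \<Delta> c \<sigma>" "is_cocone (comma A B K b) D \<Delta> z \<rho>"
  shows "\<exists>!w. w \<in> Hom D c z \<and> (\<forall>x \<in> Obj A. \<forall>k \<in> Hom B (FObj K x) b. w \<cdot>\<^bsub>D\<^esub> \<sigma> (x, k) = \<rho> (x, k))"
  using assms unfolding is_colimit_def ball_comma by (elim conjE allE[of _ z] allE[of _ \<rho>]) (erule mp)

text \<open>
  A transformation \<open>\<gamma>\<close> from \<open>F\<close> to \<open>G K\<close> gives at each \<open>b\<close> a cocone with vertex \<open>G b\<close>, and \<open>\<beta> b\<close> is the arrow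
  induced on the colimit. The cocones are treated with an extra arrow \<open>m\<close> out of \<open>b\<close>, so that naturality of
  \<open>\<beta>\<close> follows from uniqueness for the cocone with vertex at the codomain of \<open>m\<close>.
\<close>

lemma pointwise_left_kan_extensionI:
  assumes K: "cat_functor A B K" and L: "cat_functor B D L" and \<alpha>: "nat_trans A D F (L \<circ>\<^sub>F K) \<alpha>"
    and colim: "\<And>b. b \<in> Obj B \<Longrightarrow> is_colimit (comma A B K b) D (F \<circ>\<^sub>F comma_proj) (FObj L b)
        (\<lambda>(x, k). FArr L k \<cdot>\<^bsub>D\<^esub> \<alpha> x)"
  shows "is_pointwise_left_kan_extension A B D K F L \<alpha>"
proof -
  interpret K: cat_functor A B K by fact
  interpret L: cat_functor B D L by fact
  interpret \<alpha>: nat_trans A D F "L \<circ>\<^sub>F K" \<alpha> by fact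
  have "\<exists>\<beta>. nat_trans B D L G \<beta> \<and> (\<forall>x \<in> Obj A. \<beta> (FObj K x) \<cdot>\<^bsub>D\<^esub> \<alpha> x = \<gamma> x) \<and>
         (\<forall>\<beta>'. nat_trans B D L G \<beta>' \<and> (\<forall>x \<in> Obj A. \<beta>' (FObj K x) \<cdot>\<^bsub>D\<^esub> \<alpha> x = \<gamma> x) \<longrightarrow>
            (\<forall>y \<in> Obj B. \<beta>' y = \<beta> y))"
    if G: "cat_functor B D G" and \<gamma>: "nat_trans A D F (G \<circ>\<^sub>F K) \<gamma>" for G \<gamma>
  proof -
    interpret G: cat_functor B D G by fact
    interpret \<gamma>: nat_trans A D F "G \<circ>\<^sub>F K" \<gamma> by fact
    have cone: "is_cocone (comma A B K b) D (F \<circ>\<^sub>F comma_proj) (FObj G b') (\<lambda>(x, k). FArr G (m \<cdot>\<^bsub>B\<^esub> k) \<cdot>\<^bsub>D\<^esub> \<gamma> x)"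
      if m: "m \<in> Hom B b b'" for b b' m
      unfolding is_cocone_comma
    proof (intro conjI ballI impI)
      note [simp] = K.B.HomD[OF m]
      show "FObj G b' \<in> Obj D" by simp
      show "(case (x, k) of (x, k) \<Rightarrow> FArr G (m \<cdot>\<^bsub>B\<^esub> k) \<cdot>\<^bsub>D\<^esub> \<gamma> x) \<in> Hom D (FObj F x) (FObj G b')"
        if "x \<in> Obj A" "k \<in> Hom B (FObj K x) b" for x k
        using that K.B.HomD[OF that(2)] by (simp add: Hom_def)
      fix x y u l assume h: "x \<in> Obj A" "y \<in> Obj A" "u \<in> Hom A x y" "l \<in> Hom B (FObj K y) b"
      note [simp] = h(1,2) K.A.HomD[OF h(3)] K.B.HomD[OF h(4)]
      show "(case (y, l) of (x, k) \<Rightarrow> FArr G (m \<cdot>\<^bsub>B\<^esub> k) \<cdot>\<^bsub>D\<^esub> \<gamma> x) \<cdot>\<^bsub>D\<^esub> FArr F u =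
        (case (x, l \<cdot>\<^bsub>B\<^esub> FArr K u) of (x, k) \<Rightarrow> FArr G (m \<cdot>\<^bsub>B\<^esub> k) \<cdot>\<^bsub>D\<^esub> \<gamma> x)"
        using \<gamma>.naturality_arr[of u] by simp
    qed
    have ex1: "\<exists>!w. w \<in> Hom D (FObj L b) (FObj G b') \<and>
        (\<forall>x \<in> Obj A. \<forall>k \<in> Hom B (FObj K x) b. w \<cdot>\<^bsub>D\<^esub> (FArr L k \<cdot>\<^bsub>D\<^esub> \<alpha> x) = FArr G (m \<cdot>\<^bsub>B\<^esub> k) \<cdot>\<^bsub>D\<^esub> \<gamma> x)"
      if m: "m \<in> Hom B b b'" for b b' m
      using colimit_comma_universal[OF colim[OF K.B.HomD(4)[OF m]] cone[OF m]] by simp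
    define \<beta> where "\<beta> b = (THE w. w \<in> Hom D (FObj L b) (FObj G b) \<and>
        (\<forall>x \<in> Obj A. \<forall>k \<in> Hom B (FObj K x) b. w \<cdot>\<^bsub>D\<^esub> (FArr L k \<cdot>\<^bsub>D\<^esub> \<alpha> x) = FArr G (Idn B b \<cdot>\<^bsub>B\<^esub> k) \<cdot>\<^bsub>D\<^esub> \<gamma> x))" for b
    have \<beta>: "\<beta> b \<in> Hom D (FObj L b) (FObj G b)"
      "\<And>x k. \<lbrakk>x \<in> Obj A; k \<in> Hom B (FObj K x) b\<rbrakk> \<Longrightarrow> \<beta> b \<cdot>\<^bsub>D\<^esub> (FArr L k \<cdot>\<^bsub>D\<^esub> \<alpha> x) = FArr G k \<cdot>\<^bsub>D\<^esub> \<gamma> x"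
      if "b \<in> Obj B" for b
      using theI'[OF ex1[OF K.B.idn_hom[OF that]], folded \<beta>_def] by (auto simp: K.B.idn_comp)
    have eq: "v = w" if m: "m \<in> Hom B b b'" and v: "v \<in> Hom D (FObj L b) (FObj G b')" and w: "w \<in> Hom D (FObj L b) (FObj G b')"
      and "\<And>x k. \<lbrakk>x \<in> Obj A; k \<in> Hom B (FObj K x) b\<rbrakk> \<Longrightarrow> v \<cdot>\<^bsub>D\<^esub> (FArr L k \<cdot>\<^bsub>D\<^esub> \<alpha> x) = FArr G (m \<cdot>\<^bsub>B\<^esub> k) \<cdot>\<^bsub>D\<^esub> \<gamma> x"
      and "\<And>x k. \<lbrakk>x \<in> Obj A; k \<in> Hom B (FObj K x) b\<rbrakk> \<Longrightarrow> w \<cdot>\<^bsub>D\<^esub> (FArr L k \<cdot>\<^bsub>D\<^esub> \<alpha> x) = FArr G (m \<cdot>\<^bsub>B\<^esub> k) \<cdot>\<^bsub>D\<^esub> \<gamma> x"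
      for b b' m v w
      using ex1_implies_eq[OF ex1[OF m], of v w] that by blast
    have "nat_trans B D L G \<beta>"
    proof (intro nat_trans.intro nat_trans_axioms.intro L G \<beta>(1))
      fix m b b' assume m: "m \<in> Hom B b b'"
      note mt [simp] = K.B.HomD[OF m]
      note [simp] = L.B.HomD[OF \<beta>(1)[OF mt(4)]] L.B.HomD[OF \<beta>(1)[OF mt(5)]]
      show "\<beta> b' \<cdot>\<^bsub>D\<^esub> FArr L m = FArr G m \<cdot>\<^bsub>D\<^esub> \<beta> b"
      proof (rule eq[OF m])
        fix x k assume x [simp]: "x \<in> Obj A" and k: "k \<in> Hom B (FObj K x) b"
        note [simp] = K.B.HomD[OF k]
        have "\<beta> b' \<cdot>\<^bsub>D\<^esub> (FArr L (m \<cdot>\<^bsub>B\<^esub> k) \<cdot>\<^bsub>D\<^esub> \<alpha> x) = FArr G (m \<cdot>\<^bsub>B\<^esub> k) \<cdot>\<^bsub>D\<^esub> \<gamma> x"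
          by (rule \<beta>(2)) (simp_all add: Hom_def)
        then show "(\<beta> b' \<cdot>\<^bsub>D\<^esub> FArr L m) \<cdot>\<^bsub>D\<^esub> (FArr L k \<cdot>\<^bsub>D\<^esub> \<alpha> x) = FArr G (m \<cdot>\<^bsub>B\<^esub> k) \<cdot>\<^bsub>D\<^esub> \<gamma> x"
          by simp
        show "(FArr G m \<cdot>\<^bsub>D\<^esub> \<beta> b) \<cdot>\<^bsub>D\<^esub> (FArr L k \<cdot>\<^bsub>D\<^esub> \<alpha> x) = FArr G (m \<cdot>\<^bsub>B\<^esub> k) \<cdot>\<^bsub>D\<^esub> \<gamma> x"
          using \<beta>(2)[OF mt(4) x k] by simp
      qed (simp_all add: Hom_def)
    qed
    moreover have "\<beta> (FObj K x) \<cdot>\<^bsub>D\<^esub> \<alpha> x = \<gamma> x" if "x \<in> Obj A" for x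
      using \<beta>(2)[of "FObj K x" x "Idn B (FObj K x)"] that by (simp add: K.B.idn_hom)
    moreover have "\<beta>' b = \<beta> b" if \<beta>': "nat_trans B D L G \<beta>'" and "\<forall>x \<in> Obj A. \<beta>' (FObj K x) \<cdot>\<^bsub>D\<^esub> \<alpha> x = \<gamma> x"
      and b [simp]: "b \<in> Obj B" for \<beta>' b
    proof -
      interpret \<beta>': nat_trans B D L G \<beta>' by fact
      show ?thesis
      proof (rule eq[OF K.B.idn_hom[OF b]])
        fix x k assume x [simp]: "x \<in> Obj A" and k: "k \<in> Hom B (FObj K x) b"
        note [simp] = K.B.HomD[OF k]
        have "\<beta>' b \<cdot>\<^bsub>D\<^esub> (FArr L k \<cdot>\<^bsub>D\<^esub> \<alpha> x) = FArr G k \<cdot>\<^bsub>D\<^esub> (\<beta>' (FObj K x) \<cdot>\<^bsub>D\<^esub> \<alpha> x)"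
          using \<beta>'.naturality_arr[of k] by (intro L.B.square_extend) simp_all
        then show "\<beta>' b \<cdot>\<^bsub>D\<^esub> (FArr L k \<cdot>\<^bsub>D\<^esub> \<alpha> x) = FArr G (Idn B b \<cdot>\<^bsub>B\<^esub> k) \<cdot>\<^bsub>D\<^esub> \<gamma> x"
          using that(2) by simp
        show "\<beta> b \<cdot>\<^bsub>D\<^esub> (FArr L k \<cdot>\<^bsub>D\<^esub> \<alpha> x) = FArr G (Idn B b \<cdot>\<^bsub>B\<^esub> k) \<cdot>\<^bsub>D\<^esub> \<gamma> x"
          using \<beta>(2)[OF b x k] by simp
      qed (use \<beta>'.component \<beta>(1) in simp_all)
    qed
    ultimately show ?thesis by blast
  qed
  then show ?thesis
    unfolding is_pointwise_left_kan_extension_def is_left_kan_extension_def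
    using K L \<alpha> colim by blast
qed

section \<open>Reflections computed from a dense subcategory\<close>

text \<open>
  The abstract situation: \<open>SE\<close> is dense in \<open>EE\<close> as far as arrows into objects of \<open>NN\<close> are concerned, and
  \<open>T1\<close> sends objects of \<open>SE\<close> to objects of \<open>NN\<close> with unit \<open>e\<close> universal for arrows into \<open>NN\<close>. It
  will be used for split epic, all, normal and split epic trivial extensions.
\<close>

locale densely_reflective = M: category M
  for M :: "('o, 'a) cat" +
  fixes SE EE NN TT :: "'o set" and T1 :: "('o, 'a, 'o, 'a) func" and e :: "'o \<Rightarrow> 'a"
  assumes subsets: "SE \<subseteq> EE" "TT \<subseteq> NN" "NN \<subseteq> EE" "EE \<subseteq> Obj M"
    and T1: "cat_functor (full_subcat M SE) (full_subcat M TT) T1"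
    and e_hom: "s \<in> SE \<Longrightarrow> e s \<in> Hom M s (FObj T1 s)"
    and e_natural: "\<lbrakk>s \<in> SE; s' \<in> SE; u \<in> Hom M s s'\<rbrakk> \<Longrightarrow> e s' \<cdot>\<^bsub>M\<^esub> u = FArr T1 u \<cdot>\<^bsub>M\<^esub> e s"
    and e_universal: "\<lbrakk>s \<in> SE; g \<in> NN; h \<in> Hom M s g\<rbrakk> \<Longrightarrow> \<exists>!k. k \<in> Hom M (FObj T1 s) g \<and> k \<cdot>\<^bsub>M\<^esub> e s = h"
    and dense: "\<lbrakk>f \<in> EE; g \<in> NN; \<And>s k. \<lbrakk>s \<in> SE; k \<in> Hom M s f\<rbrakk> \<Longrightarrow> \<rho> s k \<in> Hom M s g;
        \<And>s s' u k. \<lbrakk>s \<in> SE; s' \<in> SE; u \<in> Hom M s s'; k \<in> Hom M s' f\<rbrakk> \<Longrightarrow> \<rho> s' k \<cdot>\<^bsub>M\<^esub> u = \<rho> s (k \<cdot>\<^bsub>M\<^esub> u)\<rbrakk>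
      \<Longrightarrow> \<exists>!w. w \<in> Hom M f g \<and> (\<forall>s \<in> SE. \<forall>k \<in> Hom M s f. w \<cdot>\<^bsub>M\<^esub> k = \<rho> s k)"
begin

abbreviation "SEc \<equiv> full_subcat M SE"
abbreviation "EEc \<equiv> full_subcat M EE"
abbreviation "NNc \<equiv> full_subcat M NN"
abbreviation "TTc \<equiv> full_subcat M TT"

lemma inclusions:
  "cat_functor SEc EEc id_func" "cat_functor NNc EEc id_func" "cat_functor TTc NNc id_func"
  using subsets by (auto intro!: cat_functor_full_inclusion M.category_axioms)

lemma T1_NN: "cat_functor SEc NNc (id_func \<circ>\<^sub>F T1)"
  by (rule cat_functor_comp[OF T1 inclusions(3)])

lemma T1_obj: "s \<in> SE \<Longrightarrow> FObj T1 s \<in> NN" "s \<in> SE \<Longrightarrow> FObj T1 s \<in> TT"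
  using cat_functor.obj[OF T1] subsets by auto

lemma T1_hom: "\<lbrakk>u \<in> Hom M s s'; s \<in> SE; s' \<in> SE\<rbrakk> \<Longrightarrow> FArr T1 u \<in> Hom M (FObj T1 s) (FObj T1 s')"
  using cat_functor.hom[OF T1, of u s s'] by (auto simp: Hom_full_subcat split: if_splits)

lemma e_cancel:
  assumes "s \<in> SE" "g \<in> NN" "k \<in> Hom M (FObj T1 s) g" "k' \<in> Hom M (FObj T1 s) g" "k \<cdot>\<^bsub>M\<^esub> e s = k' \<cdot>\<^bsub>M\<^esub> e s"
  shows "k = k'"
  by (rule ex1_implies_eq[OF e_universal[OF assms(1,2)]])
    (use assms M.comp_hom[OF e_hom[OF assms(1)] assms(4)] in auto)

lemma dense_cancel:
  assumes f: "f \<in> EE" and g: "g \<in> NN" and w: "w \<in> Hom M f g" "w' \<in> Hom M f g"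
    and eq: "\<And>s k. \<lbrakk>s \<in> SE; k \<in> Hom M s f\<rbrakk> \<Longrightarrow> w \<cdot>\<^bsub>M\<^esub> k = w' \<cdot>\<^bsub>M\<^esub> k"
  shows "w = w'"
proof (rule ex1_implies_eq[OF dense[OF f g, of "\<lambda>s k. w' \<cdot>\<^bsub>M\<^esub> k"]])
  show "w' \<cdot>\<^bsub>M\<^esub> k \<in> Hom M s g" if "k \<in> Hom M s f" for s k
    using M.comp_hom[OF that w(2)] .
  show "(w' \<cdot>\<^bsub>M\<^esub> k) \<cdot>\<^bsub>M\<^esub> u = w' \<cdot>\<^bsub>M\<^esub> (k \<cdot>\<^bsub>M\<^esub> u)" if "u \<in> Hom M s s'" "k \<in> Hom M s' f" for s s' u k
    using M.comp_assoc[OF that w(2)] .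
qed (use w eq in auto)

lemma is_cocone_T1:
  "f \<in> EE \<Longrightarrow> is_cocone (comma SEc EEc id_func f) NNc ((id_func \<circ>\<^sub>F T1) \<circ>\<^sub>F comma_proj) c \<sigma> \<longleftrightarrow> c \<in> NN \<and>
    (\<forall>s \<in> SE. \<forall>k \<in> Hom M s f. \<sigma> (s, k) \<in> Hom M (FObj T1 s) c) \<and>
    (\<forall>s \<in> SE. \<forall>s' \<in> SE. \<forall>u \<in> Hom M s s'. \<forall>k \<in> Hom M s' f. \<sigma> (s', k) \<cdot>\<^bsub>M\<^esub> FArr T1 u = \<sigma> (s, k \<cdot>\<^bsub>M\<^esub> u))"
  using subsets T1_obj M.comp_hom unfolding is_cocone_comma by (auto simp: Hom_full_subcat subset_iff)

lemma comma_T1_functor: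
  "cat_functor (comma SEc EEc id_func f) NNc ((id_func \<circ>\<^sub>F T1) \<circ>\<^sub>F comma_proj)"
  by (rule cat_functor_comp[OF cat_functor.comma_proj_functor[OF inclusions(1)] T1_NN])

text \<open>
  Arrows out of the reflection of \<open>f\<close> are arrows out of \<open>f\<close>, hence by density cocones over \<open>SE\<close> above \<open>f\<close>,
  hence by the universal property of \<open>e\<close> cocones over their images under \<open>T1\<close>. So the reflection is the
  required colimit, with coprojections \<open>I1 k \<cdot> \<alpha> s\<close>, where \<open>\<alpha> s\<close> is the factorization of the unit at \<open>s\<close>
  through \<open>e s\<close>.
\<close>

lemma pointwise_kan_if_left_adjoint:
  assumes "left_adjoint EEc NNc I1 id_func"
  shows "\<exists>\<alpha>. is_pointwise_left_kan_extension SEc EEc NNc id_func (id_func \<circ>\<^sub>F T1) I1 \<alpha>"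
proof -
  obtain u \<epsilon> where adj: "adjunction EEc NNc I1 id_func u \<epsilon>"
    using assms unfolding left_adjoint_def by blast
  interpret adj: adjunction EEc NNc I1 id_func u \<epsilon> by fact
  interpret K: cat_functor SEc EEc id_func by (rule inclusions)
  have I1_obj: "FObj I1 f \<in> NN" if "f \<in> EE" for f
    using adj.left.obj[of f] that by simp
  have I1_hom: "FArr I1 k \<in> Hom M (FObj I1 f) (FObj I1 f')" if "k \<in> Hom M f f'" "f \<in> EE" "f' \<in> EE" for k f f'
    using adj.left.hom[of k f f'] that by (auto simp: Hom_full_subcat split: if_splits)
  have I1_comp: "FArr I1 (k' \<cdot>\<^bsub>M\<^esub> k) = FArr I1 k' \<cdot>\<^bsub>M\<^esub> FArr I1 k"
    if "k \<in> Hom M f f'" "k' \<in> Hom M f' f''" "f \<in> EE" "f' \<in> EE" "f'' \<in> EE" for k k' f f' f''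
    using adj.left.comp[of k f f' k' f''] that by (simp add: Hom_full_subcat)
  have u_hom: "u f \<in> Hom M f (FObj I1 f)" if "f \<in> EE" for f
    using adj.unit.component[of f] that by (auto simp: Hom_full_subcat split: if_splits)
  have u_nat: "u f' \<cdot>\<^bsub>M\<^esub> k = FArr I1 k \<cdot>\<^bsub>M\<^esub> u f" if "k \<in> Hom M f f'" "f \<in> EE" "f' \<in> EE" for k f f'
    using adj.unit.naturality[of k f f'] that by (simp add: Hom_full_subcat)
  have u_univ: "\<exists>!w. w \<in> Hom M (FObj I1 f) g \<and> w \<cdot>\<^bsub>M\<^esub> u f = h" if "f \<in> EE" "g \<in> NN" "h \<in> Hom M f g" for f g h
    using adj.universal_unit[of f g h] that subsets I1_obj[OF that(1)] by (simp add: Hom_full_subcat subset_iff)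
  have sub: "s \<in> EE" if "s \<in> SE" for s using that subsets by blast
  define \<alpha> where "\<alpha> s = (THE k. k \<in> Hom M (FObj T1 s) (FObj I1 s) \<and> k \<cdot>\<^bsub>M\<^esub> e s = u s)" for s
  have \<alpha>: "\<alpha> s \<in> Hom M (FObj T1 s) (FObj I1 s)" "\<alpha> s \<cdot>\<^bsub>M\<^esub> e s = u s" if "s \<in> SE" for s
    using theI'[OF e_universal[OF that I1_obj[OF sub[OF that]] u_hom[OF sub[OF that]]]] unfolding \<alpha>_def by auto
  have \<alpha>_nat: "\<alpha> s' \<cdot>\<^bsub>M\<^esub> FArr T1 k = FArr I1 k \<cdot>\<^bsub>M\<^esub> \<alpha> s" if s: "s \<in> SE" "s' \<in> SE" and k: "k \<in> Hom M s s'" for s s' k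
  proof (rule e_cancel[OF s(1) I1_obj[OF sub[OF s(2)]]])
    note h = e_hom[OF s(1)] e_hom[OF s(2)] T1_hom[OF k s] \<alpha>(1)[OF s(1)] \<alpha>(1)[OF s(2)] I1_hom[OF k sub[OF s(1)] sub[OF s(2)]]
    show "\<alpha> s' \<cdot>\<^bsub>M\<^esub> FArr T1 k \<in> Hom M (FObj T1 s) (FObj I1 s')" "FArr I1 k \<cdot>\<^bsub>M\<^esub> \<alpha> s \<in> Hom M (FObj T1 s) (FObj I1 s')"
      using M.comp_hom[OF h(3,5)] M.comp_hom[OF h(4,6)] by auto
    have "(\<alpha> s' \<cdot>\<^bsub>M\<^esub> FArr T1 k) \<cdot>\<^bsub>M\<^esub> e s = \<alpha> s' \<cdot>\<^bsub>M\<^esub> (e s' \<cdot>\<^bsub>M\<^esub> k)"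
      unfolding M.comp_assoc[OF h(1,3,5)] e_natural[OF s k] ..
    also have "\<dots> = u s' \<cdot>\<^bsub>M\<^esub> k"
      unfolding M.comp_assoc[OF k h(2,5), symmetric] \<alpha>(2)[OF s(2)] ..
    also have "\<dots> = FArr I1 k \<cdot>\<^bsub>M\<^esub> (\<alpha> s \<cdot>\<^bsub>M\<^esub> e s)"
      using u_nat[OF k] s sub \<alpha>(2)[OF s(1)] by simp
    also have "\<dots> = (FArr I1 k \<cdot>\<^bsub>M\<^esub> \<alpha> s) \<cdot>\<^bsub>M\<^esub> e s"
      unfolding M.comp_assoc[OF h(1,4,6)] ..
    finally show "(\<alpha> s' \<cdot>\<^bsub>M\<^esub> FArr T1 k) \<cdot>\<^bsub>M\<^esub> e s = (FArr I1 k \<cdot>\<^bsub>M\<^esub> \<alpha> s) \<cdot>\<^bsub>M\<^esub> e s" .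
  qed
  have \<alpha>_trans: "nat_trans SEc NNc (id_func \<circ>\<^sub>F T1) (I1 \<circ>\<^sub>F id_func) \<alpha>"
    using \<alpha> \<alpha>_nat T1_obj I1_obj sub
    by (intro nat_trans.intro nat_trans_axioms.intro T1_NN cat_functor_comp[OF inclusions(1) adj.left.cat_functor_axioms])
      (auto simp: Hom_full_subcat split: if_splits)
  have "is_colimit (comma SEc EEc id_func f) NNc ((id_func \<circ>\<^sub>F T1) \<circ>\<^sub>F comma_proj) (FObj I1 f)
      (\<lambda>(x, k). FArr I1 k \<cdot>\<^bsub>NNc\<^esub> \<alpha> x)" if f: "f \<in> EE" for f
    unfolding is_colimit_def
  proof (intro conjI allI impI comma_T1_functor)
    show "is_cocone (comma SEc EEc id_func f) NNc ((id_func \<circ>\<^sub>F T1) \<circ>\<^sub>F comma_proj) (FObj I1 f)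
      (\<lambda>(x, k). FArr I1 k \<cdot>\<^bsub>NNc\<^esub> \<alpha> x)"
      unfolding is_cocone_T1[OF f]
    proof (intro conjI ballI; clarsimp?)
      fix s k assume s: "s \<in> SE" and k: "k \<in> Hom M s f"
      show "FArr I1 k \<cdot>\<^bsub>M\<^esub> \<alpha> s \<in> Hom M (FObj T1 s) (FObj I1 f)"
        using M.comp_hom[OF \<alpha>(1)[OF s] I1_hom[OF k sub[OF s] f]] .
    next
      fix s s' v k assume s: "s \<in> SE" "s' \<in> SE" and v: "v \<in> Hom M s s'" and k: "k \<in> Hom M s' f"
      note h = T1_hom[OF v s] \<alpha>(1)[OF s(1)] \<alpha>(1)[OF s(2)] I1_hom[OF v sub[OF s(1)] sub[OF s(2)]] I1_hom[OF k sub[OF s(2)] f]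
      show "(FArr I1 k \<cdot>\<^bsub>M\<^esub> \<alpha> s') \<cdot>\<^bsub>M\<^esub> FArr T1 v = FArr I1 (k \<cdot>\<^bsub>M\<^esub> v) \<cdot>\<^bsub>M\<^esub> \<alpha> s"
        unfolding M.comp_assoc[OF h(1,3,5)] \<alpha>_nat[OF s v] I1_comp[OF v k sub[OF s(1)] sub[OF s(2)] f] M.comp_assoc[OF h(2,4,5)] ..
    qed (use I1_obj f in auto)
  next
    fix g \<rho> assume \<rho>: "is_cocone (comma SEc EEc id_func f) NNc ((id_func \<circ>\<^sub>F T1) \<circ>\<^sub>F comma_proj) g \<rho>"
    then have g: "g \<in> NN" and \<rho>_hom: "\<And>s k. \<lbrakk>s \<in> SE; k \<in> Hom M s f\<rbrakk> \<Longrightarrow> \<rho> (s, k) \<in> Hom M (FObj T1 s) g"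
      and \<rho>_nat: "\<And>s s' u k. \<lbrakk>s \<in> SE; s' \<in> SE; u \<in> Hom M s s'; k \<in> Hom M s' f\<rbrakk> \<Longrightarrow> \<rho> (s', k) \<cdot>\<^bsub>M\<^esub> FArr T1 u = \<rho> (s, k \<cdot>\<^bsub>M\<^esub> u)"
      unfolding is_cocone_T1[OF f] by blast+
    have ex1: "\<exists>!h. h \<in> Hom M f g \<and> (\<forall>s \<in> SE. \<forall>k \<in> Hom M s f. h \<cdot>\<^bsub>M\<^esub> k = \<rho> (s, k) \<cdot>\<^bsub>M\<^esub> e s)"
    proof (rule dense[OF f g])
      show "\<rho> (s, k) \<cdot>\<^bsub>M\<^esub> e s \<in> Hom M s g" if "s \<in> SE" "k \<in> Hom M s f" for s k
        using M.comp_hom[OF e_hom \<rho>_hom] that by blast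
      show "(\<rho> (s', k) \<cdot>\<^bsub>M\<^esub> e s') \<cdot>\<^bsub>M\<^esub> v = \<rho> (s, k \<cdot>\<^bsub>M\<^esub> v) \<cdot>\<^bsub>M\<^esub> e s"
        if s: "s \<in> SE" "s' \<in> SE" and v: "v \<in> Hom M s s'" and k: "k \<in> Hom M s' f" for s s' v k
      proof -
        note h = e_hom[OF s(1)] e_hom[OF s(2)] T1_hom[OF v s] \<rho>_hom[OF s(2) k]
        show ?thesis
          unfolding M.comp_assoc[OF v h(2,4)] e_natural[OF s v] \<rho>_nat[OF s v k, symmetric] M.comp_assoc[OF h(1,3,4)] ..
      qed
    qed
    then obtain h where h: "h \<in> Hom M f g" "\<And>s k. \<lbrakk>s \<in> SE; k \<in> Hom M s f\<rbrakk> \<Longrightarrow> h \<cdot>\<^bsub>M\<^esub> k = \<rho> (s, k) \<cdot>\<^bsub>M\<^esub> e s"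
      by blast
    have key: "(w \<cdot>\<^bsub>M\<^esub> (FArr I1 k \<cdot>\<^bsub>M\<^esub> \<alpha> s)) \<cdot>\<^bsub>M\<^esub> e s = (w \<cdot>\<^bsub>M\<^esub> u f) \<cdot>\<^bsub>M\<^esub> k"
      "w \<cdot>\<^bsub>M\<^esub> (FArr I1 k \<cdot>\<^bsub>M\<^esub> \<alpha> s) \<in> Hom M (FObj T1 s) g"
      if w: "w \<in> Hom M (FObj I1 f) g" and s: "s \<in> SE" and k: "k \<in> Hom M s f" for w s k
    proof -
      note t = e_hom[OF s] \<alpha>(1)[OF s] I1_hom[OF k sub[OF s] f] u_hom[OF f]
      show "w \<cdot>\<^bsub>M\<^esub> (FArr I1 k \<cdot>\<^bsub>M\<^esub> \<alpha> s) \<in> Hom M (FObj T1 s) g"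
        using M.comp_hom[OF M.comp_hom[OF t(2,3)] w] .
      have "(w \<cdot>\<^bsub>M\<^esub> (FArr I1 k \<cdot>\<^bsub>M\<^esub> \<alpha> s)) \<cdot>\<^bsub>M\<^esub> e s = w \<cdot>\<^bsub>M\<^esub> (FArr I1 k \<cdot>\<^bsub>M\<^esub> (\<alpha> s \<cdot>\<^bsub>M\<^esub> e s))"
        unfolding M.comp_assoc[OF t(1) M.comp_hom[OF t(2,3)] w] M.comp_assoc[OF t(1-3)] ..
      also have "\<dots> = (w \<cdot>\<^bsub>M\<^esub> u f) \<cdot>\<^bsub>M\<^esub> k"
        unfolding \<alpha>(2)[OF s] u_nat[OF k sub[OF s] f, symmetric] M.comp_assoc[OF k t(4) w] ..
      finally show "(w \<cdot>\<^bsub>M\<^esub> (FArr I1 k \<cdot>\<^bsub>M\<^esub> \<alpha> s)) \<cdot>\<^bsub>M\<^esub> e s = (w \<cdot>\<^bsub>M\<^esub> u f) \<cdot>\<^bsub>M\<^esub> k" .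
    qed
    have iff: "(\<forall>s \<in> SE. \<forall>k \<in> Hom M s f. w \<cdot>\<^bsub>M\<^esub> (FArr I1 k \<cdot>\<^bsub>M\<^esub> \<alpha> s) = \<rho> (s, k)) \<longleftrightarrow> w \<cdot>\<^bsub>M\<^esub> u f = h"
      if w: "w \<in> Hom M (FObj I1 f) g" for w
    proof
      assume a: "\<forall>s \<in> SE. \<forall>k \<in> Hom M s f. w \<cdot>\<^bsub>M\<^esub> (FArr I1 k \<cdot>\<^bsub>M\<^esub> \<alpha> s) = \<rho> (s, k)"
      show "w \<cdot>\<^bsub>M\<^esub> u f = h"
      proof (rule dense_cancel[OF f g M.comp_hom[OF u_hom[OF f] w] h(1)])
        fix s k assume s: "s \<in> SE" "k \<in> Hom M s f"
        show "(w \<cdot>\<^bsub>M\<^esub> u f) \<cdot>\<^bsub>M\<^esub> k = h \<cdot>\<^bsub>M\<^esub> k"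
          using key(1)[OF w s] a s h(2)[OF s] by simp
      qed
    next
      assume a: "w \<cdot>\<^bsub>M\<^esub> u f = h"
      show "\<forall>s \<in> SE. \<forall>k \<in> Hom M s f. w \<cdot>\<^bsub>M\<^esub> (FArr I1 k \<cdot>\<^bsub>M\<^esub> \<alpha> s) = \<rho> (s, k)"
      proof (intro ballI)
        fix s k assume s: "s \<in> SE" "k \<in> Hom M s f"
        show "w \<cdot>\<^bsub>M\<^esub> (FArr I1 k \<cdot>\<^bsub>M\<^esub> \<alpha> s) = \<rho> (s, k)"
          by (rule e_cancel[OF s(1) g key(2)[OF w s] \<rho>_hom[OF s]]) (simp only: key(1)[OF w s] a h(2)[OF s])
      qed
    qed
    have "\<exists>!w. w \<in> Hom M (FObj I1 f) g \<and> (\<forall>s \<in> SE. \<forall>k \<in> Hom M s f. w \<cdot>\<^bsub>M\<^esub> (FArr I1 k \<cdot>\<^bsub>M\<^esub> \<alpha> s) = \<rho> (s, k))"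
      using u_univ[OF f g h(1)] iff by metis
    then show "\<exists>!w. w \<in> Hom NNc (FObj I1 f) g \<and>
        (\<forall>j \<in> Obj (comma SEc EEc id_func f). w \<cdot>\<^bsub>NNc\<^esub> (case j of (x, k) \<Rightarrow> FArr I1 k \<cdot>\<^bsub>NNc\<^esub> \<alpha> x) = \<rho> j)"
      using g I1_obj[OF f] f sub by (auto simp: Hom_full_subcat comma_simps)
  qed
  then show ?thesis
    using pointwise_left_kan_extensionI[OF inclusions(1) adj.left.cat_functor_axioms \<alpha>_trans] by auto
qed

text \<open>
  The same chain of bijections read backwards. The coprojections of the colimit, precomposed with \<open>e\<close>, form
  a cocone over \<open>SE\<close> above \<open>f\<close>, and density assembles them to an arrow \<open>u f\<close> from \<open>f\<close> to the colimit, which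
  is then universal.
\<close>

lemma left_adjoint_if_pointwise_kan:
  assumes kan: "is_pointwise_left_kan_extension SEc EEc NNc id_func (id_func \<circ>\<^sub>F T1) L \<alpha>"
  shows "left_adjoint EEc NNc L id_func"
proof -
  have L: "cat_functor EEc NNc L" and \<alpha>_trans: "nat_trans SEc NNc (id_func \<circ>\<^sub>F T1) (L \<circ>\<^sub>F id_func) \<alpha>"
    and colim: "\<And>f. f \<in> EE \<Longrightarrow> is_colimit (comma SEc EEc id_func f) NNc ((id_func \<circ>\<^sub>F T1) \<circ>\<^sub>F comma_proj) (FObj L f)
      (\<lambda>(x, k). FArr L k \<cdot>\<^bsub>NNc\<^esub> \<alpha> x)"
    using kan unfolding is_pointwise_left_kan_extension_def is_left_kan_extension_def by auto
  interpret L: cat_functor EEc NNc L by fact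
  interpret \<alpha>: nat_trans SEc NNc "id_func \<circ>\<^sub>F T1" "L \<circ>\<^sub>F id_func" \<alpha> by fact
  have sub: "s \<in> EE" if "s \<in> SE" for s using that subsets by blast
  have L_obj: "FObj L f \<in> NN" if "f \<in> EE" for f
    using L.obj[of f] that by simp
  have L_hom: "FArr L k \<in> Hom M (FObj L f) (FObj L f')" if "k \<in> Hom M f f'" "f \<in> EE" "f' \<in> EE" for k f f'
    using L.hom[of k f f'] that by (auto simp: Hom_full_subcat split: if_splits)
  have L_comp: "FArr L (k' \<cdot>\<^bsub>M\<^esub> k) = FArr L k' \<cdot>\<^bsub>M\<^esub> FArr L k"
    if "k \<in> Hom M f f'" "k' \<in> Hom M f' f''" "f \<in> EE" "f' \<in> EE" "f'' \<in> EE" for k k' f f' f''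
    using L.comp[of k f f' k' f''] that by (simp add: Hom_full_subcat)
  have \<alpha>: "\<alpha> s \<in> Hom M (FObj T1 s) (FObj L s)" if "s \<in> SE" for s
    using \<alpha>.component[of s] that by (auto simp: Hom_full_subcat split: if_splits)
  have \<alpha>_nat: "\<alpha> s' \<cdot>\<^bsub>M\<^esub> FArr T1 k = FArr L k \<cdot>\<^bsub>M\<^esub> \<alpha> s" if "s \<in> SE" "s' \<in> SE" "k \<in> Hom M s s'" for s s' k
    using \<alpha>.naturality[of k s s'] that by (simp add: Hom_full_subcat)
  define \<rho> where "\<rho> s k = FArr L k \<cdot>\<^bsub>M\<^esub> (\<alpha> s \<cdot>\<^bsub>M\<^esub> e s)" for s k
  have \<rho>: "\<rho> s k \<in> Hom M s (FObj L f)" if "s \<in> SE" "k \<in> Hom M s f" "f \<in> EE" for s k f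
    unfolding \<rho>_def using M.comp_hom[OF M.comp_hom[OF e_hom[OF that(1)] \<alpha>[OF that(1)]] L_hom[OF that(2) sub[OF that(1)] that(3)]] .
  have \<rho>_comp: "\<rho> s (m \<cdot>\<^bsub>M\<^esub> k) = FArr L m \<cdot>\<^bsub>M\<^esub> \<rho> s k"
    if s: "s \<in> SE" and k: "k \<in> Hom M s f" and m: "m \<in> Hom M f f'" and f: "f \<in> EE" "f' \<in> EE" for s k m f f'
    unfolding \<rho>_def L_comp[OF k m sub[OF s] f]
    by (rule M.comp_assoc[OF M.comp_hom[OF e_hom[OF s] \<alpha>[OF s]] L_hom[OF k sub[OF s] f(1)] L_hom[OF m f]])
  define u where "u f = (THE w. w \<in> Hom M f (FObj L f) \<and> (\<forall>s \<in> SE. \<forall>k \<in> Hom M s f. w \<cdot>\<^bsub>M\<^esub> k = \<rho> s k))" for f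
  have u: "u f \<in> Hom M f (FObj L f)" "\<And>s k. \<lbrakk>s \<in> SE; k \<in> Hom M s f\<rbrakk> \<Longrightarrow> u f \<cdot>\<^bsub>M\<^esub> k = \<rho> s k" if f: "f \<in> EE" for f
  proof -
    have "\<exists>!w. w \<in> Hom M f (FObj L f) \<and> (\<forall>s \<in> SE. \<forall>k \<in> Hom M s f. w \<cdot>\<^bsub>M\<^esub> k = \<rho> s k)"
    proof (rule dense[OF f L_obj[OF f] \<rho>[OF _ _ f]])
      fix s s' v k assume s: "s \<in> SE" "s' \<in> SE" and v: "v \<in> Hom M s s'" and k: "k \<in> Hom M s' f"
      note t = e_hom[OF s(1)] e_hom[OF s(2)] \<alpha>[OF s(1)] \<alpha>[OF s(2)] T1_hom[OF v s] L_hom[OF v sub[OF s(1)] sub[OF s(2)]]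
        L_hom[OF k sub[OF s(2)] f]
      have "\<rho> s' k \<cdot>\<^bsub>M\<^esub> v = FArr L k \<cdot>\<^bsub>M\<^esub> (\<alpha> s' \<cdot>\<^bsub>M\<^esub> (FArr T1 v \<cdot>\<^bsub>M\<^esub> e s))"
        unfolding \<rho>_def e_natural[OF s v, symmetric] M.comp_assoc[OF v M.comp_hom[OF t(2,4)] t(7)] M.comp_assoc[OF v t(2,4)] ..
      also have "\<dots> = FArr L k \<cdot>\<^bsub>M\<^esub> \<rho> s v"
        unfolding \<rho>_def M.comp_assoc[OF t(1,5,4), symmetric] \<alpha>_nat[OF s v] M.comp_assoc[OF t(1,3,6)] ..
      finally show "\<rho> s' k \<cdot>\<^bsub>M\<^esub> v = \<rho> s (k \<cdot>\<^bsub>M\<^esub> v)"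
        unfolding \<rho>_comp[OF s(1) v k sub[OF s(2)] f] .
    qed
    from theI'[OF this, folded u_def]
    show "u f \<in> Hom M f (FObj L f)" "\<And>s k. \<lbrakk>s \<in> SE; k \<in> Hom M s f\<rbrakk> \<Longrightarrow> u f \<cdot>\<^bsub>M\<^esub> k = \<rho> s k"
      by blast+
  qed
  have u_nat: "u f' \<cdot>\<^bsub>M\<^esub> m = FArr L m \<cdot>\<^bsub>M\<^esub> u f" if m: "m \<in> Hom M f f'" and f: "f \<in> EE" "f' \<in> EE" for m f f'
  proof (rule dense_cancel[OF f(1) L_obj[OF f(2)] M.comp_hom[OF m u(1)[OF f(2)]] M.comp_hom[OF u(1)[OF f(1)] L_hom[OF m f]]])
    fix s k assume s: "s \<in> SE" and k: "k \<in> Hom M s f"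
    show "(u f' \<cdot>\<^bsub>M\<^esub> m) \<cdot>\<^bsub>M\<^esub> k = (FArr L m \<cdot>\<^bsub>M\<^esub> u f) \<cdot>\<^bsub>M\<^esub> k"
      unfolding M.comp_assoc[OF k m u(1)[OF f(2)]] M.comp_assoc[OF k u(1)[OF f(1)] L_hom[OF m f]]
        u(2)[OF f(1) s k] u(2)[OF f(2) s M.comp_hom[OF k m]] \<rho>_comp[OF s k m f] ..
  qed
  have "nat_trans EEc EEc id_func (id_func \<circ>\<^sub>F L) u"
    using u(1) u_nat subsets L_obj
    by (intro nat_trans.intro nat_trans_axioms.intro L.A.cat_functor_id cat_functor_comp[OF L inclusions(2)])
      (auto simp: Hom_full_subcat subset_iff split: if_splits)
  moreover have "\<exists>!w. w \<in> Hom M (FObj L f) g \<and> w \<cdot>\<^bsub>M\<^esub> u f = h" if f: "f \<in> EE" and g: "g \<in> NN" and h: "h \<in> Hom M f g" for f g h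
  proof -
    define \<sigma> where "\<sigma> = (\<lambda>(s, k). THE l. l \<in> Hom M (FObj T1 s) g \<and> l \<cdot>\<^bsub>M\<^esub> e s = h \<cdot>\<^bsub>M\<^esub> k)"
    have \<sigma>: "\<sigma> (s, k) \<in> Hom M (FObj T1 s) g" "\<sigma> (s, k) \<cdot>\<^bsub>M\<^esub> e s = h \<cdot>\<^bsub>M\<^esub> k" if "s \<in> SE" "k \<in> Hom M s f" for s k
      using theI'[OF e_universal[OF that(1) g M.comp_hom[OF that(2) h]]] unfolding \<sigma>_def by auto
    have "is_cocone (comma SEc EEc id_func f) NNc ((id_func \<circ>\<^sub>F T1) \<circ>\<^sub>F comma_proj) g \<sigma>"
      unfolding is_cocone_T1[OF f]
    proof (intro conjI ballI g \<sigma>(1))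
      fix s s' v k assume s: "s \<in> SE" "s' \<in> SE" and v: "v \<in> Hom M s s'" and k: "k \<in> Hom M s' f"
      note t = e_hom[OF s(1)] e_hom[OF s(2)] T1_hom[OF v s] \<sigma>(1)[OF s(2) k]
      show "\<sigma> (s', k) \<cdot>\<^bsub>M\<^esub> FArr T1 v = \<sigma> (s, k \<cdot>\<^bsub>M\<^esub> v)"
      proof (rule e_cancel[OF s(1) g M.comp_hom[OF t(3,4)] \<sigma>(1)[OF s(1) M.comp_hom[OF v k]]])
        show "(\<sigma> (s', k) \<cdot>\<^bsub>M\<^esub> FArr T1 v) \<cdot>\<^bsub>M\<^esub> e s = \<sigma> (s, k \<cdot>\<^bsub>M\<^esub> v) \<cdot>\<^bsub>M\<^esub> e s"
          unfolding \<sigma>(2)[OF s(1) M.comp_hom[OF v k]] M.comp_assoc[OF t(1,3,4)] e_natural[OF s v, symmetric]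
            M.comp_assoc[OF v t(2,4), symmetric] \<sigma>(2)[OF s(2) k] M.comp_assoc[OF v k h] ..
      qed
    qed
    from colimit_comma_universal[OF colim[OF f] this]
    have ex1: "\<exists>!w. w \<in> Hom M (FObj L f) g \<and> (\<forall>s \<in> SE. \<forall>k \<in> Hom M s f. w \<cdot>\<^bsub>M\<^esub> (FArr L k \<cdot>\<^bsub>M\<^esub> \<alpha> s) = \<sigma> (s, k))"
      using g f L_obj[OF f] sub by (simp add: Hom_full_subcat)
    have key: "(w \<cdot>\<^bsub>M\<^esub> (FArr L k \<cdot>\<^bsub>M\<^esub> \<alpha> s)) \<cdot>\<^bsub>M\<^esub> e s = (w \<cdot>\<^bsub>M\<^esub> u f) \<cdot>\<^bsub>M\<^esub> k"
      "w \<cdot>\<^bsub>M\<^esub> (FArr L k \<cdot>\<^bsub>M\<^esub> \<alpha> s) \<in> Hom M (FObj T1 s) g"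
      if w: "w \<in> Hom M (FObj L f) g" and s: "s \<in> SE" and k: "k \<in> Hom M s f" for w s k
    proof -
      note t = e_hom[OF s] \<alpha>[OF s] L_hom[OF k sub[OF s] f]
      show "w \<cdot>\<^bsub>M\<^esub> (FArr L k \<cdot>\<^bsub>M\<^esub> \<alpha> s) \<in> Hom M (FObj T1 s) g"
        using M.comp_hom[OF M.comp_hom[OF t(2,3)] w] .
      show "(w \<cdot>\<^bsub>M\<^esub> (FArr L k \<cdot>\<^bsub>M\<^esub> \<alpha> s)) \<cdot>\<^bsub>M\<^esub> e s = (w \<cdot>\<^bsub>M\<^esub> u f) \<cdot>\<^bsub>M\<^esub> k"
        unfolding M.comp_assoc[OF t(1) M.comp_hom[OF t(2,3)] w] M.comp_assoc[OF t(1-3)]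
          M.comp_assoc[OF k u(1)[OF f] w] u(2)[OF f s k] \<rho>_def ..
    qed
    have iff: "(\<forall>s \<in> SE. \<forall>k \<in> Hom M s f. w \<cdot>\<^bsub>M\<^esub> (FArr L k \<cdot>\<^bsub>M\<^esub> \<alpha> s) = \<sigma> (s, k)) \<longleftrightarrow> w \<cdot>\<^bsub>M\<^esub> u f = h"
      if w: "w \<in> Hom M (FObj L f) g" for w
    proof
      assume a: "\<forall>s \<in> SE. \<forall>k \<in> Hom M s f. w \<cdot>\<^bsub>M\<^esub> (FArr L k \<cdot>\<^bsub>M\<^esub> \<alpha> s) = \<sigma> (s, k)"
      show "w \<cdot>\<^bsub>M\<^esub> u f = h"
      proof (rule dense_cancel[OF f g M.comp_hom[OF u(1)[OF f] w] h])
        fix s k assume s: "s \<in> SE" "k \<in> Hom M s f"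
        show "(w \<cdot>\<^bsub>M\<^esub> u f) \<cdot>\<^bsub>M\<^esub> k = h \<cdot>\<^bsub>M\<^esub> k"
          using key(1)[OF w s] a s \<sigma>(2)[OF s] by simp
      qed
    next
      assume a: "w \<cdot>\<^bsub>M\<^esub> u f = h"
      show "\<forall>s \<in> SE. \<forall>k \<in> Hom M s f. w \<cdot>\<^bsub>M\<^esub> (FArr L k \<cdot>\<^bsub>M\<^esub> \<alpha> s) = \<sigma> (s, k)"
      proof (intro ballI)
        fix s k assume s: "s \<in> SE" "k \<in> Hom M s f"
        show "w \<cdot>\<^bsub>M\<^esub> (FArr L k \<cdot>\<^bsub>M\<^esub> \<alpha> s) = \<sigma> (s, k)"
          by (rule e_cancel[OF s(1) g key(2)[OF w s] \<sigma>(1)[OF s]]) (simp only: key(1)[OF w s] a \<sigma>(2)[OF s])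
      qed
    qed
    show ?thesis
      using ex1 iff by metis
  qed
  ultimately show ?thesis
    using subsets L_obj
    by (intro left_adjoint_if_universal_unit[OF _ L inclusions(2)]) (simp_all add: Hom_full_subcat subset_iff)
qed

text \<open>
  The two functors agree because a pointwise Kan extension is itself left adjoint to the inclusion.
\<close>

theorem reflection_iff_pointwise_kan:
  "((\<exists>I1. left_adjoint EEc NNc I1 id_func) \<longleftrightarrow>
    (\<exists>L \<alpha>. is_pointwise_left_kan_extension SEc EEc NNc id_func (id_func \<circ>\<^sub>F T1) L \<alpha>)) \<and>
   (\<forall>I1 L \<alpha>. left_adjoint EEc NNc I1 id_func \<longrightarrow>
      is_pointwise_left_kan_extension SEc EEc NNc id_func (id_func \<circ>\<^sub>F T1) L \<alpha> \<longrightarrow>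
      naturally_isomorphic EEc NNc I1 L)"
  using pointwise_kan_if_left_adjoint left_adjoint_if_pointwise_kan left_adjoint_unique by blast

end

section \<open>Density and transfer for split epic extensions\<close>

lemma arrow_cat_simps [simp]:
  "Obj (arrow_cat C) = Arr C"
  "Dom (arrow_cat C) (f, g, h1, h0) = f"
  "Cod (arrow_cat C) (f, g, h1, h0) = g"
  "Idn (arrow_cat C) f = (f, f, Idn C (Dom C f), Idn C (Cod C f))"
  "Comp (arrow_cat C) (f', g', h1', h0') (f, g, h1, h0) = (f, g', h1' \<cdot>\<^bsub>C\<^esub> h1, h0' \<cdot>\<^bsub>C\<^esub> h0)"
  by (auto simp: arrow_cat_def)

lemma arrow_cat_hom:
  "w \<in> Hom (arrow_cat C) f g \<longleftrightarrow> (\<exists>h1 h0. w = (f, g, h1, h0) \<and> f \<in> Arr C \<and> g \<in> Arr C \<and>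
     h1 \<in> Hom C (Dom C f) (Dom C g) \<and> h0 \<in> Hom C (Cod C f) (Cod C g) \<and> g \<cdot>\<^bsub>C\<^esub> h1 = h0 \<cdot>\<^bsub>C\<^esub> f)"
  by (auto simp: arrow_cat_def Hom_def)

context extension_class
begin

text \<open>
  A generalized element \<open>a\<close> of the domain of \<open>f\<close> is an arrow \<open>pt a\<close> from an identity to \<open>f\<close>. By naturality
  the cocone is determined on all these by its value at the identity of the domain, whose upper component
  \<open>r\<close> must be the upper component of the wanted arrow. A split epic extension \<open>s\<close> over \<open>f\<close> receives an arrow
  from the identity of its domain that is \<open>s\<close> itself on the base; as \<open>s\<close> is epic, the value of the cocone
  at \<open>s\<close> is determined too. The lower component of the wanted arrow has to extend \<open>g \<cdot> r\<close> along \<open>f\<close>, so it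
  remains to see that \<open>g \<cdot> r\<close> coequalizes the pair \<open>u\<close>, \<open>v\<close> of which \<open>f\<close> is the coequalizer.
\<close>

lemma split_extensions_dense:
  assumes f: "f \<in> E" and regular: "regular_epi C f" and g: "g \<in> Arr C"
    and \<rho>: "\<And>s k. \<lbrakk>s \<in> Split C E; k \<in> Hom (arrow_cat C) s f\<rbrakk> \<Longrightarrow> \<rho> s k \<in> Hom (arrow_cat C) s g"
    and \<rho>_nat: "\<And>s s' u k. \<lbrakk>s \<in> Split C E; s' \<in> Split C E; u \<in> Hom (arrow_cat C) s s'; k \<in> Hom (arrow_cat C) s' f\<rbrakk>
      \<Longrightarrow> \<rho> s' k \<cdot>\<^bsub>arrow_cat C\<^esub> u = \<rho> s (k \<cdot>\<^bsub>arrow_cat C\<^esub> u)"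
  shows "\<exists>!w. w \<in> Hom (arrow_cat C) f g \<and> (\<forall>s \<in> Split C E. \<forall>k \<in> Hom (arrow_cat C) s f. w \<cdot>\<^bsub>arrow_cat C\<^esub> k = \<rho> s k)"
proof -
  let ?M = "arrow_cat C"
  interpret S: extension_class C "Split C E" by (rule split_class)
  note [simp] = E_arr[OF f] g
  have idn_S: "Idn C z \<in> Split C E" if "z \<in> Obj C" for z
    using S.E_iso iso_idn that by blast
  define pt where "pt a = (Idn C (Dom C a), f, a, f \<cdot> a)" for a
  have pt: "pt a \<in> Hom ?M (Idn C (Dom C a)) f" if "a \<in> Arr C" "Cod C a = Dom C f" for a
    using that by (simp add: pt_def arrow_cat_hom) (simp add: Hom_def)
  have "\<rho> (Idn C (Dom C f)) (pt (Idn C (Dom C f))) \<in> Hom ?M (Idn C (Dom C f)) g"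
    using pt[of "Idn C (Dom C f)"] by (intro \<rho> idn_S) simp_all
  then obtain r where r_eq: "\<rho> (Idn C (Dom C f)) (pt (Idn C (Dom C f))) = (Idn C (Dom C f), g, r, g \<cdot> r)"
    and r [simp]: "r \<in> Arr C" "Dom C r = Dom C f" "Cod C r = Dom C g"
    unfolding arrow_cat_hom by (auto simp: Hom_def)
  have \<rho>_pt: "\<rho> (Idn C (Dom C a)) (pt a) = (Idn C (Dom C a), g, r \<cdot> a, g \<cdot> r \<cdot> a)"
    if a [simp]: "a \<in> Arr C" "Cod C a = Dom C f" for a
  proof -
    let ?u = "(Idn C (Dom C a), Idn C (Dom C f), a, a)"
    have "?u \<in> Hom ?M (Idn C (Dom C a)) (Idn C (Dom C f))"
      by (simp add: arrow_cat_hom) (simp add: Hom_def)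
    from \<rho>_nat[OF idn_S idn_S this, of "pt (Idn C (Dom C f))"] pt[of "Idn C (Dom C f)"]
    have "\<rho> (Idn C (Dom C f)) (pt (Idn C (Dom C f))) \<cdot>\<^bsub>?M\<^esub> ?u = \<rho> (Idn C (Dom C a)) (pt (Idn C (Dom C f)) \<cdot>\<^bsub>?M\<^esub> ?u)"
      by simp
    moreover have "pt (Idn C (Dom C f)) \<cdot>\<^bsub>?M\<^esub> ?u = pt a"
      by (simp add: pt_def)
    ultimately show ?thesis
      by (simp add: r_eq)
  qed
  have components: "\<exists>x0. \<rho> s k = (s, g, r \<cdot> k1, x0) \<and> x0 \<in> Hom C (Cod C s) (Cod C g) \<and> x0 \<cdot> s = g \<cdot> r \<cdot> k1"
    if s: "s \<in> Split C E" and k: "k \<in> Hom ?M s f" "k = (s, f, k1, k0)" for s k k1 k0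
  proof -
    have t [simp]: "s \<in> Arr C" "k1 \<in> Arr C" "Dom C k1 = Dom C s" "Cod C k1 = Dom C f"
      "k0 \<in> Arr C" "Dom C k0 = Cod C s" "Cod C k0 = Cod C f" and sq: "f \<cdot> k1 = k0 \<cdot> s"
      using k unfolding arrow_cat_hom by (auto simp: Hom_def)
    obtain x1 x0 where x: "\<rho> s k = (s, g, x1, x0)" and xt: "x1 \<in> Arr C" "Dom C x1 = Dom C s" "Cod C x1 = Dom C g"
      and x0: "x0 \<in> Hom C (Cod C s) (Cod C g)"
      using \<rho>[OF s k(1)] unfolding arrow_cat_hom by (auto simp: Hom_def)
    let ?u = "(Idn C (Dom C s), s, Idn C (Dom C s), s)"
    have "?u \<in> Hom ?M (Idn C (Dom C s)) s"
      by (simp add: arrow_cat_hom) (simp add: Hom_def)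
    from \<rho>_nat[OF idn_S s this k(1)] have "\<rho> s k \<cdot>\<^bsub>?M\<^esub> ?u = \<rho> (Idn C (Dom C s)) (k \<cdot>\<^bsub>?M\<^esub> ?u)"
      by simp
    moreover have "k \<cdot>\<^bsub>?M\<^esub> ?u = pt k1"
      by (simp add: pt_def k(2) sq)
    ultimately have "x1 = r \<cdot> k1" "x0 \<cdot> s = g \<cdot> r \<cdot> k1"
      using \<rho>_pt[of k1] xt by (simp_all add: x)
    then show ?thesis using x x0 by blast
  qed
  obtain z u v where uv: "u \<in> Hom C z (Dom C f)" "v \<in> Hom C z (Dom C f)" and fuv: "f \<cdot> u = f \<cdot> v"
    and coeq: "\<And>y h. \<lbrakk>h \<in> Hom C (Dom C f) y; h \<cdot> u = h \<cdot> v\<rbrakk> \<Longrightarrow> \<exists>!w. w \<in> Hom C (Cod C f) y \<and> w \<cdot> f = h"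
    using regular unfolding regular_epi_def by blast
  note uvt [simp] = HomD(1-4)[OF uv(1)] HomD(1-3)[OF uv(2)]
  \<comment> \<open>The pullback of \<open>f\<close> along \<open>b = f \<cdot> u = f \<cdot> v\<close> is split, and both \<open>pt u\<close> and \<open>pt v\<close> factor through it by
    arrows that are identities on the base. So the base components of the cocone at \<open>pt u\<close> and \<open>pt v\<close> agree.\<close>
  define b where "b = f \<cdot> u"
  have [simp]: "b \<in> Arr C" "Dom C b = z" "Cod C b = Cod C f" by (simp_all add: b_def)
  note pbt [simp] = pb_typing[OF f, of b, simplified]
  let ?s = "bc b f"
  have pbb: "is_pullback C f b (pr b f) ?s"
    by (rule pb_along[OF f]) simp_all
  have "split_epi C ?s"
    by (rule split_epi_pullback[OF pbb, of u]) (simp_all add: b_def[symmetric])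
  moreover have "?s \<in> E"
    by (rule bc_E[OF f]) simp_all
  ultimately have s: "?s \<in> Split C E"
    by (simp add: Split_def)
  let ?k = "(?s, f, pr b f, b)"
  have k: "?k \<in> Hom ?M ?s f"
    by (simp add: arrow_cat_hom pullback_square[OF pbb]) (simp add: Hom_def)
  obtain x1 x0 where x: "\<rho> ?s ?k = (?s, g, x1, x0)" and xt [simp]: "x0 \<in> Arr C" "Dom C x0 = z"
    using \<rho>[OF s k] unfolding arrow_cat_hom by (auto simp: Hom_def)
  have base: "x0 = g \<cdot> r \<cdot> a" if a [simp]: "a \<in> Arr C" "Dom C a = z" "Cod C a = Dom C f" and fa: "f \<cdot> a = b" for a
  proof -
    obtain i where i [simp]: "i \<in> Arr C" "Dom C i = z" "Cod C i = Dom C ?s" and i_eq: "pr b f \<cdot> i = a" "?s \<cdot> i = Idn C z"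
      using pullback_lift[OF pbb, of a "Idn C z"] fa by auto
    let ?u = "(Idn C z, ?s, i, Idn C z)"
    have "?u \<in> Hom ?M (Idn C z) ?s"
      using i_eq by (simp add: arrow_cat_hom) (simp add: Hom_def)
    from \<rho>_nat[OF idn_S s this k] have "\<rho> ?s ?k \<cdot>\<^bsub>?M\<^esub> ?u = \<rho> (Idn C z) (?k \<cdot>\<^bsub>?M\<^esub> ?u)"
      by simp
    moreover have "?k \<cdot>\<^bsub>?M\<^esub> ?u = pt a"
      by (simp add: pt_def i_eq fa)
    ultimately show ?thesis
      using \<rho>_pt[of a] by (simp add: x)
  qed
  have "g \<cdot> r \<cdot> u = g \<cdot> r \<cdot> v"
    using base[of u] base[of v] fuv by (simp add: b_def)
  then obtain w0 where w0: "w0 \<in> Hom C (Cod C f) (Cod C g)" "w0 \<cdot> f = g \<cdot> r"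
    and w0_unique: "\<And>y. \<lbrakk>y \<in> Hom C (Cod C f) (Cod C g); y \<cdot> f = g \<cdot> r\<rbrakk> \<Longrightarrow> y = w0"
    using coeq[of "g \<cdot> r" "Cod C g"] by (auto simp: Hom_def)
  note [simp] = HomD[OF w0(1)]
  show ?thesis
  proof (rule ex1I[of _ "(f, g, r, w0)"], intro conjI ballI)
    show "(f, g, r, w0) \<in> Hom ?M f g"
      using w0 by (simp add: arrow_cat_hom) (simp add: Hom_def)
  next
    fix s k assume s: "s \<in> Split C E" and k: "k \<in> Hom ?M s f"
    then obtain k1 k0 where k_eq: "k = (s, f, k1, k0)" and t [simp]: "s \<in> Arr C" "k1 \<in> Arr C" "Dom C k1 = Dom C s"
      "Cod C k1 = Dom C f" "k0 \<in> Arr C" "Dom C k0 = Cod C s" "Cod C k0 = Cod C f" and sq: "f \<cdot> k1 = k0 \<cdot> s"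
      unfolding arrow_cat_hom by (auto simp: Hom_def)
    obtain x0 where x: "\<rho> s k = (s, g, r \<cdot> k1, x0)" "x0 \<cdot> s = g \<cdot> r \<cdot> k1" and x0: "x0 \<in> Hom C (Cod C s) (Cod C g)"
      using components[OF s k k_eq] by blast
    note [simp] = HomD[OF x0]
    have "w0 \<cdot> k0 = x0"
    proof (rule split_epi_cancel[of s])
      show "split_epi C s" using s by (simp add: Split_def)
      have "w0 \<cdot> (f \<cdot> k1) = (g \<cdot> r) \<cdot> k1"
        by (rule comp_eq_extend[OF w0(2)]) simp_all
      then show "(w0 \<cdot> k0) \<cdot> s = x0 \<cdot> s"
        using x(2) by (simp add: sq)
    qed simp_all
    then show "(f, g, r, w0) \<cdot>\<^bsub>?M\<^esub> k = \<rho> s k"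
      by (simp add: k_eq x(1)[unfolded k_eq])
  next
    fix w assume w: "w \<in> Hom ?M f g \<and> (\<forall>s \<in> Split C E. \<forall>k \<in> Hom ?M s f. w \<cdot>\<^bsub>?M\<^esub> k = \<rho> s k)"
    then obtain w1' w0' where w_eq: "w = (f, g, w1', w0')" and t: "w1' \<in> Hom C (Dom C f) (Dom C g)" "w0' \<in> Hom C (Cod C f) (Cod C g)"
      by (auto simp: arrow_cat_hom)
    note [simp] = HomD(1-3)[OF t(1)] HomD(1-3)[OF t(2)]
    have "w \<cdot>\<^bsub>?M\<^esub> pt (Idn C (Dom C f)) = \<rho> (Idn C (Dom C f)) (pt (Idn C (Dom C f)))"
      using w idn_S[of "Dom C f"] pt[of "Idn C (Dom C f)"] by simp
    then have "w1' = r" "w0' \<cdot> f = g \<cdot> r"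
      unfolding r_eq by (simp_all add: w_eq pt_def)
    then show "w = (f, g, r, w0)"
      using w0_unique[OF t(2)] w_eq by simp
  qed
qed

end

context split_admissible_galois
begin

abbreviation "M \<equiv> arrow_cat C"

text \<open>
  A square from a split epic \<open>t\<close> to the normal extension \<open>g\<close> factors through the pullback of \<open>g\<close> along its
  lower side, which is a trivial split epic extension; this reduces existence to the universal property
  of \<open>e s\<close>. For uniqueness the two lower sides must first be shown equal, so that both squares factor through
  one pullback. They are compared through the identity of the codomain of \<open>g\<close>, a trivial split epic
  extension that only sees lower sides.
\<close>

lemma reflection_universal_for_normal:
  assumes adj: "adjunction (Ext C (Split C E)) (TExt C I H \<eta> (Split C E)) T1 id_func e \<epsilon>1"
    and s: "s \<in> Split C E" and g: "normal g" and h: "h \<in> Hom M s g"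
  shows "\<exists>!k. k \<in> Hom M (FObj T1 s) g \<and> k \<cdot>\<^bsub>M\<^esub> e s = h"
proof -
  interpret adj: adjunction "Ext C (Split C E)" "TExt C I H \<eta> (Split C E)" T1 id_func e \<epsilon>1
    by (rule adj)
  let ?T = "FObj T1 s"
  have T: "trivial_split ?T"
    using adj.left.obj[of s] s by (simp add: Ext_def TExt_def)
  have T_split: "?T \<in> Split C E"
    using T by (simp add: trivial_ext_def)
  have univ: "\<exists>!k. k \<in> Hom M ?T t \<and> k \<cdot>\<^bsub>M\<^esub> e s = l" if "trivial_split t" "l \<in> Hom M s t" for t l
    using adj.universal_unit[of s t l] that s T by (simp add: Ext_def TExt_def Hom_full_subcat trivial_ext_def)
  have gE: "g \<in> E" using g by (simp add: normal_ext_def monadic_ext_def)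
  note [simp] = C.E_arr[OF gE] CS.E_arr[OF s] CS.E_arr[OF T_split]
  have "e s \<in> Hom M s ?T"
    using adj.unit.component[of s] s T_split by (simp add: Ext_def Hom_full_subcat)
  then obtain e1 e0 where e: "e s = (s, ?T, e1, e0)" and et: "e1 \<in> Hom C (Dom C s) (Dom C ?T)" "e0 \<in> Hom C (Cod C s) (Cod C ?T)"
    and esq: "?T \<cdot>\<^bsub>C\<^esub> e1 = e0 \<cdot>\<^bsub>C\<^esub> s"
    by (auto simp: arrow_cat_hom)
  note [simp] = C.HomD(1-3)[OF et(1)] C.HomD(1-3)[OF et(2)]
  have factor: "\<exists>t p. trivial_split t \<and> is_pullback C g h0 p t"
    if t: "t \<in> Split C E" and l: "(t, g, h1, h0) \<in> Hom M t g" for t h1 h0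
  proof -
    have [simp]: "t \<in> Arr C" "h1 \<in> Arr C" "Dom C h1 = Dom C t" "Cod C h1 = Dom C g" "h0 \<in> Arr C"
      "Dom C h0 = Cod C t" "Cod C h0 = Cod C g" and sq: "g \<cdot>\<^bsub>C\<^esub> h1 = h0 \<cdot>\<^bsub>C\<^esub> t"
      using l unfolding arrow_cat_hom by (auto simp: Hom_def)
    obtain \<sigma> where [simp]: "\<sigma> \<in> Arr C" "Dom C \<sigma> = Cod C t" "Cod C \<sigma> = Dom C t" and \<sigma>: "t \<cdot>\<^bsub>C\<^esub> \<sigma> = Idn C (Cod C t)"
      using t C.split_epiE[of t] by (auto simp: Split_def)
    have "g \<cdot>\<^bsub>C\<^esub> (h1 \<cdot>\<^bsub>C\<^esub> \<sigma>) = h0 \<cdot>\<^bsub>C\<^esub> (t \<cdot>\<^bsub>C\<^esub> \<sigma>)"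
      by (rule C.square_extend[OF sq]) simp_all
    then have h0_eq: "g \<cdot>\<^bsub>C\<^esub> (h1 \<cdot>\<^bsub>C\<^esub> \<sigma>) = h0"
      by (simp add: \<sigma>)
    obtain p t where "is_pullback C g (g \<cdot>\<^bsub>C\<^esub> (h1 \<cdot>\<^bsub>C\<^esub> \<sigma>)) p t" "trivial_split t"
      by (rule normal_pullback_trivial_split[OF g, of "h1 \<cdot>\<^bsub>C\<^esub> \<sigma>"]) simp_all
    then show ?thesis
      unfolding h0_eq by blast
  qed
  show ?thesis
  proof (rule ex_ex1I)
    obtain h1 h0 where h_eq: "h = (s, g, h1, h0)" and ht [simp]: "h1 \<in> Arr C" "Dom C h1 = Dom C s" "Cod C h1 = Dom C g"
      "h0 \<in> Arr C" "Dom C h0 = Cod C s" "Cod C h0 = Cod C g" and hsq: "g \<cdot>\<^bsub>C\<^esub> h1 = h0 \<cdot>\<^bsub>C\<^esub> s"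
      using h unfolding arrow_cat_hom by (auto simp: Hom_def)
    obtain t p where t: "trivial_split t" and pb: "is_pullback C g h0 p t"
      using factor[OF s, of h1 h0] h h_eq by auto
    note pt [simp] = C.pullback_arr(3,4,6-)[OF pb]
    obtain l where [simp]: "l \<in> Arr C" "Dom C l = Dom C s" "Cod C l = Dom C t" and l: "p \<cdot>\<^bsub>C\<^esub> l = h1" "t \<cdot>\<^bsub>C\<^esub> l = s"
      using C.pullback_lift[OF pb, of h1 s] hsq by auto
    have "(s, t, l, Idn C (Cod C s)) \<in> Hom M s t"
      using l by (simp add: arrow_cat_hom) (simp add: Hom_def)
    then obtain k where k: "k \<in> Hom M ?T t" "k \<cdot>\<^bsub>M\<^esub> e s = (s, t, l, Idn C (Cod C s))"
      using univ[OF t] by blast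
    then obtain k1 k0 where k_eq: "k = (?T, t, k1, k0)" and kt: "k1 \<in> Hom C (Dom C ?T) (Dom C t)" "k0 \<in> Hom C (Cod C ?T) (Cod C s)"
      and ksq: "t \<cdot>\<^bsub>C\<^esub> k1 = k0 \<cdot>\<^bsub>C\<^esub> ?T"
      by (auto simp: arrow_cat_hom)
    note [simp] = C.HomD(1-3)[OF kt(1)] C.HomD(1-3)[OF kt(2)]
    have ke: "k1 \<cdot>\<^bsub>C\<^esub> e1 = l" "k0 \<cdot>\<^bsub>C\<^esub> e0 = Idn C (Cod C s)"
      using k(2) by (simp_all add: k_eq e)
    show "\<exists>k. k \<in> Hom M ?T g \<and> k \<cdot>\<^bsub>M\<^esub> e s = h"
    proof (intro exI conjI)
      have "g \<cdot>\<^bsub>C\<^esub> (p \<cdot>\<^bsub>C\<^esub> k1) = h0 \<cdot>\<^bsub>C\<^esub> (t \<cdot>\<^bsub>C\<^esub> k1)"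
        by (rule C.square_extend[OF C.pullback_square[OF pb]]) simp_all
      then show "(?T, g, p \<cdot>\<^bsub>C\<^esub> k1, h0 \<cdot>\<^bsub>C\<^esub> k0) \<in> Hom M ?T g"
        by (simp add: arrow_cat_hom ksq) (simp add: Hom_def)
      show "(?T, g, p \<cdot>\<^bsub>C\<^esub> k1, h0 \<cdot>\<^bsub>C\<^esub> k0) \<cdot>\<^bsub>M\<^esub> e s = h"
        by (simp add: e h_eq ke l)
    qed
  next
    fix k k' assume k: "k \<in> Hom M ?T g \<and> k \<cdot>\<^bsub>M\<^esub> e s = h" and k': "k' \<in> Hom M ?T g \<and> k' \<cdot>\<^bsub>M\<^esub> e s = h"
    obtain k1 k0 where k_eq: "k = (?T, g, k1, k0)" and kt: "k1 \<in> Hom C (Dom C ?T) (Dom C g)" "k0 \<in> Hom C (Cod C ?T) (Cod C g)"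
      and ksq: "g \<cdot>\<^bsub>C\<^esub> k1 = k0 \<cdot>\<^bsub>C\<^esub> ?T"
      using k by (auto simp: arrow_cat_hom)
    obtain k1' k0' where k'_eq: "k' = (?T, g, k1', k0')" and k't: "k1' \<in> Hom C (Dom C ?T) (Dom C g)" "k0' \<in> Hom C (Cod C ?T) (Cod C g)"
      and k'sq: "g \<cdot>\<^bsub>C\<^esub> k1' = k0' \<cdot>\<^bsub>C\<^esub> ?T"
      using k' by (auto simp: arrow_cat_hom)
    note [simp] = C.HomD(1-3)[OF kt(1)] C.HomD(1-3)[OF kt(2)] C.HomD(1-3)[OF k't(1)] C.HomD(1-3)[OF k't(2)]
    have same: "k1 \<cdot>\<^bsub>C\<^esub> e1 = k1' \<cdot>\<^bsub>C\<^esub> e1" "k0 \<cdot>\<^bsub>C\<^esub> e0 = k0' \<cdot>\<^bsub>C\<^esub> e0"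
      using k k' by (auto simp: k_eq k'_eq e)
    have base: "k0 = k0'"
    proof -
      let ?i = "Idn C (Cod C g)"
      have i: "trivial_split ?i" by (rule trivial_split_idn) simp
      have "(?T, ?i, g \<cdot>\<^bsub>C\<^esub> k1, k0) \<in> Hom M ?T ?i" "(?T, ?i, g \<cdot>\<^bsub>C\<^esub> k1', k0') \<in> Hom M ?T ?i"
        by (simp_all add: arrow_cat_hom ksq k'sq) (simp_all add: Hom_def)
      moreover have "(s, ?i, k0 \<cdot>\<^bsub>C\<^esub> e0 \<cdot>\<^bsub>C\<^esub> s, k0 \<cdot>\<^bsub>C\<^esub> e0) \<in> Hom M s ?i"
        by (simp add: arrow_cat_hom) (simp add: Hom_def)
      moreover have "(?T, ?i, g \<cdot>\<^bsub>C\<^esub> k1, k0) \<cdot>\<^bsub>M\<^esub> e s = (s, ?i, k0 \<cdot>\<^bsub>C\<^esub> e0 \<cdot>\<^bsub>C\<^esub> s, k0 \<cdot>\<^bsub>C\<^esub> e0)"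
        by (simp add: e ksq esq)
      moreover have "k0' \<cdot>\<^bsub>C\<^esub> e0 \<cdot>\<^bsub>C\<^esub> s = k0 \<cdot>\<^bsub>C\<^esub> e0 \<cdot>\<^bsub>C\<^esub> s"
        by (rule C.square_extend[OF same(2)[symmetric]]) simp_all
      then have "(?T, ?i, g \<cdot>\<^bsub>C\<^esub> k1', k0') \<cdot>\<^bsub>M\<^esub> e s = (s, ?i, k0 \<cdot>\<^bsub>C\<^esub> e0 \<cdot>\<^bsub>C\<^esub> s, k0 \<cdot>\<^bsub>C\<^esub> e0)"
        by (simp add: e k'sq esq same)
      ultimately have "(?T, ?i, g \<cdot>\<^bsub>C\<^esub> k1, k0) = (?T, ?i, g \<cdot>\<^bsub>C\<^esub> k1', k0')"
        by (intro ex1_implies_eq[OF univ[OF i]]) auto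
      then show ?thesis by simp
    qed
    obtain t p where t: "trivial_split t" and pb: "is_pullback C g k0 p t"
      using factor[OF T_split, of k1 k0] k k_eq by auto
    note pt [simp] = C.pullback_arr(3,4,6-)[OF pb]
    obtain l where [simp]: "l \<in> Arr C" "Dom C l = Dom C ?T" "Cod C l = Dom C t" and l: "p \<cdot>\<^bsub>C\<^esub> l = k1" "t \<cdot>\<^bsub>C\<^esub> l = ?T"
      using C.pullback_lift[OF pb, of k1 ?T] ksq by auto
    obtain l' where [simp]: "l' \<in> Arr C" "Dom C l' = Dom C ?T" "Cod C l' = Dom C t" and l': "p \<cdot>\<^bsub>C\<^esub> l' = k1'" "t \<cdot>\<^bsub>C\<^esub> l' = ?T"
      using C.pullback_lift[OF pb, of k1' ?T] k'sq base by auto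
    have le: "l \<cdot>\<^bsub>C\<^esub> e1 = l' \<cdot>\<^bsub>C\<^esub> e1"
    proof (rule C.pullback_unique[OF pb])
      show "p \<cdot>\<^bsub>C\<^esub> l \<cdot>\<^bsub>C\<^esub> e1 = p \<cdot>\<^bsub>C\<^esub> l' \<cdot>\<^bsub>C\<^esub> e1"
        by (simp add: C.comp_eq_extend[OF l(1)] C.comp_eq_extend[OF l'(1)] same)
      show "t \<cdot>\<^bsub>C\<^esub> l \<cdot>\<^bsub>C\<^esub> e1 = t \<cdot>\<^bsub>C\<^esub> l' \<cdot>\<^bsub>C\<^esub> e1"
        by (simp add: C.comp_eq_extend[OF l(2)] C.comp_eq_extend[OF l'(2)])
    qed simp_all
    let ?l = "(?T, t, l, Idn C (Cod C ?T))" and ?l' = "(?T, t, l', Idn C (Cod C ?T))"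
    have hom: "?l \<in> Hom M ?T t" "?l' \<in> Hom M ?T t"
      by (simp_all add: arrow_cat_hom l l') (simp_all add: Hom_def)
    have "?l \<cdot>\<^bsub>M\<^esub> e s = (s, t, l' \<cdot>\<^bsub>C\<^esub> e1, e0)" "?l' \<cdot>\<^bsub>M\<^esub> e s = (s, t, l' \<cdot>\<^bsub>C\<^esub> e1, e0)"
      by (simp_all add: e le)
    moreover have "(s, t, l' \<cdot>\<^bsub>C\<^esub> e1, e0) \<in> Hom M s t"
      by (simp add: arrow_cat_hom C.comp_eq_extend[OF l'(2)] esq) (simp add: Hom_def)
    ultimately have "?l = ?l'"
      using hom by (intro ex1_implies_eq[OF univ[OF t]]) auto
    then have "k1 = k1'"
      using l l' by simp
    then show "k = k'"
      by (simp add: k_eq k'_eq base)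
  qed
qed

lemma normal_reflection:
  assumes regular: "\<forall>f \<in> E. regular_epi C f"
    and adj: "adjunction (Ext C (Split C E)) (TExt C I H \<eta> (Split C E)) T1 id_func e \<epsilon>1"
  shows "densely_reflective (arrow_cat C) (Split C E) E {f. normal f} {f. trivial_split f} T1 e"
proof -
  interpret adj: adjunction "Ext C (Split C E)" "TExt C I H \<eta> (Split C E)" T1 id_func e \<epsilon>1
    by (rule adj)
  show ?thesis
  proof (intro densely_reflective.intro densely_reflective_axioms.intro)
    show "category M" by (rule C.category_arrow_cat)
    show "Split C E \<subseteq> E" by (auto simp: Split_def)
    show "{f. trivial_split f} \<subseteq> {f. normal f}" using trivial_split_normal by blast
    show "{f. normal f} \<subseteq> E" by (auto simp: normal_ext_def monadic_ext_def)
    show "E \<subseteq> Obj M" using C.E_sub by simp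
    show "cat_functor (full_subcat M (Split C E)) (full_subcat M {f. trivial_split f}) T1"
      using adj.left.cat_functor_axioms by (simp add: Ext_def TExt_def)
    show "e s \<in> Hom M s (FObj T1 s)" if "s \<in> Split C E" for s
      using adj.unit.component[of s] that by (simp add: Ext_def Hom_full_subcat split: if_splits)
    show "e s' \<cdot>\<^bsub>M\<^esub> u = FArr T1 u \<cdot>\<^bsub>M\<^esub> e s" if "s \<in> Split C E" "s' \<in> Split C E" "u \<in> Hom M s s'" for s s' u
      using adj.unit.naturality[of u s s'] that by (simp add: Ext_def Hom_full_subcat)
    show "\<exists>!k. k \<in> Hom M (FObj T1 s) g \<and> k \<cdot>\<^bsub>M\<^esub> e s = h"
      if "s \<in> Split C E" "g \<in> {f. normal f}" "h \<in> Hom M s g" for s g h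
      using reflection_universal_for_normal[OF adj] that by simp
    show "\<exists>!w. w \<in> Hom M f g \<and> (\<forall>s \<in> Split C E. \<forall>k \<in> Hom M s f. w \<cdot>\<^bsub>M\<^esub> k = \<rho> s k)"
      if f: "f \<in> E" and g: "g \<in> {f. normal f}"
        and \<rho>: "\<And>s k. \<lbrakk>s \<in> Split C E; k \<in> Hom M s f\<rbrakk> \<Longrightarrow> \<rho> s k \<in> Hom M s g"
          "\<And>s s' u k. \<lbrakk>s \<in> Split C E; s' \<in> Split C E; u \<in> Hom M s s'; k \<in> Hom M s' f\<rbrakk> \<Longrightarrow> \<rho> s' k \<cdot>\<^bsub>M\<^esub> u = \<rho> s (k \<cdot>\<^bsub>M\<^esub> u)"
      for f g \<rho>
    proof (rule C.split_extensions_dense[OF f _ _ \<rho>])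
      show "regular_epi C f" using regular f by blast
      show "g \<in> Arr C" using g C.E_arr by (auto simp: normal_ext_def monadic_ext_def)
    qed
  qed
qed

end

theorem theorem4p3:
  fixes C :: "('o, 'a) cat" and X :: "('p, 'b) cat"
    and I :: "('o, 'a, 'p, 'b) func" and H :: "('p, 'b, 'o, 'a) func"
    and \<eta> :: "'o \<Rightarrow> 'a" and \<epsilon> :: "'p \<Rightarrow> 'b"
    and E :: "'a set" and F :: "'b set"
    and K K' H\<^sub>1 T\<^sub>1 :: "('a, 'a \<times> 'a \<times> 'a \<times> 'a, 'a, 'a \<times> 'a \<times> 'a \<times> 'a) func"
  defines "K \<equiv> inclusion" \<comment> \<open>from split epic extensions to extensions\<close>
    and "K' \<equiv> inclusion" \<comment> \<open>from split epic trivial extensions to normal extensions\<close>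
    and "H\<^sub>1 \<equiv> inclusion" \<comment> \<open>from normal extensions to extensions\<close>
  assumes galois: "galois_structure C X I H \<eta> \<epsilon> E F"
    and split_admissible: "admissible C X I H \<eta> (Split C E) (Split X F)"
    and regular: "\<forall>f \<in> E. regular_epi C f"
    and T\<^sub>1: "left_adjoint (Ext C (Split C E)) (TExt C I H \<eta> (Split C E)) T\<^sub>1 inclusion"
  shows "((\<exists>I\<^sub>1. left_adjoint (Ext C E) (NExt C I H \<eta> E) I\<^sub>1 H\<^sub>1) \<longleftrightarrow>
          (\<exists>L \<alpha>. is_pointwise_left_kan_extension
                   (Ext C (Split C E)) (Ext C E) (NExt C I H \<eta> E) K (K' \<circ>\<^sub>F T\<^sub>1) L \<alpha>)) \<and>
         (\<forall>I\<^sub>1 L \<alpha>. left_adjoint (Ext C E) (NExt C I H \<eta> E) I\<^sub>1 H\<^sub>1 \<longrightarrow>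
            is_pointwise_left_kan_extension
              (Ext C (Split C E)) (Ext C E) (NExt C I H \<eta> E) K (K' \<circ>\<^sub>F T\<^sub>1) L \<alpha> \<longrightarrow>
            naturally_isomorphic (Ext C E) (NExt C I H \<eta> E) I\<^sub>1 L)"
proof -
  interpret G: galois_structure C X I H \<eta> \<epsilon> E F by (rule galois)
  interpret split_admissible_galois C X I H \<eta> \<epsilon> E F
    by (intro split_admissible_galois.intro split_admissible_galois_axioms.intro galois split_admissible
        G.unit.F.A.category_axioms G.counit.F.A.category_axioms)
  obtain e \<epsilon>1 where "adjunction (Ext C (Split C E)) (TExt C I H \<eta> (Split C E)) T\<^sub>1 id_func e \<epsilon>1"
    using T\<^sub>1 unfolding left_adjoint_def by blast
  from normal_reflection[OF regular this]
  interpret densely_reflective "arrow_cat C" "Split C E" E "{f. normal_ext C I H \<eta> E f}"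
    "{f. trivial_ext C I H \<eta> (Split C E) f}" T\<^sub>1 e .
  show ?thesis
    unfolding K_def K'_def H\<^sub>1_def Ext_def NExt_def by (rule reflection_iff_pointwise_kan)
qed

end
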